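(* Let $\phi\in\mathcal S_d$ with $\sup_\xi|\widehat\phi(\xi)|=1$ and suppose $\Omega(\phi)=\{\xi_0\}$, where $\xi_0$ is of positive homogeneous type or of imaginary homogeneous type for $\widehat\phi$, with drift $\alpha_{\xi_0}$ and homogeneous order $\mu_{\xi_0}=\mu_\phi$; in the imaginary case assume additionally $\mu_{\xi_0}<1$. (1) If $\xi_0$ is of positive homogeneous type, then $\phi^{(n)}(x)=\widehat\phi(\xi_0)^ne^{-ix\cdot\xi_0}H^n_{P_{\xi_0}}(x-n\alpha_{\xi_0})+o(n^{-\mu_\phi})$ uniformly for $x\in\mathbb{Z}^d$ as $n\to\infty$. (2) If $\xi_0$ is of imaginary homogeneous type, then for every compact $K\subseteq\mathbb{R}^d$ and every $E\in\mathrm{Exp}(Q_{\xi_0})$, $\phi^{(n)}(x)=\widehat\phi(\xi_0)^ne^{-ix\cdot\xi_0}H^n_{iQ_{\xi_0}}(x-n\alpha_{\xi_0})+o(n^{-\mu_\phi})$ uniformly for $x\in(n\alpha_{\xi_0}+n^{E^*}(K))\cap\mathbb{Z}^d$.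
   Context: Notation: $t^E:=\exp(\log(t)E)$; $E^*$ adjoint. $P$ homogeneous w.r.t. $E$: $P(t^E\xi)=tP(\xi)$; $\mathrm{Exp}(P)$ = set of such $E$. Positive homogeneous: real, continuous, positive definite ($\ge0$, zero only at $0$), $\mathrm{Exp}(P)\ne\emptyset$, $\{P=1\}$ compact; homogeneous order $\mu_P=\mathrm{tr}E$, $E\in\mathrm{Exp}(P)$. For $E$ with $\|t^E\|\to0$ as $t\to0$: subhomogeneous w.r.t. $E$ means for each $\epsilon>0$, compact $K$ there is $\tau>0$ with $|\widetilde P(t^E\xi)|\le\epsilon t$, $0<t<\tau$, $\xi\in K$; strongly subhomogeneous of order $l$: $C^l$ near $0$ and $|t^k\partial_t^k\widetilde P(t^E\xi)|\le\epsilon t$ for all $k\le l$. $\mathcal S_d$ = $\phi:\mathbb{Z}^d\to\mathbb{C}$ with $\sum_x|x^\beta\phi(x)|<\infty$ for all multi-indices $\beta$; $\widehat\phi(\xi)=\sum_x\phi(x)e^{ix\cdot\xi}$; $\phi^{(1)}=\phi$, $\phi^{(n)}(x)=\sum_y\phi^{(n-1)}(x-y)\phi(y)$; $\Omega(\phi)=\{\xi\in(-\pi,\pi]^d:|\widehat\phi(\xi)|=1\}$. For $\xi_0\in\Omega(\phi)$, $\Gamma_{\xi_0}(\xi)=\log(\widehat\phi(\xi+\xi_0)/\widehat\phi(\xi_0))$ (principal branch) on a convex neighborhood of $0$, written $i\alpha\cdot\xi-i(Q+\widetilde Q)-(R+\widetilde R)$ with $\alpha\in\mathbb{R}^d$,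 $Q,R$ real polynomials vanishing at $0$ without linear terms, $\widetilde Q,\widetilde R$ real smooth vanishing at $0$. Positive homogeneous type: such a decomposition with $R$ positive homogeneous and some $E\in\mathrm{Exp}(R)$ with $Q$ homogeneous w.r.t. $E$ and $\widetilde Q,\widetilde R$ subhomogeneous w.r.t. $E$; set $P_{\xi_0}=R+iQ$, $\mu_{\xi_0}=\mu_R$. Imaginary homogeneous type: $|Q|,R$ positive homogeneous, some $E\in\mathrm{Exp}(|Q|)$ and $k>1$ with $R$ homogeneous w.r.t. $E/k$, $\widetilde Q$ strongly subhomogeneous w.r.t. $E$ of order 2, $\widetilde R$ strongly subhomogeneous w.r.t. $E/k$ of order 1; $Q_{\xi_0}=Q$, $\mu_{\xi_0}=\mu_{|Q|}$. Drift $\alpha_{\xi_0}=\alpha$. $\mu_\phi=\min_{\xi\in\Omega(\phi)}\mu_\xi$. Attractors: $H^t_P(x)=(2\pi)^{-d}\int_{\mathbb{R}^d}e^{-tP(\xi)}e^{-ix\cdot\xi}d\xi$; for continuous real $Q$ with $|Q|$ positive homogeneous and $\mu_{|Q|}<1$, $H^t_{iQ}(x)=(2\pi)^{-d}\lim_{\tau\to\infty}\int_{\{|Q|<\tau\}}e^{-itQ(\xi)-ix\cdot\xi}d\xi$ (limit exists). *)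

theory Defs
  imports "HOL-Analysis.Analysis"
begin

definition lat :: "int^'d::finite \<Rightarrow> real^'d" where
  "lat x = (\<chi> i. real_of_int (x$i))"

definition S_d :: "(int^'d::finite \<Rightarrow> complex) set" where
  "S_d = {\<phi>. \<forall>\<beta>::'d \<Rightarrow> nat.
            (\<lambda>x. norm (of_int (\<Prod>i\<in>UNIV. (x$i) ^ \<beta> i) * \<phi> x)) summable_on UNIV}"

definition fhat :: "(int^'d::finite \<Rightarrow> complex) \<Rightarrow> real^'d \<Rightarrow> complex" where
  "fhat \<phi> \<xi> = (\<Sum>\<^sub>\<infinity>x. \<phi> x * cis (lat x \<bullet> \<xi>))"

primrec cpow :: "(int^'d::finite \<Rightarrow> complex) \<Rightarrow> nat \<Rightarrow> int^'d \<Rightarrow> complex" where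
  "cpow \<phi> 0 = (\<lambda>x. if x = 0 then 1 else 0)"
| "cpow \<phi> (Suc n) = (\<lambda>x. \<Sum>\<^sub>\<infinity>y. cpow \<phi> n (x - y) * \<phi> y)"

definition Omega :: "(int^'d::finite \<Rightarrow> complex) \<Rightarrow> (real^'d) set" where
  "Omega \<phi> = {\<xi>. (\<forall>i. - pi < \<xi>$i \<and> \<xi>$i \<le> pi) \<and> norm (fhat \<phi> \<xi>) = 1}"

primrec mpow :: "real^'d::finite^'d \<Rightarrow> nat \<Rightarrow> real^'d^'d" where
  "mpow A 0 = mat 1"
| "mpow A (Suc k) = A ** mpow A k"

definition mexp :: "real^'d::finite^'d \<Rightarrow> real^'d^'d" where
  "mexp A = (\<Sum>k. (1 / fact k) *\<^sub>R mpow A k)"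

definition tpow :: "real \<Rightarrow> real^'d::finite^'d \<Rightarrow> real^'d^'d" where
  "tpow t E = mexp (ln t *\<^sub>R E)"

definition hom_wrt :: "real^'d::finite^'d \<Rightarrow> (real^'d \<Rightarrow> real) \<Rightarrow> bool" where
  "hom_wrt E P \<longleftrightarrow> (\<forall>t>0. \<forall>\<xi>. P (tpow t E *v \<xi>) = t * P \<xi>)"

definition Exp :: "(real^'d::finite \<Rightarrow> real) \<Rightarrow> (real^'d^'d) set" where
  "Exp P = {E. hom_wrt E P}"

definition pos_hom :: "(real^'d::finite \<Rightarrow> real) \<Rightarrow> bool" where
  "pos_hom P \<longleftrightarrow> continuous_on UNIV P \<and> (\<forall>\<xi>. 0 \<le> P \<xi>) \<and> (\<forall>\<xi>. P \<xi> = 0 \<longleftrightarrow> \<xi> = 0)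
     \<and> Exp P \<noteq> {} \<and> compact {\<xi>. P \<xi> = 1}"

text \<open>homogeneous order mu_P = tr E for E in Exp(P) (independent of the choice)\<close>
definition mu :: "(real^'d::finite \<Rightarrow> real) \<Rightarrow> real" where
  "mu P = trace (SOME E. E \<in> Exp P)"

definition contracting :: "real^'d::finite^'d \<Rightarrow> bool" where
  "contracting E \<longleftrightarrow> ((\<lambda>t. onorm (\<lambda>v. tpow t E *v v)) \<longlongrightarrow> 0) (at_right 0)"

definition subhom :: "real^'d::finite^'d \<Rightarrow> (real^'d \<Rightarrow> real) \<Rightarrow> bool" where
  "subhom E f \<longleftrightarrow> contracting E \<and>
     (\<forall>\<epsilon>>0. \<forall>K. compact K \<longrightarrow>
        (\<exists>\<tau>>0. \<forall>t. 0 < t \<and> t < \<tau> \<longrightarrow> (\<forall>\<xi>\<in>K. \<bar>f (tpow t E *v \<xi>)\<bar> \<le> \<epsilon> * t)))"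

primrec Ck :: "nat \<Rightarrow> (real^'d::finite) set \<Rightarrow> (real^'d \<Rightarrow> real) \<Rightarrow> bool" where
  "Ck 0 U f = continuous_on U f"
| "Ck (Suc k) U f = (continuous_on U f \<and> (\<forall>x\<in>U. f differentiable (at x)) \<and>
      (\<forall>i. Ck k U (\<lambda>x. frechet_derivative f (at x) (axis i 1))))"

definition smooth_on :: "(real^'d::finite) set \<Rightarrow> (real^'d \<Rightarrow> real) \<Rightarrow> bool" where
  "smooth_on U f \<longleftrightarrow> (\<forall>k. Ck k U f)"

definition strong_subhom :: "real^'d::finite^'d \<Rightarrow> nat \<Rightarrow> (real^'d \<Rightarrow> real) \<Rightarrow> bool" where
  "strong_subhom E l f \<longleftrightarrow> contracting E \<and> (\<exists>U. open U \<and> 0 \<in> U \<and> Ck l U f) \<and>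
     (\<forall>\<epsilon>>0. \<forall>K. compact K \<longrightarrow>
        (\<exists>\<tau>>0. \<forall>t. 0 < t \<and> t < \<tau> \<longrightarrow> (\<forall>\<xi>\<in>K. \<forall>k\<le>l.
            \<bar>t ^ k * (deriv ^^ k) (\<lambda>s. f (tpow s E *v \<xi>)) t\<bar> \<le> \<epsilon> * t)))"

definition poly_nolin :: "(real^'d::finite \<Rightarrow> real) \<Rightarrow> bool" where
  "poly_nolin Q \<longleftrightarrow> (\<exists>B c. finite B \<and> (\<forall>\<beta>\<in>B. 2 \<le> sum \<beta> UNIV) \<and>
      Q = (\<lambda>\<xi>. \<Sum>\<beta>\<in>B. c \<beta> * (\<Prod>i\<in>UNIV. (\<xi>$i) ^ \<beta> i)))"

definition log_decomp ::
  "(int^'d::finite \<Rightarrow> complex) \<Rightarrow> real^'d \<Rightarrow> (real^'d) set \<Rightarrow> real^'d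
     \<Rightarrow> (real^'d \<Rightarrow> real) \<Rightarrow> (real^'d \<Rightarrow> real) \<Rightarrow> (real^'d \<Rightarrow> real) \<Rightarrow> (real^'d \<Rightarrow> real) \<Rightarrow> bool" where
  "log_decomp \<phi> \<xi>0 U \<alpha> Q Qt R Rt \<longleftrightarrow>
     open U \<and> convex U \<and> 0 \<in> U \<and>
     (\<forall>\<xi>\<in>U. fhat \<phi> (\<xi> + \<xi>0) \<noteq> 0 \<and>
        Ln (fhat \<phi> (\<xi> + \<xi>0) / fhat \<phi> \<xi>0)
          = \<i> * of_real (\<alpha> \<bullet> \<xi>) - \<i> * of_real (Q \<xi> + Qt \<xi>) - of_real (R \<xi> + Rt \<xi>)) \<and>
     poly_nolin Q \<and> poly_nolin R \<and> smooth_on U Qt \<and> smooth_on U Rt \<and> Qt 0 = 0 \<and> Rt 0 = 0"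

text \<open>xi0 is of positive homogeneous type, with drift alpha and P_xi0 = R + iQ.\<close>
definition pos_type ::
  "(int^'d::finite \<Rightarrow> complex) \<Rightarrow> real^'d \<Rightarrow> real^'d \<Rightarrow> (real^'d \<Rightarrow> real) \<Rightarrow> (real^'d \<Rightarrow> real) \<Rightarrow> bool" where
  "pos_type \<phi> \<xi>0 \<alpha> Q R \<longleftrightarrow> (\<exists>U Qt Rt E. log_decomp \<phi> \<xi>0 U \<alpha> Q Qt R Rt \<and>
      pos_hom R \<and> E \<in> Exp R \<and> hom_wrt E Q \<and> subhom E Qt \<and> subhom E Rt)"

definition im_type ::
  "(int^'d::finite \<Rightarrow> complex) \<Rightarrow> real^'d \<Rightarrow> real^'d \<Rightarrow> (real^'d \<Rightarrow> real) \<Rightarrow> (real^'d \<Rightarrow> real) \<Rightarrow> bool" where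
  "im_type \<phi> \<xi>0 \<alpha> Q R \<longleftrightarrow> (\<exists>U Qt Rt E k. log_decomp \<phi> \<xi>0 U \<alpha> Q Qt R Rt \<and>
      pos_hom (\<lambda>\<xi>. \<bar>Q \<xi>\<bar>) \<and> pos_hom R \<and> E \<in> Exp (\<lambda>\<xi>. \<bar>Q \<xi>\<bar>) \<and> 1 < k \<and>
      hom_wrt ((1 / k) *\<^sub>R E) R \<and>
      strong_subhom E 2 Qt \<and> strong_subhom ((1 / k) *\<^sub>R E) 1 Rt)"

definition H_pos :: "real \<Rightarrow> (real^'d::finite \<Rightarrow> complex) \<Rightarrow> real^'d \<Rightarrow> complex" where
  "H_pos t P x = (1 / (2 * pi)) ^ CARD('d) *
     integral UNIV (\<lambda>\<xi>. exp (- (of_real t * P \<xi>)) * cis (- (x \<bullet> \<xi>)))"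

definition H_im :: "real \<Rightarrow> (real^'d::finite \<Rightarrow> real) \<Rightarrow> real^'d \<Rightarrow> complex" where
  "H_im t Q x = (1 / (2 * pi)) ^ CARD('d) *
     Lim at_top (\<lambda>\<tau>. integral {\<xi>. \<bar>Q \<xi>\<bar> < \<tau>} (\<lambda>\<xi>. cis (- (t * Q \<xi>) - x \<bullet> \<xi>)))"

end

theory Submission
  imports Defs "HOL-Real_Asymp.Real_Asymp"
begin

text \<open>
  Fourier inversion writes \<open>cpow \<phi> n x\<close> as an integral of \<open>fhat \<phi> ^ n\<close> over a period cube centred at \<open>\<xi>0\<close>.
  Off a neighbourhood of \<open>\<xi>0\<close> the integrand is geometrically small; near \<open>\<xi>0\<close> the substitution
  \<open>\<xi> = n^(-E) \<eta>\<close>, with Jacobian \<open>n^(-tr E)\<close>, turns the expansion of the logarithm into its homogeneous part plus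
  an error that vanishes pointwise.

  In the positive case \<open>exp (- R / 2)\<close> dominates and dominated convergence finishes the proof. In the imaginary
  case the limit integral converges only conditionally. Dominated convergence still handles \<open>{|Q| < \<tau>}\<close>, and it
  remains to bound the integrals over \<open>{\<tau> \<le> |Q| < n \<delta>}\<close> by \<open>C \<tau>^(\<mu> - 1)\<close>, uniformly in \<open>n\<close>. Averaging over the
  orbits \<open>r \<mapsto> r^E \<omega>\<close> with \<open>\<omega>\<close> in the annulus \<open>{1 \<le> |Q| \<le> e}\<close> reduces this to one-dimensional integrals of
  \<open>r^(\<mu> - 1)\<close> against a phase \<open>r Q \<omega> + \<kappa> \<bullet> r^E \<omega> + \<dots>\<close>, which are integrated by parts. The linear term is harmless
  because \<open>Q\<close> has no linear part, which forces \<open>|r^E| = O(r^(1/2))\<close>.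
\<close>

section \<open>The matrix exponential\<close>

text \<open>The two cases differ in the source of uniformity. With absolutely integrable limits the
  character is discarded inside a norm, so all lattice points are treated at once. Without them the
  character belongs to the phase: writing the displacement as the adjoint dilation of a vector
  \<kappa> turns the linear term into \<kappa> \<bullet> x, free of n, and all constants depend only
  on a bound for \<kappa>. Hence the restriction of the second expansion to dilated compact sets.
  The orders in strong subhomogeneity are what one integration by parts consumes: two derivatives of
  the phase, one of the amplitude. The amplitude still carries exp (- n R), whose logarithmic
  derivative is not O(1 / r) uniformly in n; its derivative is, because x exp (- c x) is bounded.
  Since k > 1, the rescaled n R tends to 0 pointwise and leaves no trace in the attractor. The
  condition \<mu> < 1 makes r^(\<mu> - 1) decay, so the far end of an orbit costs nothing.\<close>

lemma has_vector_derivative_vec: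
  fixes f :: "real \<Rightarrow> ('b::euclidean_space)^'n"
  assumes "\<And>i. ((\<lambda>t. f t $ i) has_vector_derivative f' $ i) (at x within S)"
  shows "(f has_vector_derivative f') (at x within S)"
  unfolding has_vector_derivative_def
proof (subst has_derivative_componentwise_within, safe)
  fix b :: "'b^'n" assume "b \<in> Basis"
  then obtain i u where b: "b = axis i u" and u: "u \<in> Basis" by (auto simp: Basis_vec_def)
  have "((\<lambda>t. f t $ i) has_derivative (\<lambda>h. h *\<^sub>R (f' $ i))) (at x within S)"
    using assms by (simp add: has_vector_derivative_def)
  then have "((\<lambda>t. f t $ i \<bullet> u) has_derivative (\<lambda>h. (h *\<^sub>R (f' $ i)) \<bullet> u)) (at x within S)"
    by (intro derivative_intros)
  then show "((\<lambda>t. f t \<bullet> b) has_derivative (\<lambda>h. (h *\<^sub>R f') \<bullet> b)) (at x within S)"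
    by (simp add: b inner_axis)
qed

lemma bounded_bilinear_matrix_mult: "bounded_bilinear ((**) :: real^'n^'m \<Rightarrow> real^'k^'n \<Rightarrow> real^'k^'m)"
  unfolding bilinear_conv_bounded_bilinear[symmetric] bilinear_def
  by (auto intro!: linearI simp: matrix_matrix_mult_def vec_eq_iff sum.distrib sum_distrib_left algebra_simps)

lemma bounded_bilinear_matrix_vector_mult:
  "bounded_bilinear ((*v) :: real^'n^'m \<Rightarrow> real^'n \<Rightarrow> real^'m)"
  unfolding bilinear_conv_bounded_bilinear[symmetric] bilinear_def
  by (auto intro!: linearI simp: matrix_vector_mult_def vec_eq_iff sum.distrib sum_distrib_left algebra_simps)

lemma mpow_scaleR: "mpow (t *\<^sub>R A) k = t ^ k *\<^sub>R mpow A k"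
  by (induction k) (auto simp: matrix_matrix_mult_def vec_eq_iff sum_distrib_left algebra_simps)

lemma mpow_entry_bound:
  fixes A :: "real^'a^'a"
  shows "\<exists>C D. C \<ge> 0 \<and> (\<forall>k i j. \<bar>mpow A k $ i $ j\<bar> \<le> D * C ^ k)"
proof -
  obtain K where K: "K > 0" "\<And>a b. norm ((a :: real^'a^'a) ** (b :: real^'a^'a)) \<le> norm a * norm b * K"
    using bounded_bilinear.pos_bounded[OF bounded_bilinear_matrix_mult] by blast
  have "norm (mpow A k) \<le> norm (mat 1 :: real^'a^'a) * (norm A * K) ^ k" for k
  proof (induction k)
    case (Suc k)
    have "norm (mpow A (Suc k)) \<le> norm A * K * norm (mpow A k)"
      using K(2)[of A "mpow A k"] by (simp add: mult_ac)
    also have "\<dots> \<le> norm A * K * (norm (mat 1 :: real^'a^'a) * (norm A * K) ^ k)"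
      using Suc K(1) by (intro mult_left_mono) auto
    finally show ?case by (simp add: mult_ac)
  qed simp
  moreover have "\<bar>B $ i $ j\<bar> \<le> norm B" for B :: "real^'a^'a" and i j
    using component_le_norm_cart[of "B $ i" j] Finite_Cartesian_Product.norm_nth_le[of B i] by linarith
  ultimately have "\<bar>mpow A k $ i $ j\<bar> \<le> norm (mat 1 :: real^'a^'a) * (norm A * K) ^ k" for k i j
    using order_trans by blast
  moreover have "norm A * K \<ge> 0" using K(1) by simp
  ultimately show ?thesis by blast
qed

lemma summable_mpow_entry: "summable (\<lambda>k. (mpow A k $ i $ j / fact k) * t ^ k)"
proof -
  obtain C D where C: "C \<ge> 0" "\<And>k i j. \<bar>mpow A k $ i $ j\<bar> \<le> D * C ^ k"
    using mpow_entry_bound[of A] by blast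
  have "summable (\<lambda>k. D * ((C * \<bar>t\<bar>) ^ k /\<^sub>R fact k))"
    by (intro summable_mult summable_exp_generic)
  moreover have "norm ((mpow A k $ i $ j / fact k) * t ^ k) \<le> D * ((C * \<bar>t\<bar>) ^ k /\<^sub>R fact k)" for k
    using mult_right_mono[OF C(2)[of k i j], of "\<bar>t\<bar>^k / fact k"]
    by (simp add: abs_mult power_abs power_mult_distrib field_simps)
  ultimately show ?thesis by (rule summable_comparison_test')
qed

lemma sums_vec:
  fixes f :: "nat \<Rightarrow> ('b::euclidean_space)^'n"
  assumes "\<And>i. (\<lambda>k. f k $ i) sums (l $ i)"
  shows "f sums l"
  using assms unfolding sums_def by (intro vec_tendstoI) simp

lemma mexp_scaleR_sums: "(\<lambda>k. (1 / fact k) *\<^sub>R mpow (t *\<^sub>R A) k) sums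
    (\<chi> i j. \<Sum>k. (mpow A k $ i $ j / fact k) * t ^ k)"
  by (intro sums_vec) (use summable_mpow_entry[of A _ _ t] in \<open>auto simp: mpow_scaleR sums_iff mult_ac\<close>)

lemma mexp_scaleR: "mexp (t *\<^sub>R A) = (\<chi> i j. \<Sum>k. (mpow A k $ i $ j / fact k) * t ^ k)"
  unfolding mexp_def using mexp_scaleR_sums[of t A] by (simp add: sums_iff)

text \<open>Every entry is an everywhere convergent power series in t, so it is differentiated term
  by term. The index shift in \<open>diffs\<close> replaces \<open>mpow A k\<close> by
  \<open>mpow A (Suc k)\<close>, whose recursion releases one factor A on the left.\<close>

lemma mexp_deriv:
  "((\<lambda>t. mexp (t *\<^sub>R A)) has_vector_derivative A ** mexp (t *\<^sub>R A)) (at t)"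
proof (intro has_vector_derivative_vec, unfold has_real_derivative_iff_has_vector_derivative[symmetric])
  fix i j
  let ?c = "\<lambda>k. mpow A k $ i $ j / fact k"
  have "((\<lambda>t. \<Sum>k. ?c k * t ^ k) has_field_derivative (\<Sum>k. diffs ?c k * t ^ k)) (at t)"
    by (intro termdiffs_strong_converges_everywhere summable_mpow_entry)
  moreover have "(\<Sum>k. diffs ?c k * t ^ k) = (\<Sum>l\<in>UNIV. A $ i $ l * (\<Sum>k. (mpow A k $ l $ j / fact k) * t ^ k))"
  proof -
    have "diffs ?c k * t ^ k = (\<Sum>l\<in>UNIV. A $ i $ l * ((mpow A k $ l $ j / fact k) * t ^ k))" for k
    proof -
      have "diffs ?c k = mpow A (Suc k) $ i $ j / fact k"
        by (simp add: diffs_def del: mpow.simps of_nat_Suc)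
      then show ?thesis
        by (simp add: matrix_matrix_mult_def sum_distrib_left sum_divide_distrib mult_ac)
    qed
    then show ?thesis
      by (simp only: suminf_sum summable_mult suminf_mult summable_mpow_entry)
  qed
  ultimately show "((\<lambda>t. mexp (t *\<^sub>R A) $ i $ j) has_real_derivative (A ** mexp (t *\<^sub>R A)) $ i $ j) (at t)"
    by (simp add: mexp_scaleR matrix_matrix_mult_def)
qed

lemma mexp_chain:
  assumes "(g has_real_derivative g') (at x)"
  shows "((\<lambda>x. mexp (g x *\<^sub>R A)) has_vector_derivative g' *\<^sub>R (A ** mexp (g x *\<^sub>R A))) (at x)"
  using vector_diff_chain_at[where f = g and g = "\<lambda>t. mexp (t *\<^sub>R A)", OF _ mexp_deriv] assms
  by (simp add: has_real_derivative_iff_has_vector_derivative o_def)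

lemma mexp_0: "mexp 0 = mat 1"
proof -
  have "mexp (0 *\<^sub>R 0 :: real^'n^'n) = mat 1"
    unfolding mexp_scaleR powser_zero by (simp add: vec_eq_iff)
  then show ?thesis by simp
qed

lemma mexp_commute: "A ** mexp (t *\<^sub>R A) = mexp (t *\<^sub>R A) ** A"
proof -
  have c: "A ** mpow (t *\<^sub>R A) k = mpow (t *\<^sub>R A) k ** A" for k
  proof -
    have "A ** mpow A k = mpow A k ** A"
      by (induction k) (auto simp: matrix_mul_assoc)
    then show ?thesis
      by (simp add: mpow_scaleR matrix_scalar_ac scalar_matrix_assoc[symmetric])
  qed
  note s = mexp_scaleR_sums[of t A, folded mexp_scaleR]
  have "(\<lambda>k. A ** ((1 / fact k) *\<^sub>R mpow (t *\<^sub>R A) k)) sums (A ** mexp (t *\<^sub>R A))"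
    by (intro bounded_linear.sums[OF bounded_bilinear.bounded_linear_right[OF bounded_bilinear_matrix_mult]] s)
  moreover have "(\<lambda>k. ((1 / fact k) *\<^sub>R mpow (t *\<^sub>R A) k) ** A) sums (mexp (t *\<^sub>R A) ** A)"
    by (intro bounded_linear.sums[OF bounded_bilinear.bounded_linear_left[OF bounded_bilinear_matrix_mult]] s)
  moreover have "A ** ((1 / fact k) *\<^sub>R mpow (t *\<^sub>R A) k) = ((1 / fact k) *\<^sub>R mpow (t *\<^sub>R A) k) ** A" for k
    by (simp add: c matrix_scalar_ac scalar_matrix_assoc[symmetric])
  ultimately show ?thesis using sums_unique2 by fastforce
qed

text \<open>The product has derivative zero in t because A commutes with its exponential, and its
  value at t = 0 is the right-hand side. Putting the sum into the first factor avoids inverses;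
  \<open>mexp_add\<close> follows with s + t and - t.\<close>

lemma mexp_add_minus: "mexp ((s + t) *\<^sub>R A) ** mexp (- t *\<^sub>R A) = mexp (s *\<^sub>R A)"
proof -
  define F where "F = (\<lambda>t. mexp ((s + t) *\<^sub>R A) ** mexp (- t *\<^sub>R A))"
  have "(F has_vector_derivative 0) (at t)" for t
  proof -
    have 1: "((\<lambda>t. mexp ((s + t) *\<^sub>R A)) has_vector_derivative A ** mexp ((s + t) *\<^sub>R A)) (at t)"
      using mexp_chain[of "\<lambda>t. s + t" 1 t A] DERIV_add[OF DERIV_const DERIV_ident, of s t UNIV] by simp
    have 2: "((\<lambda>t. mexp (- t *\<^sub>R A)) has_vector_derivative - (A ** mexp (- t *\<^sub>R A))) (at t)"
      using mexp_chain[of "\<lambda>t. - t" "-1" t A] DERIV_minus[OF DERIV_ident, of t UNIV] by simp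
    have "mexp ((s + t) *\<^sub>R A) ** (- (A ** mexp (- t *\<^sub>R A))) + (A ** mexp ((s + t) *\<^sub>R A)) ** mexp (- t *\<^sub>R A) = 0"
      using bounded_bilinear.minus_right[OF bounded_bilinear_matrix_mult,
          of "mexp ((s + t) *\<^sub>R A)" "A ** mexp (- t *\<^sub>R A)"]
      by (simp add: matrix_mul_assoc mexp_commute[of A "s+t"])
    with bounded_bilinear.has_vector_derivative[OF bounded_bilinear_matrix_mult 1 2]
    show ?thesis by (simp add: F_def)
  qed
  then have "\<exists>c. \<forall>x. F x = c"
    using has_derivative_zero_constant[of UNIV F] by (force simp: has_vector_derivative_def)
  then have "F t = F 0" by metis
  then show ?thesis by (simp add: F_def mexp_0)
qed

lemma mexp_add: "mexp ((s + t) *\<^sub>R A) = mexp (s *\<^sub>R A) ** mexp (t *\<^sub>R A)"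
  using mexp_add_minus[of "s + t" "-t" A] by simp

section \<open>Determinant of the exponential\<close>

lemma prod_diff_single_eq_0:
  assumes "finite S" "i \<in> S" "j \<in> S" "i \<noteq> j" "f i = 0" "f j = (0::real)" "k \<in> S"
  shows "(\<Prod>l\<in>S - {k}. f l) = 0"
  using assms by (cases "k = i") (auto intro!: prod_zero)

text \<open>Jacobi's formula at the identity. A permutation other than the identity moves at least
  two indices, so its product has two vanishing factors, and differentiating one of them leaves the
  other. Only the diagonal product contributes.\<close>

lemma det_deriv_at_mat_1:
  fixes B :: "real \<Rightarrow> real^'n^'n"
  assumes B: "(B has_vector_derivative A) (at x)" and Bx: "B x = mat 1"
  shows "((\<lambda>t. det (B t)) has_real_derivative trace A) (at x)"
proof -
  have e: "((\<lambda>t. B t $ i $ j) has_real_derivative A $ i $ j) (at x)" for i j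
  proof -
    have "bounded_linear (\<lambda>M :: real^'n^'n. M $ i $ j)"
      by (intro bounded_linear_compose[OF bounded_linear_vec_nth bounded_linear_vec_nth])
    from bounded_linear.has_vector_derivative[OF this B]
    show ?thesis by (simp add: has_real_derivative_iff_has_vector_derivative)
  qed
  let ?D = "\<lambda>p. \<Sum>k\<in>UNIV. A $ k $ p k * (\<Prod>l\<in>UNIV - {k}. B x $ l $ p l)"
  have "((\<lambda>t. det (B t)) has_real_derivative (\<Sum>p\<in>{p. p permutes UNIV}. of_int (sign p) * ?D p)) (at x)"
    unfolding det_def
    by (intro DERIV_sum DERIV_cmult has_field_derivative_prod) (auto intro!: e)
  moreover have "?D p = 0" if p: "p permutes (UNIV :: 'n set)" "p \<noteq> id" for p
  proof -
    from p(2) obtain i where i: "p i \<noteq> i" by (auto simp: fun_eq_iff)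
    have "p (p i) \<noteq> p i" using i permutes_inj[OF p(1)] by (auto dest: injD)
    then have "(\<Prod>l\<in>UNIV - {k}. B x $ l $ p l) = 0" for k
      using i by (intro prod_diff_single_eq_0[of _ i "p i"]) (auto simp: Bx mat_def)
    then show ?thesis by (simp only: mult_zero_right sum.neutral_const)
  qed
  then have "(\<Sum>p\<in>{p. p permutes UNIV}. of_int (sign p) * ?D p) = of_int (sign (id :: 'n \<Rightarrow> 'n)) * ?D id"
    by (subst sum.mono_neutral_right[where S = "{id}"]) (auto simp: permutes_id finite_permutations)
  moreover have "of_int (sign (id :: 'n \<Rightarrow> 'n)) * ?D id = trace A"
    by (simp add: trace_def Bx mat_def sign_id)
  ultimately show ?thesis by simp
qed

text \<open>Liouville's formula. The determinant is multiplicative in t, so its derivative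
  everywhere is determined by the derivative at 0, which is the trace; the scalar equation f' = f
  trace A is then solved.\<close>

lemma det_mexp: "det (mexp (t *\<^sub>R A)) = exp (t * trace A)"
proof -
  define f where "f = (\<lambda>t. det (mexp (t *\<^sub>R A)))"
  have add: "f (s + t) = f s * f t" for s t by (simp add: f_def mexp_add det_mul)
  have f0: "f 0 = 1" by (simp add: f_def mexp_0)
  have d0: "(f has_real_derivative trace A) (at 0)"
    unfolding f_def
    using det_deriv_at_mat_1[OF mexp_deriv[of A 0]] by (simp add: mexp_0)
  have d: "(f has_real_derivative f t * trace A) (at t)" for t
  proof -
    have "((\<lambda>s. f t * f (s - t)) has_real_derivative f t * trace A) (at t)"
    proof (intro DERIV_cmult)
      show "((\<lambda>s. f (s - t)) has_real_derivative trace A) (at t)"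
        using DERIV_shift[of f "trace A" t "- t"] d0 by simp
    qed
    moreover have "f t * f (s - t) = f s" for s using add[of t "s - t"] by simp
    ultimately show ?thesis by simp
  qed
  have "((\<lambda>t. f t * exp (- t * trace A)) has_real_derivative 0) (at t)" for t
  proof -
    have "((\<lambda>t. exp (- t * trace A)) has_real_derivative - trace A * exp (- t * trace A)) (at t)"
      by (auto intro!: derivative_eq_intros)
    from DERIV_mult[OF d[of t] this] show ?thesis by simp
  qed
  then have "f t * exp (- t * trace A) = f 0 * exp (- 0 * trace A)"
    using DERIV_isconst_all by blast
  then show ?thesis using f0 by (simp add: f_def exp_minus field_simps mexp_0)
qed

section \<open>The dilations t^E\<close>

lemma tpow_1: "tpow 1 E = mat 1"
  by (simp add: tpow_def mexp_0)

lemma tpow_mult: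
  assumes "s > 0" "t > 0" shows "tpow (s * t) E = tpow s E ** tpow t E"
  using assms by (simp add: tpow_def ln_mult_pos mexp_add)

lemma tpow_tpow:
  assumes "s > 0" "t > 0" shows "tpow s E *v (tpow t E *v x) = tpow (s * t) E *v x"
  using assms by (simp add: tpow_mult matrix_vector_mul_assoc)

lemma tpow_inverse:
  assumes "t > 0"
  shows "tpow t E *v (tpow (1 / t) E *v x) = x" "tpow (1 / t) E *v (tpow t E *v x) = x"
  using assms by (simp_all add: tpow_tpow tpow_1)

lemma det_tpow: "t > 0 \<Longrightarrow> det (tpow t E) = t powr trace E"
  by (simp add: tpow_def det_mexp powr_def mult.commute)

text \<open>The exponents E / k and E have the same orbits, traversed at different speeds. This lets
  both homogeneity conditions of imaginary type be read along one orbit.\<close>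

lemma tpow_divide: 
  assumes "t > 0" shows "tpow t ((1 / k) *\<^sub>R E) = tpow (t powr (1 / k)) E"
  using assms by (simp add: tpow_def ln_powr)

lemma tpow_deriv:
  assumes "t > 0"
  shows "((\<lambda>t. tpow t E *v x) has_vector_derivative (1 / t) *\<^sub>R (E *v (tpow t E *v x))) (at t)"
proof -
  have "((\<lambda>t. tpow t E) has_vector_derivative (1 / t) *\<^sub>R (E ** tpow t E)) (at t)"
    unfolding tpow_def
    by (intro mexp_chain) (use assms in \<open>auto intro!: derivative_eq_intros\<close>)
  then have "((\<lambda>t. tpow t E *v x) has_vector_derivative ((1 / t) *\<^sub>R (E ** tpow t E)) *v x) (at t)"
    by (rule bounded_linear.has_vector_derivative[OF bounded_bilinear.bounded_linear_left[OF bounded_bilinear_matrix_vector_mult]])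
  then show ?thesis by (simp add: matrix_vector_mul_assoc scaleR_matrix_vector_assoc)
qed

lemma continuous_on_tpow: "continuous_on ({0<..} \<times> UNIV) (\<lambda>(t, x). tpow t E *v x)"
proof -
  have "continuous_on UNIV (\<lambda>t. mexp (t *\<^sub>R E))"
    by (intro continuous_at_imp_continuous_on ballI has_vector_derivative_continuous[OF mexp_deriv])
  then have "continuous_on {0<..} (\<lambda>t. tpow t E)"
    unfolding tpow_def
    by (rule continuous_on_compose2[of UNIV "\<lambda>t. mexp (t *\<^sub>R E)"]) (auto intro!: continuous_on_ln)
  then have "continuous_on ({0<..} \<times> (UNIV :: (real^'a) set)) (\<lambda>p. tpow (fst p) E)"
    by (rule continuous_on_compose2[of _ "\<lambda>t. tpow t E"]) (auto intro!: continuous_on_fst continuous_on_id)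
  then show ?thesis unfolding case_prod_beta
    by (intro bounded_bilinear.continuous_on[OF bounded_bilinear_matrix_vector_mult] continuous_on_snd continuous_on_id)
qed

lemma transpose_tpow: "tpow t (transpose E) = transpose (tpow t E)"
proof -
  have mm: "mpow (transpose A) k = transpose (mpow A k)" for k and A :: "real^'n^'n"
  proof (induction k)
    case (Suc k)
    have "A ** mpow A k = mpow A k ** A" by (induction k) (auto simp: matrix_mul_assoc)
    with Suc show ?case by (simp add: matrix_transpose_mul)
  qed (simp add: transpose_mat)
  show ?thesis
    unfolding tpow_def mexp_scaleR mm by (simp add: vec_eq_iff transpose_def)
qed

section \<open>Linear change of variables\<close>

lemma borel_measurable_matrix_vector_mult [measurable]:
  "(*v) (A :: real^'n^'n) \<in> borel \<rightarrow>\<^sub>M borel"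
  by (intro borel_measurable_continuous_onI matrix_vector_mult_linear_continuous_on)

lemma Basis_cart: "(Basis :: (real^'n) set) = range (\<lambda>i. axis i 1)"
  by (auto simp: Basis_vec_def)

lemma sum_Basis_cart: "(\<Sum>b\<in>(Basis :: (real^'n) set). f b) = (\<Sum>i\<in>UNIV. f (axis i 1))"
  and prod_Basis_cart: "(\<Prod>b\<in>(Basis :: (real^'n) set). g b) = (\<Prod>i\<in>UNIV. g (axis i 1))"
proof -
  have "inj (\<lambda>i::'n. axis i (1::real))" by (auto simp: inj_on_def axis_eq_axis)
  then show "(\<Sum>b\<in>(Basis :: (real^'n) set). f b) = (\<Sum>i\<in>UNIV. f (axis i 1))"
    and "(\<Prod>b\<in>(Basis :: (real^'n) set). g b) = (\<Prod>i\<in>UNIV. g (axis i 1))"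
    by (simp_all add: Basis_cart sum.reindex prod.reindex o_def)
qed

lemma emeasure_shear_vimage:
  fixes S :: "(real^'n) set" and m n :: 'n
  assumes mn: "m \<noteq> n" and [measurable]: "S \<in> sets borel"
  defines "f \<equiv> (\<lambda>x :: real^'n. \<chi> i. if i = m then x $ m + x $ n else x $ i)"
  shows "emeasure lborel {x. f x \<in> S} = emeasure lborel S"
proof -
  define g where "g = (\<lambda>x :: real^'n. \<chi> i. if i = m then x $ m - x $ n else x $ i)"
  have fg: "f (g x) = x" "g (f x) = x" for x using mn by (auto simp: f_def g_def vec_eq_iff)
  have lf: "linear f" and lg: "linear g"
    by (auto intro!: linearI simp: f_def g_def vec_eq_iff algebra_simps)
  have [measurable]: "f \<in> borel \<rightarrow>\<^sub>M borel" "g \<in> borel \<rightarrow>\<^sub>M borel"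
    using lf lg by (auto intro!: borel_measurable_continuous_onI linear_continuous_on simp: linear_linear)
  have shear: "measure lebesgue (f ` cbox a b) = 1 * measure lebesgue (cbox a b)" for a b
  proof (cases "cbox a b = {}")
    case False
    \<comment> \<open>\<open>measure_shear_interval\<close> asks for a nonnegative n-th coordinate
      of the lower corner. Translating by v makes that coordinate 0, and volume ignores the
      translation.\<close>
    define v where "v = (axis n (- a $ n) :: real^'n)"
    have "f ` cbox (v + a) (v + b) = (+) (f v) ` f ` cbox a b"
      by (auto simp: cbox_translation image_image linear_add[OF lf])
    then have "measure lebesgue (f ` cbox a b) = measure lebesgue (f ` cbox (v + a) (v + b))"
      by (simp add: measure_translation)
    also have "\<dots> = measure lebesgue (cbox (v + a) (v + b))"
      unfolding f_def using mn False
      by (intro measure_shear_interval) (auto simp: cbox_translation v_def)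
    also have "\<dots> = measure lebesgue (cbox a b)"
      by (metis cbox_translation measure_translation)
    finally show ?thesis by simp
  qed simp
  have "lborel = distr lborel borel g"
  proof (rule lborel_eqI)
    fix l u :: "real^'n" assume lu: "\<And>b. b \<in> Basis \<Longrightarrow> l \<bullet> b \<le> u \<bullet> b"
    have im: "g -` box l u = f ` box l u"
      using fg by (auto simp: image_iff) metis+
    note s = measure_linear_sufficient[OF lf lmeasurable_box shear, of l u]
    have "emeasure (distr lborel borel g) (box l u) = emeasure lborel (g -` box l u)"
      by (simp add: emeasure_distr)
    also have "\<dots> = emeasure lebesgue (f ` box l u)"
      using measurable_sets[of g borel borel "box l u"] by (simp add: im)
    also have "\<dots> = ennreal (measure lebesgue (box l u))"
      using s by (simp add: emeasure_eq_measure2)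
    finally show "emeasure (distr lborel borel g) (box l u) = (\<Prod>b\<in>Basis. (u - l) \<bullet> b)"
      using lu by (simp add: measure_def)
  qed simp
  then have "emeasure lborel {x. f x \<in> S} = emeasure (distr lborel borel g) {x. f x \<in> S}" by simp
  also have "\<dots> = emeasure lborel {x. f (g x) \<in> S}"
    by (subst emeasure_distr) (auto simp: vimage_def)
  finally show ?thesis by (simp add: fg)
qed

text \<open>Induction over elementary matrices. Nonvanishing of the determinant is kept inside the
  induction predicate: it makes the zero-row case vacuous and passes to both factors of a product.
  Preimages are used because their measurability is immediate.\<close>

lemma emeasure_matrix_vimage:
  fixes A :: "real^'n^'n" and S :: "(real^'n) set"
  assumes "det A \<noteq> 0" "S \<in> sets borel"
  shows "emeasure lborel S = ennreal \<bar>det A\<bar> * emeasure lborel {x. A *v x \<in> S}"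
proof -
  have "det A \<noteq> 0 \<longrightarrow> (\<forall>S\<in>sets borel. emeasure lborel S = ennreal \<bar>det A\<bar> * emeasure lborel {x. A *v x \<in> S})"
    (is "?Q A")
  proof (rule induct_matrix_elementary_alt[where P = ?Q]; intro impI ballI)
    fix A B :: "real^'n^'n" and S :: "(real^'n) set"
    assume A: "?Q A" and B: "?Q B" and d: "det (A ** B) \<noteq> 0" and S [measurable]: "S \<in> sets borel"
    have "{x. A *v x \<in> S} \<in> sets borel" by measurable
    with B d have B': "emeasure lborel {x. A *v x \<in> S} = ennreal \<bar>det B\<bar> * emeasure lborel {x. B *v x \<in> {x. A *v x \<in> S}}"
      by (metis det_mul mult_zero_right)
    from A d S have "emeasure lborel S = ennreal \<bar>det A\<bar> * emeasure lborel {x. A *v x \<in> S}"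
      by (metis det_mul mult_zero_left)
    then have "emeasure lborel S = ennreal \<bar>det A\<bar> * (ennreal \<bar>det B\<bar> * emeasure lborel {x. A *v (B *v x) \<in> S})"
      unfolding B' by simp
    then show "emeasure lborel S = ennreal \<bar>det (A ** B)\<bar> * emeasure lborel {x. A ** B *v x \<in> S}"
      by (simp add: det_mul abs_mult ennreal_mult mult.assoc matrix_vector_mul_assoc)
  next
    fix A :: "real^'n^'n" and i and S :: "(real^'n) set"
    assume "row i A = 0" "det A \<noteq> 0"
    then show "emeasure lborel S = ennreal \<bar>det A\<bar> * emeasure lborel {x. A *v x \<in> S}"
      using det_zero_row by blast
  next
    fix A :: "real^'n^'n" and S :: "(real^'n) set"
    assume diag: "\<And>i j. i \<noteq> j \<Longrightarrow> A $ i $ j = 0" and d: "det A \<noteq> 0" and S [measurable]: "S \<in> sets borel"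
    define c where "c = (\<lambda>b :: real^'n. A $ axis_index b $ axis_index b)"
    have det: "det A = (\<Prod>i\<in>UNIV. A $ i $ i)" using diag by (rule det_diagonal)
    have nz: "c b \<noteq> 0" if "b \<in> Basis" for b using d by (auto simp: c_def det)
    have T: "0 + (\<Sum>j\<in>Basis. (c j * (x \<bullet> j)) *\<^sub>R j) = A *v x" for x
    proof -
      have "(A *v x) $ i = A $ i $ i * x $ i" for i
        unfolding matrix_vector_mult_def
        using diag by (simp add: sum.remove[of UNIV i])
      then show ?thesis
        unfolding sum_Basis_cart c_def axis_index_axis inner_axis
        by (simp add: vec_eq_iff axis_def if_distrib cong: if_cong)
    qed
    have "emeasure lborel S = emeasure (density (distr lborel borel ((*v) A)) (\<lambda>_. ennreal (\<Prod>j\<in>Basis. \<bar>c j\<bar>))) S"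
      using lborel_affine_euclidean[of c 0] nz unfolding T by metis
    also have "\<dots> = ennreal (\<Prod>j\<in>Basis. \<bar>c j\<bar>) * emeasure lborel ((*v) A -` S)"
      by (simp add: emeasure_density nn_integral_cmult_indicator emeasure_distr)
    finally show "emeasure lborel S = ennreal \<bar>det A\<bar> * emeasure lborel {x. A *v x \<in> S}"
      by (simp add: det prod_Basis_cart c_def abs_prod vimage_def)
  next
    fix m n :: 'n and S :: "(real^'n) set"
    let ?t = "Transposition.transpose m n"
    let ?A = "\<chi> i j. mat 1 $ i $ ?t j :: real^'n^'n"
    assume mn: "m \<noteq> n" and S [measurable]: "S \<in> sets borel"
    have 1: "\<bar>det ?A\<bar> = 1"
      by (simp add: det_permute_columns permutes_swap_id sign_swap_id abs_mult)
    have A: "?A *v x = (\<chi> i. x $ ?t i)" for x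
    proof -
      have "(\<Sum>j\<in>UNIV. mat 1 $ i $ ?t j * x $ j) = (\<Sum>j\<in>UNIV. mat 1 $ i $ j * x $ ?t j)" for i
        by (rule sum.reindex_bij_witness[of _ ?t ?t]) auto
      moreover have "(\<Sum>j\<in>UNIV. mat 1 $ i $ j * x $ ?t j) = (\<Sum>j\<in>UNIV. if i = j then x $ ?t j else 0)" for i
        by (intro sum.cong) (auto simp: mat_def)
      ultimately show ?thesis
        by (simp add: matrix_vector_mult_def vec_eq_iff)
    qed
    have "lborel = distr lborel borel ((*v) ?A)"
    proof (rule lborel_eqI)
      fix l u :: "real^'n" assume lu: "\<And>b. b \<in> Basis \<Longrightarrow> l \<bullet> b \<le> u \<bullet> b"
      have "(*v) ?A -` box l u = box (\<chi> i. l $ ?t i) (\<chi> i. u $ ?t i)"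
        by (auto simp: A mem_box_cart) (metis transpose_involutory)+
      moreover have "l $ i \<le> u $ i" for i using lu[of "axis i 1"] by (simp add: inner_axis)
      moreover have "(\<Prod>i\<in>UNIV. u $ ?t i - l $ ?t i) = (\<Prod>i\<in>UNIV. u $ i - l $ i)"
        by (rule prod.reindex_bij_witness[of _ ?t ?t]) auto
      ultimately show "emeasure (distr lborel borel ((*v) ?A)) (box l u) = (\<Prod>b\<in>Basis. (u - l) \<bullet> b)"
        by (simp add: emeasure_distr emeasure_lborel_box_eq Basis_cart) 
           (simp add: Basis_cart[symmetric] prod_Basis_cart inner_axis)
    qed simp
    then have "emeasure lborel S = emeasure (distr lborel borel ((*v) ?A)) S" by simp
    then show "emeasure lborel S = ennreal \<bar>det ?A\<bar> * emeasure lborel {x. ?A *v x \<in> S}"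
      by (simp add: 1 emeasure_distr vimage_def)
  next
    fix m n :: 'n and S :: "(real^'n) set"
    let ?A = "\<chi> i j. of_bool (i = m \<and> j = n \<or> i = j) :: real^'n^'n"
    assume mn: "m \<noteq> n" and S: "S \<in> sets borel"
    have "?A = (\<chi> k. if k = m then row m (mat 1) + 1 *s row n (mat 1) else row k (mat 1))"
      using mn by (auto simp: vec_eq_iff row_def mat_def)
    then have 1: "det ?A = 1" using det_row_operation[OF mn, of "mat 1 :: real^'n^'n" 1] by simp
    have "?A *v x = (\<chi> i. if i = m then x $ m + x $ n else x $ i)" for x
    proof -
      have "(\<Sum>j\<in>UNIV. of_bool (i = m \<and> j = n \<or> i = j) * x $ j) = (if i = m then x $ m + x $ n else x $ i)" for i
      proof -
        have "(\<Sum>j\<in>UNIV. of_bool (i = m \<and> j = n \<or> i = j) * x $ j)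
            = (\<Sum>j\<in>UNIV. (if i = j then x $ j else 0) + (if j = n then (if i = m then x $ n else 0) else 0))"
          using mn by (intro sum.cong) auto
        also have "\<dots> = (if i = m then x $ m + x $ n else x $ i)" by (simp add: sum.distrib)
        finally show ?thesis .
      qed
      then show ?thesis by (simp add: matrix_vector_mult_def vec_eq_iff)
    qed
    then show "emeasure lborel S = ennreal \<bar>det ?A\<bar> * emeasure lborel {x. ?A *v x \<in> S}"
      using emeasure_shear_vimage[OF mn S] unfolding 1 by simp
  qed
  with assms show ?thesis by blast
qed

lemma lborel_matrix:
  fixes A :: "real^'n^'n"
  assumes "det A \<noteq> 0"
  shows "lborel = density (distr lborel borel ((*v) A)) (\<lambda>_. ennreal \<bar>det A\<bar>)"
proof (rule measure_eqI)
  fix S assume "S \<in> sets (lborel :: (real^'n) measure)"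
  then have S [measurable]: "S \<in> sets borel" by simp
  have "emeasure (density (distr lborel borel ((*v) A)) (\<lambda>_. ennreal \<bar>det A\<bar>)) S
      = ennreal \<bar>det A\<bar> * emeasure lborel {x. A *v x \<in> S}"
    by (simp add: emeasure_density nn_integral_cmult_indicator emeasure_distr vimage_def)
  with emeasure_matrix_vimage[OF assms S]
  show "emeasure lborel S = emeasure (density (distr lborel borel ((*v) A)) (\<lambda>_. ennreal \<bar>det A\<bar>)) S"
    by simp
qed simp

lemma integral_lborel_matrix:
  fixes A :: "real^'n^'n" and f :: "real^'n \<Rightarrow> 'b::{banach, second_countable_topology}"
  assumes "det A \<noteq> 0" and [measurable]: "f \<in> borel_measurable borel"
  shows "(\<integral>x. f x \<partial>lborel) = \<bar>det A\<bar> *\<^sub>R (\<integral>x. f (A *v x) \<partial>lborel)"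
    and "integrable lborel f \<longleftrightarrow> integrable lborel (\<lambda>x. f (A *v x))"
proof -
  let ?M = "density (distr lborel borel ((*v) A)) (\<lambda>_. ennreal \<bar>det A\<bar>)"
  have sc: "integrable lborel (\<lambda>x. \<bar>det A\<bar> *\<^sub>R f (A *v x)) \<longleftrightarrow> integrable lborel (\<lambda>x. f (A *v x))"
    using assms(1) integrable_scaleR_right[of "1 / \<bar>det A\<bar>" lborel "\<lambda>x. \<bar>det A\<bar> *\<^sub>R f (A *v x)"] by auto
  have "integral\<^sup>L ?M f = \<bar>det A\<bar> *\<^sub>R (\<integral>x. f (A *v x) \<partial>lborel)"
    "integrable ?M f \<longleftrightarrow> integrable lborel (\<lambda>x. f (A *v x))"
    using assms(1) by (simp_all add: integral_density integral_distr integrable_density integrable_distr_eq sc)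
  then show "(\<integral>x. f x \<partial>lborel) = \<bar>det A\<bar> *\<^sub>R (\<integral>x. f (A *v x) \<partial>lborel)"
    "integrable lborel f \<longleftrightarrow> integrable lborel (\<lambda>x. f (A *v x))"
    unfolding lborel_matrix[OF assms(1), symmetric] by simp_all
qed

lemma integral_tpow:
  fixes f :: "real^'n \<Rightarrow> 'b::{banach, second_countable_topology}"
  assumes "t > 0" and "f \<in> borel_measurable borel"
  shows "(\<integral>x. f x \<partial>lborel) = t powr trace E *\<^sub>R (\<integral>x. f (tpow t E *v x) \<partial>lborel)"
    and "integrable lborel f \<longleftrightarrow> integrable lborel (\<lambda>x. f (tpow t E *v x))"
  using integral_lborel_matrix[of "tpow t E" f] assms by (simp_all add: det_tpow)

lemma emeasure_tpow:
  fixes S :: "(real^'n) set"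
  assumes "t > 0" and "S \<in> sets borel"
  shows "emeasure lborel S = t powr trace E * emeasure lborel {x. tpow t E *v x \<in> S}"
  using emeasure_matrix_vimage[of "tpow t E" S] assms by (simp add: det_tpow)

section \<open>Positive homogeneous functions\<close>

locale contracting_pos_hom =
  fixes P :: "real^'d::finite \<Rightarrow> real" and E :: "real^'d^'d"
  assumes pos: "pos_hom P" and E: "E \<in> Exp P" and contr: "contracting E"
begin

lemma continuous_P: "continuous_on UNIV P" and P_nonneg: "P x \<ge> 0" and P_eq_0: "P x = 0 \<longleftrightarrow> x = 0"
  and compact_level: "compact {x. P x = 1}"
  using pos by (auto simp: pos_hom_def)

lemma P_pos: "x \<noteq> 0 \<Longrightarrow> P x > 0"
  using P_nonneg[of x] P_eq_0[of x] by linarith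

lemma P_tpow: "t > 0 \<Longrightarrow> P (tpow t E *v x) = t * P x"
  using E by (auto simp: Exp_def hom_wrt_def)

lemma P_measurable [measurable]: "P \<in> borel_measurable borel"
  using continuous_P by (rule borel_measurable_continuous_onI)

lemma polar:
  assumes "x \<noteq> 0"
  obtains \<theta> where "P \<theta> = 1" "x = tpow (P x) E *v \<theta>"
proof
  show "P (tpow (1 / P x) E *v x) = 1" "x = tpow (P x) E *v (tpow (1 / P x) E *v x)"
    using P_pos[OF assms] by (simp_all add: P_tpow tpow_inverse)
qed

text \<open>In polar form x = t^E \<theta> with \<theta> on the compact level set and t = P x \<le>
  1. For small t contraction bounds x by the size of \<theta>; the remaining t fill a compact
  interval away from 0, where joint continuity gives a bound.\<close>

lemma bounded_unit_sublevel: "bounded {x. P x \<le> 1}"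
proof -
  have "\<forall>\<^sub>F t in at_right 0. onorm (\<lambda>v. tpow t E *v v) < 1"
    using contr unfolding contracting_def by (rule order_tendstoD) simp
  then obtain \<tau> where \<tau>: "\<tau> > 0" "\<And>t. 0 < t \<Longrightarrow> t < \<tau> \<Longrightarrow> onorm (\<lambda>v. tpow t E *v v) < 1"
    by (auto simp: eventually_at_right_field)
  obtain M where M: "\<And>x. P x = 1 \<Longrightarrow> norm x \<le> M"
    using compact_imp_bounded[OF compact_level] by (auto simp: bounded_iff)
  have "compact ((\<lambda>(t, x). tpow t E *v x) ` ({\<tau>..1} \<times> {x. P x = 1}))"
    using \<tau>(1) by (intro compact_continuous_image compact_Times compact_level
        continuous_on_subset[OF continuous_on_tpow]) auto
  then obtain N where N: "\<And>t x. t \<in> {\<tau>..1} \<Longrightarrow> P x = 1 \<Longrightarrow> norm (tpow t E *v x) \<le> N"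
    by (force dest!: compact_imp_bounded simp: bounded_iff)
  have "norm x \<le> max 0 (max M N)" if x: "P x \<le> 1" for x
  proof (cases "x = 0")
    case False
    then obtain \<theta> where \<theta>: "P \<theta> = 1" "x = tpow (P x) E *v \<theta>" by (rule polar)
    show ?thesis
    proof (cases "P x < \<tau>")
      case True
      have "norm (tpow (P x) E *v \<theta>) \<le> onorm (\<lambda>v. tpow (P x) E *v v) * norm \<theta>"
        by (rule onorm) simp
      also have "\<dots> \<le> 1 * norm \<theta>"
        using \<tau>(2)[of "P x"] P_pos[OF False] True by (intro mult_right_mono) auto
      finally show ?thesis using M[OF \<theta>(1)] \<theta>(2) by simp
    next
      case False
      then show ?thesis using N[of "P x" \<theta>] x \<theta> by auto
    qed
  qed simp
  then show ?thesis by (auto simp: bounded_iff)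
qed

lemma compact_sublevel: "compact {x. P x \<le> s}"
proof -
  have cl: "closed {x. P x \<le> s}"
    using continuous_P by (intro closed_Collect_le) auto
  have "bounded {x. P x \<le> s}"
  proof (cases "s > 0")
    case True
    have "{x. P x \<le> s} \<subseteq> (*v) (tpow s E) ` {x. P x \<le> 1}"
    proof safe
      fix x assume "P x \<le> s"
      with True show "x \<in> (*v) (tpow s E) ` {x. P x \<le> 1}"
        by (intro image_eqI[of _ _ "tpow (1 / s) E *v x"]) (auto simp: tpow_inverse P_tpow)
    qed
    moreover have "bounded ((*v) (tpow s E) ` {x. P x \<le> 1})"
      by (intro bounded_linear_image bounded_unit_sublevel) simp
    ultimately show ?thesis by (rule bounded_subset[rotated])
  next
    case False
    then show ?thesis
      by (intro bounded_subset[OF bounded_unit_sublevel]) auto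
  qed
  with cl show ?thesis by (simp add: compact_eq_bounded_closed)
qed

text \<open>On the compact set {P \<le> 1} - U, which omits 0, P has a positive minimum. The bound 1
  in the witness keeps points inside {P \<le> 1}, where that minimum applies.\<close>

lemma sublevel_shrink:
  assumes "open U" "0 \<in> U"
  obtains \<delta> where "\<delta> > 0" "\<And>x. P x < \<delta> \<Longrightarrow> x \<in> U"
proof (cases "{x. P x \<le> 1} - U = {}")
  case True
  then show ?thesis by (intro that[of 1]) auto
next
  case False
  have "compact ({x. P x \<le> 1} - U)"
    by (intro compact_diff compact_sublevel assms)
  then obtain z where z: "z \<in> {x. P x \<le> 1} - U" "\<And>x. x \<in> {x. P x \<le> 1} - U \<Longrightarrow> P z \<le> P x"
    using continuous_attains_inf[of "{x. P x \<le> 1} - U" P] False continuous_on_subset[OF continuous_P] by blast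
  have "P z > 0" using z(1) assms P_pos[of z] by auto
  show ?thesis
  proof (rule that[of "min 1 (P z)"])
    fix x assume "P x < min 1 (P z)"
    then show "x \<in> U" using z(2)[of x] by (cases "x \<in> U") auto
  qed (use \<open>P z > 0\<close> in auto)
qed

lemma sublevel_meas [measurable]: "{x. P x < s} \<in> sets borel"
  by measurable

lemma emeasure_sublevel_finite: "emeasure lborel {x. P x < s} < \<infinity>"
proof -
  have "emeasure lborel {x. P x < s} \<le> emeasure lborel {x. P x \<le> s}"
    by (intro emeasure_mono) auto
  also have "\<dots> < \<infinity>"
    by (intro emeasure_bounded_finite compact_imp_bounded compact_sublevel)
  finally show ?thesis .
qed

lemma emeasure_sublevel_pos: "emeasure lborel {x. P x < 1} > 0"
proof -
  have "open {x. P x < 1}" by (intro open_Collect_less continuous_P) auto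
  moreover have "0 \<in> {x. P x < 1}" using P_eq_0[of 0] by simp
  ultimately have "\<not> negligible {x. P x < 1}"
    using open_not_negligible by blast
  then show ?thesis
    by (auto simp: negligible_iff_null_sets null_sets_completion_iff null_sets_def zero_less_iff_neq_zero)
qed

lemma emeasure_sublevel:
  assumes "E' \<in> Exp P" "s > 0"
  shows "emeasure lborel {x. P x < s} = s powr trace E' * emeasure lborel {x. P x < 1}"
proof -
  have "{x. tpow s E' *v x \<in> {x. P x < s}} = {x. P x < 1}"
    using assms by (auto simp: Exp_def hom_wrt_def)
  then show ?thesis using emeasure_tpow[OF assms(2), of "{x. P x < s}" E'] by simp
qed

text \<open>For every exponent E' of P the volume of {P < 2} is 2 powr trace E' times that of {P <
  1}, which is positive and finite. Hence all exponents have the same trace and the arbitrary choice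
  in \<open>mu\<close> is harmless.\<close>

lemma mu_eq: "mu P = trace E"
proof -
  have *: "(SOME E. E \<in> Exp P) \<in> Exp P" using E by (rule someI)
  let ?m = "measure lborel {x. P x < 1}"
  have m: "emeasure lborel {x. P x < 1} = ennreal ?m"
    using emeasure_sublevel_finite[of 1] by (simp add: emeasure_eq_ennreal_measure)
  have "?m > 0" using emeasure_sublevel_pos m by simp
  moreover have "2 powr trace (SOME E. E \<in> Exp P) * ?m = 2 powr trace E * ?m"
    using emeasure_sublevel[OF *, of 2] emeasure_sublevel[OF E, of 2] unfolding m
    by (auto simp: ennreal_mult[symmetric])
  ultimately show ?thesis by (simp add: mu_def powr_inj)
qed

text \<open>Space is cut into the slabs k \<le> P x < k + 1. On each the integrand is at most exp (-
  c k), while by homogeneity the volume grows only like a power of k, so the series over k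
  converges.\<close>

lemma integrable_exp_minus:
  assumes c: "c > 0"
  shows "integrable lborel (\<lambda>x. exp (- c * P x))"
proof (rule integrableI_bounded)
  let ?m = "measure lborel {x. P x < 1}" and ?\<mu> = "trace E"
  have m: "emeasure lborel {x. P x < s} = ennreal (s powr ?\<mu> * ?m)" if "s > 0" for s
    using emeasure_sublevel[OF E that] emeasure_sublevel_finite[of 1]
    by (simp add: emeasure_eq_ennreal_measure ennreal_mult[symmetric])
  have "(\<integral>\<^sup>+x. norm (exp (- c * P x)) \<partial>lborel)
      \<le> (\<integral>\<^sup>+x. (\<Sum>k. ennreal (exp (- c * real k)) * indicator {x. P x < real k + 1} x) \<partial>lborel)"
  proof (intro nn_integral_mono)
    fix x
    define k where "k = nat \<lfloor>P x\<rfloor>"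
    have k: "real k \<le> P x" "P x < real k + 1"
      using P_nonneg[of x] by (auto simp: k_def)
    have "ennreal (norm (exp (- c * P x))) \<le> ennreal (exp (- c * real k)) * indicator {x. P x < real k + 1} x"
      using k c by (simp add: ennreal_leI)
    also have "\<dots> \<le> (\<Sum>k. ennreal (exp (- c * real k)) * indicator {x. P x < real k + 1} x)"
      (is "?f k \<le> suminf ?f")
      using sum_le_suminf[of ?f "{k}"] by (simp only: sum.insert sum.empty finite.intros empty_iff not_False_eq_True) auto
    finally show "ennreal (norm (exp (- c * P x))) \<le> (\<Sum>k. ennreal (exp (- c * real k)) * indicator {x. P x < real k + 1} x)" .
  qed
  also have "\<dots> = (\<Sum>k. ennreal (exp (- c * real k)) * emeasure lborel {x. P x < real k + 1})"
    by (subst nn_integral_suminf) (auto simp: nn_integral_cmult_indicator)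
  also have "\<dots> = (\<Sum>k. ennreal (exp (- c * real k) * ((real k + 1) powr ?\<mu> * ?m)))"
    by (simp add: m ennreal_mult[symmetric])
  also have "\<dots> < \<infinity>"
  proof -
    have "(\<lambda>k. exp (- c * real k) * (real k + 1) powr ?\<mu>) \<in> O(\<lambda>k. inverse (real k ^ 2))"
      using c by real_asymp
    moreover have "summable (\<lambda>k. norm (inverse (real k ^ 2)))"
      using inverse_power_summable[of 2, where ?'a = real] by simp
    ultimately have "summable (\<lambda>k. exp (- c * real k) * (real k + 1) powr ?\<mu>)"
      by (rule summable_comparison_test_bigo[rotated])
    from summable_mult2[OF this, of ?m]
    have "summable (\<lambda>k. exp (- c * real k) * ((real k + 1) powr ?\<mu> * ?m))"
      by (simp add: mult.assoc)
    then show ?thesis by (subst suminf_ennreal2) auto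
  qed
  finally show "(\<integral>\<^sup>+x. ennreal (norm (exp (- c * P x))) \<partial>lborel) < \<infinity>" .
qed simp

end

section \<open>Fourier inversion on the lattice\<close>

text \<open>A period cell centred at 0. The point \<xi>0 is moved to the centre by shifting the
  integrand, which keeps it off the boundary of the cell even if it lies on the boundary of (-\<pi>,
  \<pi>]^d.\<close>

definition cube :: "(real^'d::finite) set" where
  "cube = cbox (\<chi> i. - pi) (\<chi> i. pi)"

lemma mem_cube: "x \<in> cube \<longleftrightarrow> (\<forall>i. - pi \<le> x $ i \<and> x $ i \<le> pi)"
  by (simp add: cube_def mem_box_cart)

lemma cube_sets [measurable]: "cube \<in> sets borel"
  by (simp add: cube_def)

lemma integral_lborel_prod_cart:
  fixes g :: "'d::finite \<Rightarrow> real \<Rightarrow> complex"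
  assumes "\<And>i. integrable lborel (g i)"
  shows "(\<integral>x. (\<Prod>i\<in>UNIV. g i (x $ i)) \<partial>(lborel :: (real^'d) measure)) = (\<Prod>i\<in>UNIV. \<integral>t. g i t \<partial>lborel)"
proof -
  interpret product_sigma_finite "\<lambda>_ :: real^'d. lborel :: real measure" ..
  have [measurable]: "g i \<in> borel_measurable borel" for i
    using borel_measurable_integrable[OF assms[of i]] by simp
  let ?T = "\<lambda>f. (\<Sum>b\<in>Basis. f b *\<^sub>R b) :: real^'d"
  have T: "?T f $ i = f (axis i 1)" for f i
    by (subst cart_eq_inner_axis) (simp add: inner_sum_left_Basis)
  have "(\<integral>x. (\<Prod>i\<in>UNIV. g i (x $ i)) \<partial>(lborel :: (real^'d) measure))
      = (\<integral>x. (\<Prod>i\<in>UNIV. g i (x $ i)) \<partial>distr (\<Pi>\<^sub>M b\<in>Basis. lborel) borel ?T)"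
    by (simp flip: lborel_eq)
  also have "\<dots> = (\<integral>f. (\<Prod>i\<in>UNIV. g i (?T f $ i)) \<partial>(\<Pi>\<^sub>M b\<in>Basis. lborel))"
    by (rule integral_distr) auto
  also have "\<dots> = (\<integral>f. (\<Prod>b\<in>Basis. g (axis_index b) (f b)) \<partial>(\<Pi>\<^sub>M b\<in>(Basis :: (real^'d) set). lborel))"
    by (simp only: T prod_Basis_cart axis_index_axis)
  also have "\<dots> = (\<Prod>b\<in>(Basis :: (real^'d) set). \<integral>t. g (axis_index b) t \<partial>lborel)"
    using assms by (intro product_integral_prod) auto
  finally show ?thesis by (simp only: prod_Basis_cart axis_index_axis)
qed

lemma integral_cis_int:
  fixes m :: int
  shows "integral {-pi..pi} (\<lambda>t. cis (of_int m * t)) = (if m = 0 then 2 * pi else 0)"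
proof (cases "m = 0")
  case False
  have "((\<lambda>t. cis (of_int m * t)) has_integral
      cis (of_int m * pi) / (\<i> * of_int m) - cis (of_int m * (- pi)) / (\<i> * of_int m)) {-pi..pi}"
  proof (rule fundamental_theorem_of_calculus)
    fix t
    have "((\<lambda>t. cis (of_int m * t)) has_vector_derivative of_int m *\<^sub>R (\<i> * cis (of_int m * t))) (at t within {-pi..pi})"
    proof -
      have "((\<lambda>z. exp (\<i> * (of_int m * z))) has_field_derivative of_int m * (\<i> * exp (\<i> * (of_int m * of_real t))))
          (at (of_real t))"
        by (auto intro!: derivative_eq_intros)
      from has_vector_derivative_real_field[OF this] show ?thesis
        by (simp add: cis_conv_exp scaleR_conv_of_real)
    qed
    then have "((\<lambda>t. cis (of_int m * t) / (\<i> * of_int m)) has_vector_derivative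
       (of_int m *\<^sub>R (\<i> * cis (of_int m * t))) / (\<i> * of_int m)) (at t within {-pi..pi})"
      by (rule has_vector_derivative_divide)
    then show "((\<lambda>t. cis (of_int m * t) / (\<i> * of_int m)) has_vector_derivative cis (of_int m * t)) (at t within {-pi..pi})"
      using False by (simp add: scaleR_conv_of_real)
  qed simp
  moreover have "cis (of_int m * pi) = cis (of_int m * (- pi))"
  proof -
    have "cis (of_int m * pi) = cis (of_int m * (- pi)) * cis (2 * pi * of_int m)"
      by (simp add: cis_mult algebra_simps)
    then show ?thesis by simp
  qed
  ultimately show ?thesis using False by (auto intro!: integral_unique)
qed (simp add: scaleR_conv_of_real)

lemma lat_simps: "lat 0 = 0" "lat (x - y) = lat x - lat y" "lat (x + y) = lat x + lat y"
  by (auto simp: lat_def vec_eq_iff)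

lemma integral_cis_lat:
  fixes k :: "int^'d::finite"
  shows "integral cube (\<lambda>\<xi>. cis (lat k \<bullet> \<xi>)) = (if k = 0 then (2 * pi) ^ CARD('d) else 0)"
proof -
  define g where "g = (\<lambda>i t. indicator {-pi..pi} t *\<^sub>R cis (of_int (k $ i) * t))"
  have si: "set_integrable lborel {-pi..pi} (\<lambda>t. cis (of_int m * t))" for m :: int
    by (intro borel_integrable_atLeastAtMost' continuous_intros)
  have gi: "integrable lborel (g i)" for i
    using si[of "k $ i"] by (simp add: g_def set_integrable_def)
  have gI: "(\<integral>t. g i t \<partial>lborel) = (if k $ i = 0 then 2 * pi else 0)" for i
    using set_borel_integral_eq_integral[OF si[of "k $ i"]] integral_cis_int[of "k $ i"]
    by (simp add: g_def set_lebesgue_integral_def)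
  have prod: "indicator cube \<xi> *\<^sub>R cis (lat k \<bullet> \<xi>) = (\<Prod>i\<in>UNIV. g i (\<xi> $ i))" for \<xi>
  proof -
    have "lat k \<bullet> \<xi> = (\<Sum>i\<in>UNIV. of_int (k $ i) * \<xi> $ i)" by (simp add: inner_vec_def lat_def)
    moreover have "cis (\<Sum>i\<in>S. f i) = (\<Prod>i\<in>S. cis (f i))" if "finite S" for S :: "'d set" and f
      using that by (induction S) (auto simp: cis_mult[symmetric])
    moreover have "(\<Prod>i\<in>S. indicator {-pi..pi} (\<xi> $ i) *\<^sub>R cis (f i)) =
       (if \<forall>i\<in>S. \<xi> $ i \<in> {-pi..pi} then (\<Prod>i\<in>S. cis (f i)) else 0)" if "finite S" for S :: "'d set" and f
      using that by (induction S) auto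
    ultimately show ?thesis by (auto simp: g_def mem_cube indicator_def)
  qed
  have ci: "set_integrable lborel cube (\<lambda>\<xi>. cis (lat k \<bullet> \<xi>))"
    unfolding cube_def set_integrable_def by (intro borel_integrable_compact continuous_intros) simp
  have "integral cube (\<lambda>\<xi>. cis (lat k \<bullet> \<xi>)) = (LINT \<xi>:cube|lborel. cis (lat k \<bullet> \<xi>))"
    using set_borel_integral_eq_integral(2)[OF ci] by simp
  also have "\<dots> = (\<Prod>i\<in>UNIV. \<integral>t. g i t \<partial>lborel)"
    unfolding set_lebesgue_integral_def prod by (rule integral_lborel_prod_cart) (rule gi)
  also have "\<dots> = (if k = 0 then (2 * pi) ^ CARD('d) else 0)"
    by (auto simp: gI vec_eq_iff)
  finally show ?thesis .
qed

section \<open>Fourier transform and convolution of summable lattice functions\<close>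

abbreviation asum :: "('a \<Rightarrow> complex) \<Rightarrow> bool" where
  "asum f \<equiv> (\<lambda>x. norm (f x)) summable_on UNIV"

lemma abs_summable_mult_cis:
  "asum f \<Longrightarrow> asum (\<lambda>x. f x * cis (lat x \<bullet> \<xi>))"
  by (simp add: norm_mult)

lemma fhat_bound:
  assumes "asum f"
  shows "norm (fhat f \<xi>) \<le> (\<Sum>\<^sub>\<infinity>x. norm (f x))"
  using Infinite_Sum.norm_infsum_bound[OF abs_summable_mult_cis[OF assms, of \<xi>]] by (simp add: fhat_def norm_mult)

lemma fhat_uniform_limit:
  assumes "asum f"
  shows "uniform_limit S (\<lambda>F \<xi>. \<Sum>x\<in>F. f x * cis (lat x \<bullet> \<xi>)) (fhat f) (finite_subsets_at_top UNIV)"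
  unfolding fhat_def
  by (rule Weierstrass_m_test_general[OF _ assms]) (simp add: norm_mult)

lemma continuous_fhat:
  assumes "asum f"
  shows "continuous_on S (fhat f)"
  by (rule uniform_limit_theorem[OF _ fhat_uniform_limit[OF assms]])
     (auto intro!: always_eventually continuous_intros)

text \<open>Absolute summability makes the finite partial sums converge uniformly on the cube, so
  their integrals converge too. By orthogonality the integral has its final value as soon as the
  finite set contains x, so the net of integrals is eventually constant. The shift a multiplies each
  coefficient by a unimodular factor, equal to 1 at y = x.\<close>

lemma fourier_inversion:
  fixes f :: "int^'d::finite \<Rightarrow> complex"
  assumes "asum f"
  shows "((\<lambda>\<eta>. fhat f (\<eta> + a) * cis (- (lat x \<bullet> (\<eta> + a)))) has_integral (2 * pi) ^ CARD('d) * f x) cube"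
proof -
  let ?s = "\<lambda>F \<eta>. (\<Sum>y\<in>F. f y * cis (lat y \<bullet> (\<eta> + a))) * cis (- (lat x \<bullet> (\<eta> + a)))"
  have "uniform_limit (cbox (\<chi> i. - pi) (\<chi> i. pi)) (\<lambda>F \<eta>. \<Sum>y\<in>F. f y * cis (lat y \<bullet> (\<eta> + a))) (\<lambda>\<eta>. fhat f (\<eta> + a)) (finite_subsets_at_top UNIV)"
    by (rule uniform_limit_compose'[OF fhat_uniform_limit[OF assms, of UNIV]]) auto
  then have u: "uniform_limit (cbox (\<chi> i. - pi) (\<chi> i. pi)) ?s (\<lambda>\<eta>. fhat f (\<eta> + a) * cis (- (lat x \<bullet> (\<eta> + a)))) (finite_subsets_at_top UNIV)"
    unfolding uniform_limit_iff dist_norm left_diff_distrib[symmetric] norm_mult by simp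
  obtain I J where IJ: "\<And>F. (?s F has_integral I F) cube"
    "((\<lambda>\<eta>. fhat f (\<eta> + a) * cis (- (lat x \<bullet> (\<eta> + a)))) has_integral J) cube"
    "(I \<longlongrightarrow> J) (finite_subsets_at_top UNIV)"
    unfolding cube_def
    by (rule uniform_limit_integral_cbox[OF u]) (auto intro!: continuous_intros)
  have I: "I F = (2 * pi) ^ CARD('d) * f x" if F: "finite F" "x \<in> F" for F
  proof -
    have s: "?s F \<eta> = (\<Sum>y\<in>F. f y * cis (lat (y - x) \<bullet> a) * cis (lat (y - x) \<bullet> \<eta>))" for \<eta>
      unfolding sum_distrib_right
      by (intro sum.cong refl) (simp add: cis_mult mult.assoc lat_simps algebra_simps)
    have int: "(\<lambda>\<xi>. cis (lat k \<bullet> \<xi>)) integrable_on cube" for k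
      unfolding cube_def by (intro integrable_continuous continuous_intros)
    have "I F = integral cube (?s F)" by (rule integral_unique[OF IJ(1), symmetric])
    also have "\<dots> = (\<Sum>y\<in>F. f y * cis (lat (y - x) \<bullet> a) * integral cube (\<lambda>\<eta>. cis (lat (y - x) \<bullet> \<eta>)))"
      unfolding s using F int by (subst integral_sum) (auto intro!: integrable_on_mult_right)
    also have "\<dots> = (\<Sum>y\<in>F. if y = x then (2 * pi) ^ CARD('d) * f x else 0)"
      unfolding integral_cis_lat by (intro sum.cong refl) (auto simp: lat_simps)
    finally show ?thesis using F by simp
  qed
  have "\<forall>\<^sub>F F in finite_subsets_at_top UNIV. I F = (2 * pi) ^ CARD('d) * f x"
    using eventually_finite_subsets_at_top_weakI[of UNIV] I
    by (auto simp: eventually_finite_subsets_at_top intro!: exI[of _ "{x}"])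
  then have "(I \<longlongrightarrow> (2 * pi) ^ CARD('d) * f x) (finite_subsets_at_top UNIV)"
    by (rule tendsto_eventually)
  then have "J = (2 * pi) ^ CARD('d) * f x"
    using IJ(3) tendsto_unique finite_subsets_at_top_neq_bot by blast
  with IJ(2) show ?thesis by simp
qed

text \<open>The shear (x, y) \<mapsto> (x - y, y) is a bijection of the double lattice, so the
  convolution family is a reindexed product family and inherits absolute summability. This
  legitimates exchanging the sums, and the character splits along the shear.\<close>

lemma convolution_lattice:
  fixes f g :: "int^'d::finite \<Rightarrow> complex"
  assumes f: "asum f" and g: "asum g"
  shows "asum (\<lambda>x. \<Sum>\<^sub>\<infinity>y. f (x - y) * g y)"
    and "fhat (\<lambda>x. \<Sum>\<^sub>\<infinity>y. f (x - y) * g y) \<xi> = fhat f \<xi> * fhat g \<xi>"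
proof -
  have bij: "bij_betw (\<lambda>(x, y). (x - y, y)) (UNIV \<times> UNIV) (UNIV \<times> (UNIV :: (int^'d) set))"
    by (rule bij_betwI[where g = "\<lambda>(x, y). (x + y, y)"]) auto
  have prod: "(\<lambda>p. norm (case p of (x, y) \<Rightarrow> u x * v y)) summable_on UNIV \<times> UNIV"
    if "asum u" "asum v" for u v :: "int^'d \<Rightarrow> complex"
    using that by (subst Infinite_Sum.abs_summable_on_Sigma_iff) (auto simp: norm_mult infsum_cmult_right' abs_mult infsum_nonneg intro!: summable_on_cmult_right summable_on_cmult_left)
  have s: "(\<lambda>p. norm (case p of (x, y) \<Rightarrow> u (x - y) * v y)) summable_on UNIV \<times> UNIV"
    if "asum u" "asum v" for u v :: "int^'d \<Rightarrow> complex"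
    using summable_on_reindex_bij_betw[OF bij, of "\<lambda>p. norm (case p of (x, y) \<Rightarrow> u x * v y)"] prod[OF that]
    by (simp add: case_prod_beta)
  have 0: "(\<lambda>x. norm (\<Sum>\<^sub>\<infinity>y. norm (f (x - y) * g y))) summable_on UNIV"
    and 1: "\<And>x. asum (\<lambda>y. f (x - y) * g y)"
    using s[OF f g] unfolding Infinite_Sum.abs_summable_on_Sigma_iff by auto
  show "asum (\<lambda>x. \<Sum>\<^sub>\<infinity>y. f (x - y) * g y)"
    using 0 by (rule Infinite_Sum.abs_summable_on_comparison_test) (use norm_infsum_bound[OF 1] in \<open>force simp: infsum_nonneg\<close>)
  let ?u = "\<lambda>x. f x * cis (lat x \<bullet> \<xi>)" and ?v = "\<lambda>x. g x * cis (lat x \<bullet> \<xi>)"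
  note uv = abs_summable_mult_cis[OF f, of \<xi>] abs_summable_mult_cis[OF g, of \<xi>]
  have "fhat (\<lambda>x. \<Sum>\<^sub>\<infinity>y. f (x - y) * g y) \<xi> = (\<Sum>\<^sub>\<infinity>x. \<Sum>\<^sub>\<infinity>y. ?u (x - y) * ?v y)"
    unfolding fhat_def infsum_cmult_left'[symmetric]
    by (intro infsum_cong) (simp add: lat_simps inner_diff_left cis_divide[symmetric])
  also have "\<dots> = infsum (\<lambda>(x, y). ?u (x - y) * ?v y) (UNIV \<times> UNIV)"
    using abs_summable_summable[OF s[OF uv]] by (rule infsum_Sigma'_banach)
  also have "\<dots> = infsum (\<lambda>(x, y). ?u x * ?v y) (UNIV \<times> UNIV)"
    using infsum_reindex_bij_betw[OF bij, of "\<lambda>(x, y). ?u x * ?v y"] by (simp add: case_prod_unfold)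
  also have "\<dots> = (\<Sum>\<^sub>\<infinity>x. \<Sum>\<^sub>\<infinity>y. ?u x * ?v y)"
    using abs_summable_summable[OF prod[OF uv]] by (rule infsum_Sigma'_banach[symmetric])
  also have "\<dots> = fhat f \<xi> * fhat g \<xi>"
    by (simp only: infsum_cmult_right' infsum_cmult_left' fhat_def)
  finally show "fhat (\<lambda>x. \<Sum>\<^sub>\<infinity>y. f (x - y) * g y) \<xi> = fhat f \<xi> * fhat g \<xi>" .
qed

lemma S_d_abs_summable: "\<phi> \<in> S_d \<Longrightarrow> asum \<phi>"
  unfolding S_d_def by (auto dest!: spec[of _ "\<lambda>_. 0"])

lemma cpow_fhat:
  assumes "asum \<phi>"
  shows "asum (cpow \<phi> n) \<and> (\<forall>\<xi>. fhat (cpow \<phi> n) \<xi> = fhat \<phi> \<xi> ^ n)"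
proof (induction n)
  case 0
  have "asum (cpow \<phi> 0)"
    by (rule finite_nonzero_values_imp_summable_on) simp
  moreover have "fhat (cpow \<phi> 0) \<xi> = 1" for \<xi>
    unfolding fhat_def by (subst infsum_cong_neutral[where T = "{0}" and g = "\<lambda>_. 1"]) (auto simp: lat_simps)
  ultimately show ?case by simp
next
  case (Suc n)
  then show ?case
    using convolution_lattice[OF _ assms] by (simp add: mult.commute)
qed

lemma cpow_integral:
  fixes \<phi> :: "int^'d::finite \<Rightarrow> complex"
  assumes "\<phi> \<in> S_d"
  shows "cpow \<phi> n x = (1 / (2 * pi)) ^ CARD('d) *
    (LINT \<eta>:cube|lborel. fhat \<phi> (\<eta> + a) ^ n * cis (- (lat x \<bullet> (\<eta> + a))))"
proof -
  note \<phi> = S_d_abs_summable[OF assms]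
  note c = cpow_fhat[OF \<phi>, of n]
  have "continuous_on S (\<lambda>\<eta>. fhat \<phi> (\<eta> + a))" for S
    by (rule continuous_on_compose2[OF continuous_fhat[OF \<phi>, of UNIV]]) (auto intro!: continuous_intros)
  then have "set_integrable lborel cube (\<lambda>\<eta>. fhat \<phi> (\<eta> + a) ^ n * cis (- (lat x \<bullet> (\<eta> + a))))"
    unfolding cube_def set_integrable_def by (intro borel_integrable_compact continuous_intros) auto
  from set_borel_integral_eq_integral(2)[OF this] fourier_inversion[of "cpow \<phi> n" a x] c
  have "(LINT \<eta>:cube|lborel. fhat \<phi> (\<eta> + a) ^ n * cis (- (lat x \<bullet> (\<eta> + a)))) = (2 * pi) ^ CARD('d) * cpow \<phi> n x"
    by (simp add: integral_unique)
  then show ?thesis by (simp add: power_one_over)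
qed

lemma fhat_periodic:
  fixes k :: "int^'d::finite"
  shows "fhat f (\<xi> + (2 * pi) *\<^sub>R lat k) = fhat f \<xi>"
proof -
  have "cis (lat x \<bullet> (\<xi> + (2 * pi) *\<^sub>R lat k)) = cis (lat x \<bullet> \<xi>)" for x :: "int^'d"
  proof -
    have "lat x \<bullet> lat k \<in> \<int>"
      by (auto simp: inner_vec_def lat_def intro!: Ints_sum Ints_mult)
    then have "cis (2 * pi * (lat x \<bullet> lat k)) = 1" by (rule cis_multiple_2pi)
    then show ?thesis by (simp add: inner_add_right cis_mult[symmetric])
  qed
  then show ?thesis by (simp add: fhat_def)
qed

lemma fhat_le_1:
  assumes "\<phi> \<in> S_d" "(SUP \<xi>. norm (fhat \<phi> \<xi>)) = 1"
  shows "norm (fhat \<phi> \<xi>) \<le> 1"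
proof -
  have "bdd_above (range (\<lambda>\<xi>. norm (fhat \<phi> \<xi>)))"
    using fhat_bound[OF S_d_abs_summable[OF assms(1)]] by (intro bdd_aboveI2)
  from cSUP_upper[OF UNIV_I this, of \<xi>] assms(2) show ?thesis by simp
qed

text \<open>If the maximum over the compact set \<open>cube - V\<close> were 1, the maximizer could
  be moved by periods into (-\<pi>, \<pi>]^d and would have to land on \<xi>0. Its deviation z from
  \<xi>0 would then be a point of 2 \<pi> Z^d inside the cube, hence 0, which lies in V.\<close>

lemma fhat_lt_1_away:
  assumes \<phi>: "\<phi> \<in> S_d" and sup: "(SUP \<xi>. norm (fhat \<phi> \<xi>)) = 1" and Om: "Omega \<phi> = {\<xi>0}"
    and V: "open V" "0 \<in> V"
  obtains \<rho> where "0 \<le> \<rho>" "\<rho> < 1" "\<And>\<eta>. \<eta> \<in> cube \<Longrightarrow> \<eta> \<notin> V \<Longrightarrow> norm (fhat \<phi> (\<eta> + \<xi>0)) \<le> \<rho>"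
proof (cases "cube - V = {}")
  case True
  then show ?thesis by (intro that[of 0]) auto
next
  case False
  have cont: "continuous_on S (\<lambda>\<eta>. norm (fhat \<phi> (\<eta> + \<xi>0)))" for S
    by (intro continuous_on_norm continuous_on_compose2[OF continuous_fhat[OF S_d_abs_summable[OF \<phi>], of UNIV]])
       (auto intro!: continuous_intros)
  have "compact (cube - V)" by (intro compact_diff V) (simp add: cube_def)
  then obtain z where z: "z \<in> cube - V" "\<And>\<eta>. \<eta> \<in> cube - V \<Longrightarrow> norm (fhat \<phi> (\<eta> + \<xi>0)) \<le> norm (fhat \<phi> (z + \<xi>0))"
    using continuous_attains_sup[OF _ False cont] by blast
  have "norm (fhat \<phi> (z + \<xi>0)) \<noteq> 1"
  proof
    assume 1: "norm (fhat \<phi> (z + \<xi>0)) = 1"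
    \<comment> \<open>Rounding up, not down, since the cell in \<open>Omega\<close> is open on the
      left and closed on the right.\<close>
    define k :: "int^'a" where "k = (\<chi> i. \<lceil>((z + \<xi>0) $ i - pi) / (2 * pi)\<rceil>)"
    define w where "w = z + \<xi>0 + (2 * pi) *\<^sub>R lat (- k)"
    have w: "w $ i = (z + \<xi>0) $ i - 2 * pi * of_int (k $ i)" for i by (simp add: w_def lat_def)
    have "- pi < w $ i \<and> w $ i \<le> pi" for i
    proof -
      let ?y = "((z + \<xi>0) $ i - pi) / (2 * pi)"
      have "?y \<le> of_int (k $ i)" "of_int (k $ i) < ?y + 1" by (auto simp: k_def) linarith
      then show ?thesis unfolding w by (simp add: field_simps)
    qed
    moreover have "norm (fhat \<phi> w) = 1" using 1 unfolding w_def fhat_periodic .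
    ultimately have "w \<in> Omega \<phi>" by (simp add: Omega_def)
    then have "w = \<xi>0" using Om by simp
    then have zk: "z $ i = 2 * pi * of_int (k $ i)" for i using w[of i] by (simp add: algebra_simps)
    have "k $ i = 0" for i
    proof -
      have "\<bar>z $ i\<bar> \<le> pi" using z(1) by (auto simp: mem_cube abs_le_iff minus_le_iff)
      then have "\<bar>real_of_int (k $ i)\<bar> \<le> 1 / 2" by (simp add: zk abs_mult field_simps)
      then show ?thesis by linarith
    qed
    then have "z = 0" using zk by (simp add: vec_eq_iff)
    with z V show False by auto
  qed
  then have "norm (fhat \<phi> (z + \<xi>0)) < 1" using fhat_le_1[OF \<phi> sup, of "z + \<xi>0"] by simp
  then show ?thesis using z by (intro that[of "norm (fhat \<phi> (z + \<xi>0))"]) auto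
qed

section \<open>Localization near the maximum\<close>

lemma geometric_small:
  fixes \<rho> \<epsilon> \<mu> :: real
  assumes "0 \<le> \<rho>" "\<rho> < 1" "\<epsilon> > 0"
  shows "\<forall>\<^sub>F n in sequentially. \<rho> ^ n \<le> \<epsilon> * real n powr (- \<mu>)"
proof (cases "\<rho> = 0")
  case True
  have "\<forall>\<^sub>F n in sequentially. n > (0::nat)" by (rule eventually_gt_at_top)
  then show ?thesis by eventually_elim (use True assms in \<open>simp add: power_0_left\<close>)
next
  case False
  then have "\<rho> > 0" using assms by simp
  then have "(\<lambda>n. real n powr \<mu> * \<rho> ^ n) \<longlonglongrightarrow> 0"
    using assms(2) by real_asymp
  then have "\<forall>\<^sub>F n in sequentially. real n powr \<mu> * \<rho> ^ n < \<epsilon>"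
    using assms(3) by (rule order_tendstoD)
  moreover have "\<forall>\<^sub>F n in sequentially. n > (0::nat)" by (rule eventually_gt_at_top)
  ultimately show ?thesis
    by eventually_elim (simp add: powr_minus field_simps)
qed

lemma continuous_poly_nolin: "poly_nolin Q \<Longrightarrow> continuous_on S Q"
  by (auto simp: poly_nolin_def intro!: continuous_intros)

lemma borel_measurable_poly_nolin: "poly_nolin Q \<Longrightarrow> Q \<in> borel_measurable borel"
  by (intro borel_measurable_continuous_onI continuous_poly_nolin)

lemma smooth_on_continuous: "smooth_on U f \<Longrightarrow> continuous_on U f"
  unfolding smooth_on_def by (metis Ck.simps(1))

lemma measure_cube: "measure lborel (cube :: (real^'d::finite) set) = (2 * pi) ^ CARD('d)"
proof -
  have "(cube :: (real^'d) set) \<noteq> {}" by (auto simp: cube_def interval_ne_empty_cart)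
  then show ?thesis
    unfolding cube_def by (simp add: content_cbox_cart)
qed

lemma set_integrable_bounded:
  fixes f :: "'a::euclidean_space \<Rightarrow> complex"
  assumes S [measurable]: "S \<in> sets borel" and "bounded S"
    and "(\<lambda>x. indicator S x *\<^sub>R f x) \<in> borel_measurable borel"
    and "\<And>x. x \<in> S \<Longrightarrow> norm (f x) \<le> B"
  shows "set_integrable lborel S f"
  unfolding set_integrable_def
proof (rule integrableI_bounded_set[where A = S and B = B])
  show "emeasure lborel S < \<infinity>" using assms(2) by (rule emeasure_bounded_finite)
qed (use assms in \<open>auto simp: indicator_def\<close>)

text \<open>The contribution outside V is at most \<rho>^n times the volume of the cube, which the
  factor (1 / (2 \<pi>))^d cancels; it is uniform in x because characters are unimodular. Inside V
  the drift joins the character and produces the displacement x - n \<alpha>.\<close>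

lemma cpow_localize:
  fixes \<phi> :: "int^'d::finite \<Rightarrow> complex"
  assumes \<phi>: "\<phi> \<in> S_d" and sup: "(SUP \<xi>. norm (fhat \<phi> \<xi>)) = 1" and Om: "Omega \<phi> = {\<xi>0}"
    and dec: "log_decomp \<phi> \<xi>0 U \<alpha> Q Qt R Rt"
    and V: "open V" "0 \<in> V" "V \<subseteq> U" "V \<subseteq> cube"
  obtains \<rho> where "0 \<le> \<rho>" "\<rho> < 1"
    "\<And>n x. norm (cpow \<phi> n x - fhat \<phi> \<xi>0 ^ n * cis (- (lat x \<bullet> \<xi>0)) * ((1 / (2 * pi)) ^ CARD('d) *
        (LINT \<eta>:V|lborel. exp (- (real n * (of_real (R \<eta> + Rt \<eta>) + \<i> * of_real (Q \<eta> + Qt \<eta>)))) *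
           cis (- ((lat x - real n *\<^sub>R \<alpha>) \<bullet> \<eta>))))) \<le> \<rho> ^ n"
proof -
  obtain \<rho> where \<rho>: "0 \<le> \<rho>" "\<rho> < 1" "\<And>\<eta>. \<eta> \<in> cube \<Longrightarrow> \<eta> \<notin> V \<Longrightarrow> norm (fhat \<phi> (\<eta> + \<xi>0)) \<le> \<rho>"
    using fhat_lt_1_away[OF \<phi> sup Om V(1,2)] by blast
  have [measurable]: "V \<in> sets borel" using V(1) by simp
  have "norm (fhat \<phi> \<xi>0) = 1" using Om by (auto simp: Omega_def)
  then have nz: "fhat \<phi> \<xi>0 \<noteq> 0" by auto
  show ?thesis
  proof (rule that[OF \<rho>(1,2)])
    fix n x
    let ?f = "\<lambda>\<eta>. fhat \<phi> (\<eta> + \<xi>0) ^ n * cis (- (lat x \<bullet> (\<eta> + \<xi>0)))"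
    let ?g = "\<lambda>\<eta>. exp (- (real n * (of_real (R \<eta> + Rt \<eta>) + \<i> * of_real (Q \<eta> + Qt \<eta>)))) *
           cis (- ((lat x - real n *\<^sub>R \<alpha>) \<bullet> \<eta>))"
    have f: "?f \<eta> = fhat \<phi> \<xi>0 ^ n * cis (- (lat x \<bullet> \<xi>0)) * ?g \<eta>" if "\<eta> \<in> V" for \<eta>
    proof -
      let ?L = "\<i> * of_real (\<alpha> \<bullet> \<eta>) - \<i> * of_real (Q \<eta> + Qt \<eta>) - of_real (R \<eta> + Rt \<eta>)"
      have "fhat \<phi> (\<eta> + \<xi>0) \<noteq> 0" "Ln (fhat \<phi> (\<eta> + \<xi>0) / fhat \<phi> \<xi>0) = ?L"
        using dec that V(3) by (auto simp: log_decomp_def)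
      then have "fhat \<phi> (\<eta> + \<xi>0) / fhat \<phi> \<xi>0 = exp ?L"
        using nz by (metis divide_eq_0_iff exp_Ln)
      then have "fhat \<phi> (\<eta> + \<xi>0) = fhat \<phi> \<xi>0 * exp ?L" using nz by (simp add: field_simps)
      then have "?f \<eta> = fhat \<phi> \<xi>0 ^ n * exp (real n * ?L) * cis (- (lat x \<bullet> (\<eta> + \<xi>0)))"
        by (simp add: power_mult_distrib exp_of_nat_mult)
      moreover have "exp (real n * ?L) * cis (- (lat x \<bullet> (\<eta> + \<xi>0))) = cis (- (lat x \<bullet> \<xi>0)) * ?g \<eta>"
        unfolding cis_conv_exp exp_add[symmetric]
        by (rule arg_cong[where f = exp]) (simp add: algebra_simps inner_simps)
      ultimately show ?thesis by (simp add: mult.assoc)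
    qed
    have cont: "continuous_on S ?f" for S
      by (intro continuous_intros continuous_on_compose2[OF continuous_fhat[OF S_d_abs_summable[OF \<phi>], of UNIV]]) auto
    have int: "set_integrable lborel cube ?f"
      unfolding cube_def set_integrable_def by (intro borel_integrable_compact cont) auto
    have intV: "set_integrable lborel V ?f" and intC: "set_integrable lborel (cube - V) ?f"
      using V(4) by (auto intro!: set_integrable_subset[OF int])
    have "(LINT \<eta>:cube|lborel. ?f \<eta>) = (LINT \<eta>:V \<union> (cube - V)|lborel. ?f \<eta>)"
      using V(4) by (simp add: Un_absorb1)
    also have "\<dots> = (LINT \<eta>:V|lborel. ?f \<eta>) + (LINT \<eta>:cube - V|lborel. ?f \<eta>)"
      by (rule set_integral_Un) (use intV intC in auto)
    also have "(LINT \<eta>:V|lborel. ?f \<eta>) = fhat \<phi> \<xi>0 ^ n * cis (- (lat x \<bullet> \<xi>0)) * (LINT \<eta>:V|lborel. ?g \<eta>)"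
      by (subst set_lebesgue_integral_cong[OF _ allI[OF impI[OF f]]]) auto
    finally have "cpow \<phi> n x - fhat \<phi> \<xi>0 ^ n * cis (- (lat x \<bullet> \<xi>0)) * ((1 / (2 * pi)) ^ CARD('d) * (LINT \<eta>:V|lborel. ?g \<eta>))
        = (1 / (2 * pi)) ^ CARD('d) * (LINT \<eta>:cube - V|lborel. ?f \<eta>)"
      unfolding cpow_integral[OF \<phi>, of n x \<xi>0] by (simp add: algebra_simps)
    moreover have "norm (LINT \<eta>:cube - V|lborel. ?f \<eta>) \<le> \<rho> ^ n * (2 * pi) ^ CARD('d)"
    proof -
      have "norm (LINT \<eta>:cube - V|lborel. ?f \<eta>) \<le> (LINT \<eta>:cube - V|lborel. norm (?f \<eta>))"
        using intC by (rule set_integral_norm_bound)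
      also have "\<dots> \<le> (LINT \<eta>|lborel. indicator (cube :: (real^'d) set) \<eta> * \<rho> ^ n)"
        unfolding set_lebesgue_integral_def
      proof (rule Bochner_Integration.integral_mono)
        show "integrable lborel (\<lambda>\<eta>. indicat_real (cube - V) \<eta> *\<^sub>R norm (?f \<eta>))"
          using set_integrable_norm[OF intC] by (simp add: set_integrable_def)
        show "integrable lborel (\<lambda>\<eta>::real^'d. indicator cube \<eta> * \<rho> ^ n)"
          by (intro integrable_mult_left integrable_real_indicator)
             (use emeasure_bounded_finite[of cube] in \<open>auto simp: cube_def\<close>)
        fix \<eta>
        show "indicat_real (cube - V) \<eta> *\<^sub>R norm (?f \<eta>) \<le> indicator cube \<eta> * \<rho> ^ n"
          using \<rho>(1) \<rho>(3)[of \<eta>] by (auto simp: indicator_def norm_mult norm_power intro!: power_mono)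
      qed
      also have "\<dots> = \<rho> ^ n * (2 * pi) ^ CARD('d)"
        by (simp add: measure_cube)
      finally show ?thesis .
    qed
    ultimately show "norm (cpow \<phi> n x - fhat \<phi> \<xi>0 ^ n * cis (- (lat x \<bullet> \<xi>0)) * ((1 / (2 * pi)) ^ CARD('d) * (LINT \<eta>:V|lborel. ?g \<eta>))) \<le> \<rho> ^ n"
      by (simp add: norm_mult norm_power norm_divide power_one_over field_simps)
  qed
qed

context contracting_pos_hom
begin

lemma open_sublevel: "open {x. P x < s}"
  by (intro open_Collect_less continuous_P) auto

lemma zero_mem_sublevel: "s > 0 \<Longrightarrow> 0 \<in> {x. P x < s}"
  using P_eq_0[of 0] by simp

lemma bounded_sublevel: "bounded {x. P x < s}"
  by (rule bounded_subset[OF compact_imp_bounded[OF compact_sublevel[of s]]]) auto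

lemma sublevel_integral_rescale:
  fixes g :: "real^'d \<Rightarrow> complex"
  assumes "t > 0" and g: "(\<lambda>x. indicator {x. P x < s} x *\<^sub>R g x) \<in> borel_measurable borel"
  shows "(LINT x:{x. P x < s}|lborel. g x) =
    t powr (- mu P) *\<^sub>R (LINT x:{x. P x < t * s}|lborel. g (tpow (1 / t) E *v x))"
proof -
  have p: "(1 / t) powr mu P = t powr (- mu P)"
    using assms(1) by (simp add: powr_minus_divide powr_divide)
  have ind: "indicator {x. P x < s} (tpow (1 / t) E *v x) = (indicator {x. P x < t * s} x :: real)" for x
    using assms(1) by (simp add: indicator_def P_tpow field_simps)
  have "(LINT x:{x. P x < s}|lborel. g x)
      = (1 / t) powr (mu P) *\<^sub>R (LINT x|lborel. indicator {x. P x < s} (tpow (1 / t) E *v x) *\<^sub>R g (tpow (1 / t) E *v x))"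
    unfolding set_lebesgue_integral_def mu_eq
    by (rule integral_tpow(1)[where f = "\<lambda>x. indicator {x. P x < s} x *\<^sub>R g x", OF _ g]) (use assms(1) in simp)
  then show ?thesis
    unfolding p ind set_lebesgue_integral_def .
qed

end

lemma subhomD:
  assumes "subhom E f" "\<epsilon> > 0" "compact K"
  obtains \<tau> where "\<tau> > 0" "\<And>t \<xi>. 0 < t \<Longrightarrow> t < \<tau> \<Longrightarrow> \<xi> \<in> K \<Longrightarrow> \<bar>f (tpow t E *v \<xi>)\<bar> \<le> \<epsilon> * t"
proof -
  have "\<exists>\<tau>>0. \<forall>t. 0 < t \<and> t < \<tau> \<longrightarrow> (\<forall>\<xi>\<in>K. \<bar>f (tpow t E *v \<xi>)\<bar> \<le> \<epsilon> * t)"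
    using assms by (simp add: subhom_def)
  then obtain \<tau> where "\<tau> > 0" "\<forall>t. 0 < t \<and> t < \<tau> \<longrightarrow> (\<forall>\<xi>\<in>K. \<bar>f (tpow t E *v \<xi>)\<bar> \<le> \<epsilon> * t)"
    by (elim exE conjE)
  then show ?thesis by (intro that[of \<tau>]) simp_all
qed

text \<open>Subhomogeneity on the single compact set {P = 1} is uniform over directions, and polar
  form turns the time t into P x. The origin has no polar form; there f 0 = 0 is used.\<close>

lemma subhom_bound:
  assumes P: "contracting_pos_hom P E" and f: "subhom E f" and "f 0 = 0" "c > 0"
  obtains \<delta> where "\<delta> > 0" "\<And>x. P x < \<delta> \<Longrightarrow> \<bar>f x\<bar> \<le> c * P x"
proof -
  interpret contracting_pos_hom P E by (fact P)
  obtain \<tau> where \<tau>: "\<tau> > 0" "\<And>t x. 0 < t \<Longrightarrow> t < \<tau> \<Longrightarrow> x \<in> {x. P x = 1} \<Longrightarrow> \<bar>f (tpow t E *v x)\<bar> \<le> c * t"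
    by (rule subhomD[OF f \<open>c > 0\<close> compact_level], rule that)
  show ?thesis
  proof (rule that[OF \<tau>(1)])
    fix x assume x: "P x < \<tau>"
    show "\<bar>f x\<bar> \<le> c * P x"
    proof (cases "x = 0")
      case False
      then obtain \<theta> where "P \<theta> = 1" "x = tpow (P x) E *v \<theta>" by (rule polar)
      then show ?thesis using \<tau>(2)[of "P x" \<theta>] x P_pos[OF False] by simp
    qed (use assms(3) P_eq_0[of 0] in simp)
  qed
qed

lemma subhom_pointwise_limit:
  assumes f: "subhom E f"
  shows "(\<lambda>n. real n * f (tpow (1 / real n) E *v x)) \<longlonglongrightarrow> 0"
proof (rule LIMSEQ_I)
  fix r :: real assume r: "r > 0"
  obtain \<tau> where \<tau>: "\<tau> > 0" "\<And>t y. 0 < t \<Longrightarrow> t < \<tau> \<Longrightarrow> y \<in> {x} \<Longrightarrow> \<bar>f (tpow t E *v y)\<bar> \<le> (r / 2) * t"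
    by (rule subhomD[OF f half_gt_zero[OF r] compact_sing[of x]], rule that)
  obtain m where "inverse (real (Suc m)) < \<tau>"
    using \<tau>(1) reals_Archimedean by blast
  then obtain N :: nat where N: "N > 0" "1 / real N < \<tau>"
    by (intro that[of "Suc m"]) (auto simp: inverse_eq_divide)
  show "\<exists>N. \<forall>n\<ge>N. norm (real n * f (tpow (1 / real n) E *v x) - 0) < r"
  proof (intro exI allI impI)
    fix n assume n: "N \<le> n"
    have "1 / real n \<le> 1 / real N" using n N(1) by (intro divide_left_mono) auto
    then have "\<bar>f (tpow (1 / real n) E *v x)\<bar> \<le> (r / 2) * (1 / real n)"
      using \<tau>(2)[of "1 / real n"] n N by auto
    then have "real n * \<bar>f (tpow (1 / real n) E *v x)\<bar> \<le> r / 2"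
      using n N(1) by (simp add: field_simps)
    then show "norm (real n * f (tpow (1 / real n) E *v x) - 0) < r"
      using r by (simp add: abs_mult)
  qed
qed

section \<open>Points of positive homogeneous type\<close>

lemma zero_mem_cube_interior: "open (box (\<chi> i. - pi) (\<chi> i. pi) :: (real^'d::finite) set)"
  "0 \<in> (box (\<chi> i. - pi) (\<chi> i. pi) :: (real^'d) set)" "box (\<chi> i. - pi) (\<chi> i. pi) \<subseteq> (cube :: (real^'d) set)"
  by (auto simp: mem_box_cart mem_cube less_imp_le)

text \<open>Dominated convergence with hypotheses for n > 0 only: the dilation by 1 / n is
  meaningful from n = 1 on, and at n = 0 the dominating bounds may fail.\<close>

lemma tendsto_integral_Suc:
  fixes f :: "nat \<Rightarrow> 'a \<Rightarrow> real"
  assumes "\<And>n. n > 0 \<Longrightarrow> f n \<in> borel_measurable M" "integrable M w"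
    and "AE x in M. (\<lambda>n. f n x) \<longlonglongrightarrow> 0"
    and "\<And>n x. n > 0 \<Longrightarrow> \<bar>f n x\<bar> \<le> w x"
  shows "(\<lambda>n. \<integral>x. f n x \<partial>M) \<longlonglongrightarrow> 0"
proof -
  have "(\<lambda>n. \<integral>x. f (Suc n) x \<partial>M) \<longlonglongrightarrow> (\<integral>x. 0 \<partial>M)"
  proof (rule integral_dominated_convergence[where w = w])
    show "AE x in M. (\<lambda>n. f (Suc n) x) \<longlonglongrightarrow> 0"
      using assms(3) by eventually_elim (rule LIMSEQ_Suc)
    show "AE x in M. norm (f (Suc n) x) \<le> w x" for n
      using assms(4)[of "Suc n"] by simp
    show "f (Suc n) \<in> borel_measurable M" for n
      by (rule assms(1)) simp
  qed (simp_all add: assms(2))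
  then show ?thesis by (simp add: LIMSEQ_imp_Suc)
qed

lemma positive_type_expansion:
  fixes \<phi> :: "int^'d::finite \<Rightarrow> complex"
  assumes \<phi>: "\<phi> \<in> S_d" and sup: "(SUP \<xi>. norm (fhat \<phi> \<xi>)) = 1" and Om: "Omega \<phi> = {\<xi>0}"
    and type: "pos_type \<phi> \<xi>0 \<alpha> Q R" and \<epsilon>: "\<epsilon> > 0"
  shows "\<forall>\<^sub>F n in sequentially. \<forall>x.
     norm (cpow \<phi> n x - fhat \<phi> \<xi>0 ^ n * cis (- (lat x \<bullet> \<xi>0)) *
        H_pos (real n) (\<lambda>\<xi>. of_real (R \<xi>) + \<i> * of_real (Q \<xi>)) (lat x - real n *\<^sub>R \<alpha>))
     \<le> \<epsilon> * real n powr (- mu R)"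
proof -
  obtain U Qt Rt E where dec: "log_decomp \<phi> \<xi>0 U \<alpha> Q Qt R Rt" and R: "pos_hom R" "E \<in> Exp R"
    and Q: "hom_wrt E Q" and Qt: "subhom E Qt" and Rt: "subhom E Rt"
    using type by (auto simp: pos_type_def)
  have "contracting E" using Qt by (simp add: subhom_def)
  then interpret contracting_pos_hom R E using R by unfold_locales
  have U: "open U" "0 \<in> U" and pQ: "poly_nolin Q" and pR: "poly_nolin R" and sm: "smooth_on U Qt" "smooth_on U Rt" and Rt0: "Rt 0 = 0"
    using dec by (auto simp: log_decomp_def)
  have [measurable]: "Q \<in> borel_measurable borel" using pQ by (rule borel_measurable_poly_nolin)
  obtain \<delta>1 where \<delta>1: "\<delta>1 > 0" "\<And>x. R x < \<delta>1 \<Longrightarrow> x \<in> U \<inter> box (\<chi> i. - pi) (\<chi> i. pi)"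
    by (rule sublevel_shrink[of "U \<inter> box (\<chi> i. - pi) (\<chi> i. pi)"]) (use U zero_mem_cube_interior in auto)
  \<comment> \<open>The factor 1 / 2 leaves R + Rt \<ge> R / 2 on V.\<close>
  obtain \<delta>2 where \<delta>2: "\<delta>2 > 0" "\<And>x. R x < \<delta>2 \<Longrightarrow> \<bar>Rt x\<bar> \<le> (1 / 2) * R x"
    by (rule subhom_bound[OF contracting_pos_hom_axioms Rt Rt0, of "1 / 2"]) auto
  define \<delta> where "\<delta> = min \<delta>1 \<delta>2"
  define V where "V = {x. R x < \<delta>}"
  have \<delta>: "\<delta> > 0" using \<delta>1 \<delta>2 by (simp add: \<delta>_def)
  have V: "open V" "0 \<in> V" "V \<subseteq> U" "V \<subseteq> cube"
    using open_sublevel[of \<delta>] zero_mem_sublevel[OF \<delta>] \<delta>1(2) zero_mem_cube_interior(3)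
    by (auto simp: V_def \<delta>_def)
  have [measurable]: "V \<in> sets borel" using V(1) by simp
  obtain \<rho> where \<rho>: "0 \<le> \<rho>" "\<rho> < 1"
    "\<And>n x. norm (cpow \<phi> n x - fhat \<phi> \<xi>0 ^ n * cis (- (lat x \<bullet> \<xi>0)) * ((1 / (2 * pi)) ^ CARD('d) *
        (LINT \<eta>:V|lborel. exp (- (real n * (of_real (R \<eta> + Rt \<eta>) + \<i> * of_real (Q \<eta> + Qt \<eta>)))) *
           cis (- ((lat x - real n *\<^sub>R \<alpha>) \<bullet> \<eta>))))) \<le> \<rho> ^ n"
    by (rule cpow_localize[OF \<phi> sup Om dec V], rule that)
  define g where "g = (\<lambda>n \<eta>. indicator V \<eta> *\<^sub>R exp (- (real n * (of_real (R \<eta> + Rt \<eta>) + \<i> * of_real (Q \<eta> + Qt \<eta>)))))"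
  define h where "h = (\<lambda>\<zeta>. exp (- (of_real (R \<zeta>) + \<i> * of_real (Q \<zeta>))))"
  define T where "T = (\<lambda>n. tpow (1 / real n) E)"
  \<comment> \<open>The L1 distance of the rescaled integrand to its limit, with the unimodular
    character left out. It does not involve x, which is the source of uniformity over the whole
    lattice.\<close>
  define a where "a = (\<lambda>n. \<integral>\<zeta>. norm (g n (T n *v \<zeta>) - h \<zeta>) \<partial>lborel)"
  have g_meas [measurable]: "g n \<in> borel_measurable borel" for n
    unfolding g_def
    by (intro borel_measurable_continuous_on_indicator continuous_intros)
       (use V(3) in \<open>auto intro!: continuous_poly_nolin pQ pR
          continuous_on_subset[OF smooth_on_continuous[OF sm(1)]] continuous_on_subset[OF smooth_on_continuous[OF sm(2)]]\<close>)
  have h_meas [measurable]: "h \<in> borel_measurable borel" unfolding h_def by measurable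
  have RT: "R (T n *v \<zeta>) = R \<zeta> / real n" and QT: "Q (T n *v \<zeta>) = Q \<zeta> / real n" if "n > 0" for n \<zeta>
    using P_tpow[of "1 / real n"] Q that by (auto simp: T_def hom_wrt_def)
  have h_norm: "norm (h \<zeta>) = exp (- 1 * R \<zeta>)" for \<zeta> by (simp add: h_def)
  have g_norm: "norm (g n (T n *v \<zeta>)) \<le> exp (- (1 / 2) * R \<zeta>)" if n: "n > 0" for n \<zeta>
  proof (cases "T n *v \<zeta> \<in> V")
    case True
    then have "\<bar>Rt (T n *v \<zeta>)\<bar> \<le> (1 / 2) * R (T n *v \<zeta>)"
      by (intro \<delta>2(2)) (simp add: V_def \<delta>_def)
    then have "R (T n *v \<zeta>) / 2 \<le> R (T n *v \<zeta>) + Rt (T n *v \<zeta>)" by linarith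
    then have "- (real n * (R (T n *v \<zeta>) + Rt (T n *v \<zeta>))) \<le> - (real n * (R (T n *v \<zeta>) / 2))"
      unfolding neg_le_iff_le by (rule mult_left_mono) simp
    also have "\<dots> = - (1 / 2) * R \<zeta>" using n by (simp add: RT)
    finally show ?thesis using True by (simp add: g_def)
  qed (simp add: g_def)
  have h_int: "integrable lborel h"
    by (rule Bochner_Integration.integrable_bound[OF integrable_exp_minus[of 1]]) (simp_all add: h_norm)
  have g_int: "integrable lborel (\<lambda>\<zeta>. g n (T n *v \<zeta>))" if "n > 0" for n
    by (rule Bochner_Integration.integrable_bound[OF integrable_exp_minus[of "1 / 2"]]) (use g_norm[OF that] in simp_all)
  have a0: "a \<longlonglongrightarrow> 0"
    unfolding a_def
  proof (rule tendsto_integral_Suc)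
    show "integrable lborel (\<lambda>\<zeta>. exp (- (1 / 2) * R \<zeta>) + exp (- 1 * R \<zeta>))"
      by (intro Bochner_Integration.integrable_add integrable_exp_minus) auto
    show "\<bar>norm (g n (T n *v \<zeta>) - h \<zeta>)\<bar> \<le> exp (- (1 / 2) * R \<zeta>) + exp (- 1 * R \<zeta>)" if "n > 0" for n \<zeta>
      using norm_triangle_ineq4[of "g n (T n *v \<zeta>)" "h \<zeta>"] g_norm[OF that, of \<zeta>] h_norm[of \<zeta>] by simp
    show "AE \<zeta> in lborel. (\<lambda>n. norm (g n (T n *v \<zeta>) - h \<zeta>)) \<longlonglongrightarrow> 0"
    proof (rule AE_I2)
      fix \<zeta>
      let ?u = "\<lambda>n. exp (- (of_real (R \<zeta> + real n * Rt (T n *v \<zeta>)) + \<i> * of_real (Q \<zeta> + real n * Qt (T n *v \<zeta>))))"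
      have "(\<lambda>n. real n * Rt (T n *v \<zeta>)) \<longlonglongrightarrow> 0" "(\<lambda>n. real n * Qt (T n *v \<zeta>)) \<longlonglongrightarrow> 0"
        unfolding T_def by (intro subhom_pointwise_limit Rt Qt)+
      then have "?u \<longlonglongrightarrow> exp (- (of_real (R \<zeta> + 0) + \<i> * of_real (Q \<zeta> + 0)))"
        by (intro tendsto_intros)
      then have u: "?u \<longlonglongrightarrow> h \<zeta>" by (simp add: h_def)
      have "(\<lambda>n. R \<zeta> / real n) \<longlonglongrightarrow> 0" by real_asymp
      then have "\<forall>\<^sub>F n in sequentially. R \<zeta> / real n < \<delta>" using \<delta> by (rule order_tendstoD)
      moreover have "\<forall>\<^sub>F n in sequentially. n > (0::nat)" by (rule eventually_gt_at_top)
      ultimately have "\<forall>\<^sub>F n in sequentially. ?u n = g n (T n *v \<zeta>)"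
        by eventually_elim (simp add: g_def V_def RT QT algebra_simps)
      with u have "(\<lambda>n. g n (T n *v \<zeta>)) \<longlonglongrightarrow> h \<zeta>" by (rule Lim_transform_eventually)
      from tendsto_norm[OF tendsto_diff[OF this tendsto_const[of "h \<zeta>"]]]
      show "(\<lambda>n. norm (g n (T n *v \<zeta>) - h \<zeta>)) \<longlonglongrightarrow> 0" by simp
    qed
  qed (auto simp: T_def)
  have key: "norm (cpow \<phi> n x - fhat \<phi> \<xi>0 ^ n * cis (- (lat x \<bullet> \<xi>0)) *
        H_pos (real n) (\<lambda>\<xi>. of_real (R \<xi>) + \<i> * of_real (Q \<xi>)) (lat x - real n *\<^sub>R \<alpha>))
      \<le> \<rho> ^ n + real n powr (- mu R) * a n" if n: "n > 0" for n x
  proof -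
    let ?y = "lat x - real n *\<^sub>R \<alpha>" and ?C = "(1 / (2 * pi)) ^ CARD('d)"
    let ?c = "\<lambda>\<zeta>. cis (- (?y \<bullet> (T n *v \<zeta>)))"
    have c_meas [measurable]: "?c \<in> borel_measurable borel"
      by (intro borel_measurable_continuous_onI continuous_intros matrix_vector_mult_linear_continuous_on)
    have p: "(1 / real n) powr trace E = real n powr (- mu R)"
      using n by (simp add: powr_minus_divide powr_divide mu_eq)
    have "(LINT \<eta>:V|lborel. exp (- (real n * (of_real (R \<eta> + Rt \<eta>) + \<i> * of_real (Q \<eta> + Qt \<eta>)))) * cis (- (?y \<bullet> \<eta>)))
        = (LINT \<eta>|lborel. g n \<eta> * cis (- (?y \<bullet> \<eta>)))"
      by (simp add: set_lebesgue_integral_def g_def)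
    also have "\<dots> = (1 / real n) powr trace E *\<^sub>R (LINT \<zeta>|lborel. g n (T n *v \<zeta>) * ?c \<zeta>)"
      unfolding T_def by (rule integral_tpow(1)[where f = "\<lambda>\<eta>. g n \<eta> * cis (- (?y \<bullet> \<eta>))"])
        (use n in \<open>auto intro!: borel_measurable_times borel_measurable_continuous_onI[of "\<lambda>\<eta>. cis (- (?y \<bullet> \<eta>))"] continuous_intros\<close>)
    finally have G: "(LINT \<eta>:V|lborel. exp (- (real n * (of_real (R \<eta> + Rt \<eta>) + \<i> * of_real (Q \<eta> + Qt \<eta>)))) * cis (- (?y \<bullet> \<eta>)))
        = real n powr (- mu R) *\<^sub>R (LINT \<zeta>|lborel. g n (T n *v \<zeta>) * ?c \<zeta>)" by (simp only: p)
    \<comment> \<open>The attractor is rescaled by the same dilation, so both integrals carry the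
      factor n powr (- mu R) and are compared in the same variable.\<close>
    let ?h = "\<lambda>\<xi>. exp (- (of_real (real n) * (of_real (R \<xi>) + \<i> * of_real (Q \<xi>)))) * cis (- (?y \<bullet> \<xi>))"
    have h_meas': "?h \<in> borel_measurable borel"
      by (intro borel_measurable_times borel_measurable_continuous_onI[of "\<lambda>\<eta>. cis (- (?y \<bullet> \<eta>))"] continuous_intros) measurable
    have "integrable lborel ?h"
      by (rule Bochner_Integration.integrable_bound[OF integrable_exp_minus[of "real n"]]) (use n h_meas' in \<open>simp_all add: norm_mult\<close>)
    then have "integral UNIV ?h = (LINT \<xi>|lborel. ?h \<xi>)" by (rule integral_lborel)
    also have "\<dots> = (1 / real n) powr trace E *\<^sub>R (LINT \<zeta>|lborel. ?h (T n *v \<zeta>))"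
      unfolding T_def by (rule integral_tpow(1)[where f = ?h]) (use n h_meas' in auto)
    also have "(\<lambda>\<zeta>. ?h (T n *v \<zeta>)) = (\<lambda>\<zeta>. h \<zeta> * ?c \<zeta>)"
      using n by (auto simp: h_def RT QT fun_eq_iff distrib_left)
    finally have H: "integral UNIV ?h = real n powr (- mu R) *\<^sub>R (LINT \<zeta>|lborel. h \<zeta> * ?c \<zeta>)" by (simp only: p)
    have i1: "integrable lborel (\<lambda>\<zeta>. g n (T n *v \<zeta>) * ?c \<zeta>)"
      by (rule Bochner_Integration.integrable_bound[OF g_int[OF n]]) (auto simp: norm_mult)
    have i2: "integrable lborel (\<lambda>\<zeta>. h \<zeta> * ?c \<zeta>)"
      by (rule Bochner_Integration.integrable_bound[OF h_int]) (auto simp: norm_mult)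
    have d: "norm ((LINT \<zeta>|lborel. g n (T n *v \<zeta>) * ?c \<zeta>) - (LINT \<zeta>|lborel. h \<zeta> * ?c \<zeta>)) \<le> a n"
    proof -
      have "(LINT \<zeta>|lborel. g n (T n *v \<zeta>) * ?c \<zeta>) - (LINT \<zeta>|lborel. h \<zeta> * ?c \<zeta>)
          = (LINT \<zeta>|lborel. (g n (T n *v \<zeta>) - h \<zeta>) * ?c \<zeta>)"
        using i1 i2 by (simp add: left_diff_distrib)
      also have "norm \<dots> \<le> (LINT \<zeta>|lborel. norm ((g n (T n *v \<zeta>) - h \<zeta>) * ?c \<zeta>))"
        by (rule integral_norm_bound)
      also have "\<dots> = a n" by (simp add: a_def norm_mult)
      finally show ?thesis .
    qed
    let ?M = "fhat \<phi> \<xi>0 ^ n * cis (- (lat x \<bullet> \<xi>0))"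
    have "\<xi>0 \<in> Omega \<phi>" using Om by simp
    then have f1: "norm ?M = 1" by (simp add: Omega_def norm_mult norm_power)
    have C1: "norm (?C :: complex) \<le> 1"
      using pi_ge_two by (simp add: norm_power norm_divide power_le_one)
    let ?G = "LINT \<eta>:V|lborel. exp (- (real n * (of_real (R \<eta> + Rt \<eta>) + \<i> * of_real (Q \<eta> + Qt \<eta>)))) * cis (- (?y \<bullet> \<eta>))"
    have "norm (?M * (?C * ?G) - ?M * (?C * integral UNIV ?h)) = norm (?C :: complex) * (real n powr (- mu R) * norm ((LINT \<zeta>|lborel. g n (T n *v \<zeta>) * ?c \<zeta>) - (LINT \<zeta>|lborel. h \<zeta> * ?c \<zeta>)))"
      unfolding right_diff_distrib[symmetric] norm_mult f1 G H scaleR_right_diff_distrib[symmetric] norm_scaleR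
      using f1 by (simp add: norm_mult)
    also have "\<dots> \<le> 1 * (real n powr (- mu R) * a n)"
      by (intro mult_mono mult_left_mono C1 d) auto
    finally have "norm (?M * (?C * ?G) - ?M * (?C * integral UNIV ?h)) \<le> real n powr (- mu R) * a n" by simp
    moreover have "H_pos (real n) (\<lambda>\<xi>. of_real (R \<xi>) + \<i> * of_real (Q \<xi>)) ?y = ?C * integral UNIV ?h"
      by (simp add: H_pos_def)
    ultimately show ?thesis
      using \<rho>(3)[of n x] norm_triangle_ineq[of "cpow \<phi> n x - ?M * (?C * ?G)" "?M * (?C * ?G) - ?M * (?C * integral UNIV ?h)"]
      by simp
  qed
  have "\<forall>\<^sub>F n in sequentially. \<rho> ^ n \<le> (\<epsilon> / 2) * real n powr (- mu R)"
    using \<rho> \<epsilon> by (intro geometric_small) auto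
  moreover have "\<forall>\<^sub>F n in sequentially. a n < \<epsilon> / 2"
    using a0 \<epsilon> by (intro order_tendstoD) auto
  moreover have "\<forall>\<^sub>F n in sequentially. n > (0::nat)" by (rule eventually_gt_at_top)
  ultimately show ?thesis
  proof eventually_elim
    case (elim n)
    show ?case
    proof
      fix x
      have "real n powr (- mu R) * a n \<le> real n powr (- mu R) * (\<epsilon> / 2)"
        using elim(2) by (intro mult_left_mono) auto
      then show "norm (cpow \<phi> n x - fhat \<phi> \<xi>0 ^ n * cis (- (lat x \<bullet> \<xi>0)) *
          H_pos (real n) (\<lambda>\<xi>. of_real (R \<xi>) + \<i> * of_real (Q \<xi>)) (lat x - real n *\<^sub>R \<alpha>)) \<le> \<epsilon> * real n powr (- mu R)"
        using key[OF elim(3), of x] elim(1) by (simp add: field_simps)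
    qed
  qed
qed

section \<open>Oscillatory integrals along orbits\<close>

text \<open>One integration by parts. The derivative of i cis (- f) is f' cis (- f), so F = (g / f')
  i cis (- f) has the integrand as its derivative up to the error G. Each boundary term is at most 2
  C a^(\<mu> - 1), and |G| \<le> D r^(\<mu> - 2) contributes at most D a^(\<mu> - 1) / (1 - \<mu>),
  whatever b is. The numerical coefficients come from 1 / |f'| \<le> 2.\<close>

lemma oscillatory_integral_bound:
  fixes f f' f'' g g' :: "real \<Rightarrow> real"
  assumes ab: "0 < a" "a \<le> b" and \<mu>: "\<mu> < 1" and C: "C \<ge> 0"
    and f: "\<And>r. r \<in> {a..b} \<Longrightarrow> (f has_real_derivative f' r) (at r)"
    and f': "\<And>r. r \<in> {a..b} \<Longrightarrow> (f' has_real_derivative f'' r) (at r)"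
    and g: "\<And>r. r \<in> {a..b} \<Longrightarrow> (g has_real_derivative g' r) (at r)"
    and f'_ge: "\<And>r. r \<in> {a..b} \<Longrightarrow> \<bar>f' r\<bar> \<ge> 1 / 2"
    and f''_le: "\<And>r. r \<in> {a..b} \<Longrightarrow> \<bar>f'' r\<bar> \<le> C / r"
    and g_le: "\<And>r. r \<in> {a..b} \<Longrightarrow> \<bar>g r\<bar> \<le> C * r powr (\<mu> - 1)"
    and g'_le: "\<And>r. r \<in> {a..b} \<Longrightarrow> \<bar>g' r\<bar> \<le> C * r powr (\<mu> - 2)"
  shows "norm (integral {a..b} (\<lambda>r. g r *\<^sub>R cis (- f r))) \<le> (4 * C + (2 * C + 4 * C\<^sup>2) / (1 - \<mu>)) * a powr (\<mu> - 1)"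
proof -
  define D where "D = 2 * C + 4 * C\<^sup>2"
  define F where "F = (\<lambda>r. (g r / f' r) *\<^sub>R (\<i> * cis (- f r)))"
  define G where "G = (\<lambda>r. ((g' r * f' r - g r * f'' r) / (f' r)\<^sup>2) *\<^sub>R (\<i> * cis (- f r)))"
  have nz: "f' r \<noteq> 0" if "r \<in> {a..b}" for r using f'_ge[OF that] by auto
  have dF: "(F has_vector_derivative (g r *\<^sub>R cis (- f r) + G r)) (at r)" if r: "r \<in> {a..b}" for r
  proof -
    have 1: "((\<lambda>r. g r / f' r) has_real_derivative (g' r * f' r - g r * f'' r) / (f' r)\<^sup>2) (at r)"
      using DERIV_divide[OF g[OF r] f'[OF r] nz[OF r]] by (simp add: power2_eq_square)
    have "((\<lambda>z. \<i> * exp (\<i> * z)) has_field_derivative \<i> * (\<i> * exp (\<i> * z))) (at z)" for z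
      by (auto intro!: derivative_eq_intros simp: mult.assoc)
    note e = this[of "of_real (- f r)"]
    have "((\<lambda>r. of_real (- f r) :: complex) has_vector_derivative of_real (- f' r)) (at r)"
      using DERIV_minus[OF f[OF r]] by (intro has_vector_derivative_of_real) (simp add: has_real_derivative_iff_has_vector_derivative)
    from field_vector_diff_chain_at[OF this e]
    have "((\<lambda>r. \<i> * exp (\<i> * of_real (- f r))) has_vector_derivative of_real (- f' r) * (\<i> * (\<i> * exp (\<i> * of_real (- f r))))) (at r)"
      by (simp add: o_def)
    then have 2: "((\<lambda>r. \<i> * cis (- f r)) has_vector_derivative f' r *\<^sub>R cis (- f r)) (at r)"
      by (simp add: cis_conv_exp scaleR_conv_of_real)
    have "(F has_vector_derivative ((g r / f' r) *\<^sub>R (f' r *\<^sub>R cis (- f r)) + G r)) (at r)"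
      unfolding F_def G_def using has_vector_derivative_scaleR[OF 1 2] by simp
    then show ?thesis using nz[OF r] by simp
  qed
  have I1: "((\<lambda>r. g r *\<^sub>R cis (- f r) + G r) has_integral (F b - F a)) {a..b}"
    by (rule fundamental_theorem_of_calculus[OF ab(2)]) (rule has_vector_derivative_at_within[OF dF])
  have "continuous_on {a..b} f" "continuous_on {a..b} g"
    by (auto intro!: continuous_at_imp_continuous_on DERIV_isCont f g)
  then have "continuous_on {a..b} (\<lambda>r. g r *\<^sub>R cis (- f r))"
    by (intro continuous_intros)
  then have I2: "(\<lambda>r. g r *\<^sub>R cis (- f r)) integrable_on {a..b}" by (rule integrable_continuous_real)
  have "((\<lambda>r. (g r *\<^sub>R cis (- f r) + G r) - g r *\<^sub>R cis (- f r)) has_integral (F b - F a - integral {a..b} (\<lambda>r. g r *\<^sub>R cis (- f r)))) {a..b}"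
    by (intro has_integral_diff I1 integrable_integral I2)
  then have I3: "(G has_integral (F b - F a - integral {a..b} (\<lambda>r. g r *\<^sub>R cis (- f r)))) {a..b}" by simp
  have pw: "((\<lambda>r. D * r powr (\<mu> - 2)) has_integral (D * b powr (\<mu> - 1) / (\<mu> - 1) - D * a powr (\<mu> - 1) / (\<mu> - 1))) {a..b}"
  proof (rule fundamental_theorem_of_calculus[OF ab(2)])
    fix r assume r: "r \<in> {a..b}"
    have "((\<lambda>r. D * r powr (\<mu> - 1) / (\<mu> - 1)) has_real_derivative D * r powr (\<mu> - 2)) (at r)"
      using r ab \<mu> by (auto intro!: derivative_eq_intros)
    then show "((\<lambda>r. D * r powr (\<mu> - 1) / (\<mu> - 1)) has_vector_derivative D * r powr (\<mu> - 2)) (at r within {a..b})"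
      by (simp add: has_real_derivative_iff_has_vector_derivative has_vector_derivative_at_within)
  qed
  have D: "D \<ge> 0" using C by (simp add: D_def)
  have Gle: "norm (G r) \<le> D * r powr (\<mu> - 2)" if r: "r \<in> {a..b}" for r
  proof -
    have r0: "r > 0" using r ab by auto
    have i1: "1 / \<bar>f' r\<bar> \<le> 2" using f'_ge[OF r] by (simp add: field_simps)
    have e: "r powr (\<mu> - 1) / r = r powr (\<mu> - 2)"
      using r0 powr_diff[of r "\<mu> - 1" 1] by simp
    have "(g' r * f' r - g r * f'' r) / (f' r)\<^sup>2 = g' r * (1 / f' r) - g r * f'' r * (1 / f' r) * (1 / f' r)"
      using nz[OF r] by (simp add: field_simps power2_eq_square)
    then have "norm (G r) = \<bar>g' r * (1 / f' r) - g r * f'' r * (1 / f' r) * (1 / f' r)\<bar>"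
      by (simp add: G_def norm_mult)
    also have "\<dots> \<le> \<bar>g' r\<bar> * (1 / \<bar>f' r\<bar>) + \<bar>g r\<bar> * \<bar>f'' r\<bar> * (1 / \<bar>f' r\<bar>) * (1 / \<bar>f' r\<bar>)"
      by (rule order_trans[OF abs_triangle_ineq4]) (simp add: abs_mult)
    also have "\<dots> \<le> (C * r powr (\<mu> - 2)) * 2 + (C * r powr (\<mu> - 1)) * (C / r) * 2 * 2"
      using C r0 by (intro add_mono mult_mono g'_le[OF r] g_le[OF r] f''_le[OF r] i1) auto
    also have "\<dots> = D * r powr (\<mu> - 2)"
      unfolding e[symmetric] by (simp add: D_def power2_eq_square algebra_simps add_divide_distrib)
    finally show ?thesis .
  qed
  have "norm (integral {a..b} G) \<le> integral {a..b} (\<lambda>r. D * r powr (\<mu> - 2))"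
    using I3 pw Gle by (intro integral_norm_bound_integral) (auto simp: integrable_on_def)
  also have "\<dots> = D / (1 - \<mu>) * (a powr (\<mu> - 1) - b powr (\<mu> - 1))"
  proof -
    have neg: "y / (\<mu> - 1) = - (y / (1 - \<mu>))" for y
      by (metis minus_diff_eq minus_divide_right)
    show ?thesis unfolding integral_unique[OF pw] neg by (simp add: algebra_simps diff_divide_distrib)
  qed
  also have "\<dots> \<le> D / (1 - \<mu>) * a powr (\<mu> - 1)"
    using D \<mu> by (intro mult_left_mono) auto
  finally have G: "norm (integral {a..b} G) \<le> D / (1 - \<mu>) * a powr (\<mu> - 1)" .
  have Fle: "norm (F r) \<le> 2 * C * a powr (\<mu> - 1)" if r: "r \<in> {a..b}" for r
  proof -
    have "norm (F r) = \<bar>g r\<bar> * (1 / \<bar>f' r\<bar>)" by (simp add: F_def norm_mult)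
    also have "\<dots> \<le> (C * r powr (\<mu> - 1)) * 2"
      using f'_ge[OF r] C by (intro mult_mono g_le[OF r]) (auto simp: field_simps)
    also have "\<dots> \<le> (C * a powr (\<mu> - 1)) * 2"
      using r ab \<mu> C by (intro mult_right_mono mult_left_mono powr_mono2') auto
    finally show ?thesis by (simp add: mult_ac)
  qed
  have "integral {a..b} (\<lambda>r. g r *\<^sub>R cis (- f r)) = F b - F a - integral {a..b} G"
    using integral_unique[OF I3] by simp
  also have "norm \<dots> \<le> norm (F b) + norm (F a) + norm (integral {a..b} G)"
    by (rule order_trans[OF norm_triangle_ineq4]) (use norm_triangle_ineq4[of "F b" "F a"] in simp)
  also have "\<dots> \<le> (4 * C + D / (1 - \<mu>)) * a powr (\<mu> - 1)"
    using Fle[of a] Fle[of b] G ab by (simp add: algebra_simps)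
  finally show ?thesis by (simp add: D_def)
qed

section \<open>Growth of orbits and the phase along them\<close>

lemma poly_nolin_quadratic_bound:
  assumes "poly_nolin Q"
  obtains C where "C \<ge> 1" "\<And>x. norm x \<le> 1 \<Longrightarrow> \<bar>Q x\<bar> \<le> C * (norm x)\<^sup>2"
proof -
  obtain B c where B: "finite B" "\<And>\<beta>. \<beta> \<in> B \<Longrightarrow> 2 \<le> sum \<beta> UNIV"
    and Q: "Q = (\<lambda>\<xi>. \<Sum>\<beta>\<in>B. c \<beta> * (\<Prod>i\<in>UNIV. (\<xi>$i) ^ \<beta> i))"
    using assms by (auto simp: poly_nolin_def)
  have "\<bar>Q x\<bar> \<le> (\<Sum>\<beta>\<in>B. \<bar>c \<beta>\<bar>) * (norm x)\<^sup>2" if x: "norm x \<le> 1" for x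
  proof -
    have "\<bar>\<Prod>i\<in>UNIV. (x$i) ^ \<beta> i\<bar> \<le> (norm x)\<^sup>2" if \<beta>: "\<beta> \<in> B" for \<beta>
    proof -
      have "\<bar>\<Prod>i\<in>UNIV. (x$i) ^ \<beta> i\<bar> \<le> (\<Prod>i\<in>UNIV. norm x ^ \<beta> i)"
        unfolding abs_prod power_abs by (intro prod_mono conjI power_mono component_le_norm_cart) auto
      also have "\<dots> = norm x ^ sum \<beta> UNIV" by (simp add: power_sum)
      also have "\<dots> \<le> (norm x)\<^sup>2" using B(2)[OF \<beta>] x by (intro power_decreasing) auto
      finally show ?thesis .
    qed
    then have "\<bar>Q x\<bar> \<le> (\<Sum>\<beta>\<in>B. \<bar>c \<beta>\<bar> * (norm x)\<^sup>2)"
      unfolding Q by (intro order_trans[OF sum_abs] sum_mono) (auto simp: abs_mult intro!: mult_left_mono)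
    then show ?thesis by (simp add: sum_distrib_right)
  qed
  moreover have "(\<Sum>\<beta>\<in>B. \<bar>c \<beta>\<bar>) * y\<^sup>2 \<le> max 1 (\<Sum>\<beta>\<in>B. \<bar>c \<beta>\<bar>) * y\<^sup>2" for y :: real
    by (intro mult_right_mono) auto
  ultimately have "\<bar>Q x\<bar> \<le> max 1 (\<Sum>\<beta>\<in>B. \<bar>c \<beta>\<bar>) * (norm x)\<^sup>2" if "norm x \<le> 1" for x
    using that order_trans by blast
  then show ?thesis
    by (intro that[of "max 1 (\<Sum>\<beta>\<in>B. \<bar>c \<beta>\<bar>)"]) simp_all
qed

context contracting_pos_hom
begin

text \<open>Intermediate value theorem along the ray: P starts at 0 and is at least 1 at radius M +
  1, outside the bounded set {P \<le> 1}. Linear estimates may thus be checked on vectors of level 1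
  and extended by scaling.\<close>

lemma ray_meets_level:
  assumes "v \<noteq> 0" obtains s where "s > 0" "P (s *\<^sub>R v) = 1"
proof -
  obtain M where M: "M > 0" "\<And>x. P x \<le> 1 \<Longrightarrow> norm x \<le> M"
    using bounded_unit_sublevel by (auto simp: bounded_pos)
  have "\<exists>s. 0 \<le> s \<and> s \<le> (M + 1) / norm v \<and> P (s *\<^sub>R v) = 1"
  proof (rule IVT')
    show "P (0 *\<^sub>R v) \<le> 1" using P_eq_0[of 0] by simp
    have "norm (((M + 1) / norm v) *\<^sub>R v) = M + 1" using assms M(1) by simp
    then show "1 \<le> P (((M + 1) / norm v) *\<^sub>R v)" using M(2)[of "((M + 1) / norm v) *\<^sub>R v"] by linarith
    show "continuous_on {0..(M + 1) / norm v} (\<lambda>s. P (s *\<^sub>R v))"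
      by (rule continuous_on_compose2[OF continuous_P]) (auto intro!: continuous_intros)
  qed (use M(1) in simp)
  then obtain s where s: "s \<ge> 0" "P (s *\<^sub>R v) = 1" by blast
  moreover have "s \<noteq> 0" using s(2) P_eq_0[of 0] by auto
  ultimately show ?thesis by (intro that[of s]) auto
qed

end

text \<open>Since \<open>Q\<close> has no linear terms, \<open>|Q x| = O(|x|\<^sup>2)\<close> near the origin; hence \<open>t \<mapsto> t^E\<close> shrinks no
  vector faster than \<open>t^(1/2)\<close>, and \<open>r^E\<close> expands no vector faster than \<open>r^(1/2)\<close>.\<close>

lemma tpow_growth:
  assumes P: "contracting_pos_hom (\<lambda>x. \<bar>Q x\<bar>) E" and Q: "poly_nolin Q"
  obtains C where "C > 0" "\<And>r x. r \<ge> 1 \<Longrightarrow> norm (tpow r E *v x) \<le> C * sqrt r * norm x"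
proof -
  interpret contracting_pos_hom "\<lambda>x. \<bar>Q x\<bar>" E by (fact P)
  obtain C where C: "C \<ge> 1" "\<And>x. norm x \<le> 1 \<Longrightarrow> \<bar>Q x\<bar> \<le> C * (norm x)\<^sup>2"
    by (rule poly_nolin_quadratic_bound[OF Q], rule that)
  obtain M where M: "M > 0" "\<And>x. \<bar>Q x\<bar> \<le> 1 \<Longrightarrow> norm x \<le> M"
    using bounded_unit_sublevel by (auto simp: bounded_pos)
  have low: "norm v \<le> M * sqrt C * sqrt (1 / t) * norm (tpow t E *v v)" if t: "0 < t" "t \<le> 1" for t v
  proof (cases "v = 0")
    case False
    obtain s where s0: "s > 0" and s: "\<bar>Q (s *\<^sub>R v)\<bar> = 1"
      by (rule ray_meets_level[OF False], rule that)
    \<comment> \<open>The point s v lies on the level set and has norm at most M; its image w has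
      level t, so the quadratic bound forces t \<le> C |w|^2. By linearity the factor s cancels in
      the end.\<close>
    define w where "w = tpow t E *v (s *\<^sub>R v)"
    have Qw: "\<bar>Q w\<bar> = t" using P_tpow[OF t(1), of "s *\<^sub>R v"] s by (simp add: w_def)
    have "t \<le> C * (norm w)\<^sup>2"
    proof (cases "norm w \<le> 1")
      case True
      then show ?thesis using C(2) Qw by metis
    next
      case False
      then have "1 \<le> (norm w)\<^sup>2" by simp
      then have "1 * 1 \<le> C * (norm w)\<^sup>2" using C(1) by (intro mult_mono) auto
      then show ?thesis using t by simp
    qed
    then have "sqrt t \<le> sqrt C * norm w"
      using real_sqrt_le_mono[of t "C * (norm w)\<^sup>2"] by (simp add: real_sqrt_mult)
    also have "norm w = s * norm (tpow t E *v v)"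
      using s0 by (simp add: w_def matrix_vector_mult_scaleR)
    finally have 1: "1 \<le> sqrt C * sqrt (1 / t) * (s * norm (tpow t E *v v))"
      using t by (simp add: real_sqrt_divide field_simps)
    have "s * norm v \<le> M" using M(2)[of "s *\<^sub>R v"] s s0 by simp
    also have "\<dots> \<le> M * (sqrt C * sqrt (1 / t) * (s * norm (tpow t E *v v)))"
      using mult_left_mono[OF 1, of M] M(1) by simp
    finally show ?thesis using s0 by (simp add: mult_ac)
  qed simp
  show ?thesis
  proof (rule that[of "M * sqrt C"])
    show "M * sqrt C > 0" using M C by simp
    fix r :: real and x assume r: "r \<ge> 1"
    \<comment> \<open>The lower bound at time 1 / r is applied to r^E x, whose image is x.\<close>
    then show "norm (tpow r E *v x) \<le> M * sqrt C * sqrt r * norm x"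
      using low[of "1 / r" "tpow r E *v x"] by (simp add: tpow_inverse)
  qed
qed

text \<open>p perturbs the phase and q is a damping exponent. The 1 / 4 leaves half of the phase
  derivative |Q \<omega>| \<ge> 1 once another 1 / 4 is spent on the linear term. The derivative of
  q is weighed by exp (- q) because q behaves like n (r / n)^k and q' like k q / r, which is not O(1
  / r) uniformly in n.\<close>

definition mild_perturbation :: "real \<Rightarrow> real \<Rightarrow> real \<Rightarrow> (real \<Rightarrow> real) \<Rightarrow> (real \<Rightarrow> real) \<Rightarrow> bool" where
  "mild_perturbation c a b p q \<longleftrightarrow> (\<exists>p' p'' q'. \<forall>r\<in>{a..b}.
     (p has_real_derivative p' r) (at r) \<and> (p' has_real_derivative p'' r) (at r) \<and> \<bar>p' r\<bar> \<le> 1 / 4 \<and> \<bar>p'' r\<bar> \<le> 1 / r \<and>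
     (q has_real_derivative q' r) (at r) \<and> 0 \<le> q r \<and> \<bar>q' r\<bar> * exp (- q r) \<le> c / r)"

locale contracting_im_hom = contracting_pos_hom "\<lambda>x. \<bar>Q x\<bar>" E
  for Q :: "real^'d::finite \<Rightarrow> real" and E :: "real^'d^'d" +
  assumes poly: "poly_nolin Q" and mu_lt_1: "mu (\<lambda>x. \<bar>Q x\<bar>) < 1"
begin

lemma trace_lt_1: "trace E < 1"
  using mu_lt_1 by (simp add: mu_eq)

lemma continuous_Q: "continuous_on S Q"
  by (rule continuous_poly_nolin[OF poly])

lemma Q_measurable [measurable]: "Q \<in> borel_measurable borel"
  by (rule borel_measurable_poly_nolin[OF poly])

text \<open>\<open>Q\<close> cannot change sign along an orbit, so the homogeneity of \<open>|Q|\<close> carries over to \<open>Q\<close>.\<close>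

lemma Q_tpow:
  assumes t: "t > 0" shows "Q (tpow t E *v x) = t * Q x"
proof (cases "x = 0")
  case True
  then show ?thesis using P_eq_0[of 0] by simp
next
  case False
  let ?S = "(\<lambda>t. Q (tpow t E *v x)) ` {0<..}"
  have "continuous_on {0<..} (\<lambda>t. (\<lambda>(t, x). tpow t E *v x) (t, x))"
    by (rule continuous_on_compose2[OF continuous_on_tpow]) (auto intro!: continuous_intros)
  then have "continuous_on {0<..} (\<lambda>t. Q (tpow t E *v x))"
    by (intro continuous_on_compose2[OF continuous_Q[of UNIV]]) auto
  then have conn: "connected ?S" by (intro connected_continuous_image) auto
  have "0 \<notin> ?S"
  proof
    assume "0 \<in> ?S"
    then obtain s where "s > 0" "Q (tpow s E *v x) = 0" by auto
    then show False using P_tpow[of s x] P_pos[OF False] by simp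
  qed
  moreover have "Q x \<in> ?S" by (rule image_eqI[of _ _ 1]) (auto simp: tpow_1)
  moreover have "Q (tpow t E *v x) \<in> ?S" using t by auto
  ultimately have "\<not> (Q x < 0 \<and> 0 < Q (tpow t E *v x))" "\<not> (0 < Q x \<and> Q (tpow t E *v x) < 0)"
    using connectedD_interval[OF conn, of "Q x" "Q (tpow t E *v x)" 0]
      connectedD_interval[OF conn, of "Q (tpow t E *v x)" "Q x" 0] by (auto simp: less_imp_le)
  moreover have "\<bar>Q (tpow t E *v x)\<bar> = t * \<bar>Q x\<bar>" using P_tpow[OF t, of x] .
  moreover have "Q x \<noteq> 0" using P_pos[OF False] by simp
  ultimately show ?thesis
    by (cases "Q x > 0"; cases "Q (tpow t E *v x) > 0") (auto simp: not_less abs_if split: if_splits)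
qed

text \<open>The phase derivative is Q \<omega> + e1 / r + p', where e1 / r = O(r^(-1/2)) comes from
  the linear term, since r d/dr r^E = E r^E. All bounds see \<omega> only through 1 \<le> |Q
  \<omega>| \<le> e and \<kappa> only through B, so the constants are uniform in both, and in
  b.\<close>

lemma radial_oscillation:
  assumes B: "B \<ge> 0" and Cq: "Cq \<ge> 0"
  obtains a0 C where "a0 \<ge> 1" "C \<ge> 0"
    "\<And>\<omega> \<kappa> p q a b. \<lbrakk>1 \<le> \<bar>Q \<omega>\<bar>; \<bar>Q \<omega>\<bar> \<le> exp 1; norm \<kappa> \<le> B; a0 \<le> a; a \<le> b; mild_perturbation Cq a b p q\<rbrakk>
      \<Longrightarrow> norm (integral {a..b} (\<lambda>r. (r powr (trace E - 1) * exp (- q r)) *\<^sub>R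
            cis (- (r * Q \<omega> + \<kappa> \<bullet> (tpow r E *v \<omega>) + p r)))) \<le> C * a powr (trace E - 1)"
proof -
  obtain Cg where Cg: "Cg > 0" "\<And>r x. r \<ge> 1 \<Longrightarrow> norm (tpow r E *v x) \<le> Cg * sqrt r * norm x"
    by (rule tpow_growth[OF contracting_pos_hom_axioms poly], rule that)
  obtain M where M: "M > 0" "\<And>x. \<bar>Q x\<bar> \<le> exp 1 \<Longrightarrow> norm x \<le> M"
    using compact_imp_bounded[OF compact_sublevel[of "exp 1"]] by (auto simp: bounded_pos)
  define K where "K = onorm ((*v) E)"
  have K: "K \<ge> 0" "\<And>x. norm (E *v x) \<le> K * norm x"
    by (auto simp: K_def onorm_pos_le onorm)
  \<comment> \<open>K is the operator norm of E and controls e1, its square controls e2. With both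
    summed, one L serves |e1| and |e2 - e1|, each up to a factor sqrt r.\<close>
  define L where "L = B * (K + K\<^sup>2) * Cg * M"
  have L: "L \<ge> 0" using B K Cg M by (simp add: L_def)
  let ?\<mu> = "trace E"
  \<comment> \<open>The sum of what the hypotheses of the oscillatory bound demand: L + 1 for f'', 1
    for g, and |\<mu> - 1| + Cq for g'.\<close>
  define C where "C = L + 1 + \<bar>?\<mu> - 1\<bar> + Cq"
  have C: "C \<ge> 0" using L Cq by (simp add: C_def)
  show ?thesis
  \<comment> \<open>From r \<ge> 16 L^2 on, L / sqrt r \<le> 1 / 4, the share of |Q \<omega>|
    reserved for the linear term.\<close>
  proof (rule that[of "max 1 (16 * L\<^sup>2)" "4 * C + (2 * C + 4 * C\<^sup>2) / (1 - ?\<mu>)"])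
    show "0 \<le> 4 * C + (2 * C + 4 * C\<^sup>2) / (1 - ?\<mu>)" using C trace_lt_1 by simp
    fix \<omega> \<kappa> :: "real^'d" and p q :: "real \<Rightarrow> real" and a b :: real
    assume \<omega>: "1 \<le> \<bar>Q \<omega>\<bar>" "\<bar>Q \<omega>\<bar> \<le> exp 1" and \<kappa>: "norm \<kappa> \<le> B" and a: "max 1 (16 * L\<^sup>2) \<le> a" and ab: "a \<le> b"
      and "mild_perturbation Cq a b p q"
    then obtain p' p'' q' where pq: "\<forall>r\<in>{a..b}.
     (p has_real_derivative p' r) (at r) \<and> (p' has_real_derivative p'' r) (at r) \<and> \<bar>p' r\<bar> \<le> 1 / 4 \<and> \<bar>p'' r\<bar> \<le> 1 / r \<and>
     (q has_real_derivative q' r) (at r) \<and> 0 \<le> q r \<and> \<bar>q' r\<bar> * exp (- q r) \<le> Cq / r"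
      unfolding mild_perturbation_def by (elim exE)
    have p: "(p has_real_derivative p' r) (at r)" and p': "(p' has_real_derivative p'' r) (at r)"
      and p'_le: "\<bar>p' r\<bar> \<le> 1 / 4" and p''_le: "\<bar>p'' r\<bar> \<le> 1 / r"
      and q: "(q has_real_derivative q' r) (at r)" and q0: "q r \<ge> 0" and q'_le: "\<bar>q' r\<bar> * exp (- q r) \<le> Cq / r"
      if "r \<in> {a..b}" for r
      using bspec[OF pq that] by blast+
    define y where "y = (\<lambda>r. tpow r E *v \<omega>)"
    define e1 where "e1 = (\<lambda>r. \<kappa> \<bullet> (E *v y r))"
    define e2 where "e2 = (\<lambda>r. \<kappa> \<bullet> (E *v (E *v y r)))"
    have r0: "r > 0" "r \<ge> 1" "r \<ge> 16 * L\<^sup>2" if "r \<in> {a..b}" for r using that a by auto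
    have dy: "(y has_vector_derivative (1 / r) *\<^sub>R (E *v y r)) (at r)" if "r > 0" for r
      unfolding y_def by (rule tpow_deriv[OF that])
    have dk: "((\<lambda>r. \<kappa> \<bullet> y r) has_real_derivative e1 r / r) (at r)" if "r > 0" for r
      using bounded_linear.has_vector_derivative[OF bounded_linear_inner_right dy[OF that], of \<kappa>]
      by (simp add: has_real_derivative_iff_has_vector_derivative e1_def)
    have de1: "(e1 has_real_derivative e2 r / r) (at r)" if "r > 0" for r
    proof -
      have "bounded_linear (\<lambda>x. \<kappa> \<bullet> (E *v x))"
        by (rule bounded_linear_compose[OF bounded_linear_inner_right matrix_vector_mul_bounded_linear])
      from bounded_linear.has_vector_derivative[OF this dy[OF that]] show ?thesis
        by (simp add: has_real_derivative_iff_has_vector_derivative e1_def e2_def matrix_vector_mult_scaleR)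
    qed
    have ny: "norm (y r) \<le> Cg * M * sqrt r" if "r \<ge> 1" for r
    proof -
      have "norm (y r) \<le> Cg * sqrt r * norm \<omega>" unfolding y_def by (rule Cg(2)[OF that])
      also have "\<dots> \<le> Cg * sqrt r * M" using M(2)[OF \<omega>(2)] Cg(1) that by (intro mult_left_mono) auto
      finally show ?thesis by (simp add: mult_ac)
    qed
    have ek: "\<bar>\<kappa> \<bullet> x\<bar> \<le> B * c" if "norm x \<le> c" for x c
      using order_trans[OF Cauchy_Schwarz_ineq2 mult_mono[OF \<kappa> that B norm_ge_zero]] .
    have n1: "norm (E *v y r) \<le> K * (Cg * M * sqrt r)" if "r \<ge> 1" for r
      by (rule order_trans[OF K(2) mult_left_mono[OF ny[OF that] K(1)]])
    have n2: "norm (E *v (E *v y r)) \<le> K * (K * (Cg * M * sqrt r))" if "r \<ge> 1" for r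
      by (rule order_trans[OF K(2) mult_left_mono[OF n1[OF that] K(1)]])
    have e1_le: "\<bar>e1 r\<bar> \<le> L * sqrt r" and e12_le: "\<bar>e2 r - e1 r\<bar> \<le> L * sqrt r" if r: "r \<ge> 1" for r
    proof -
      have "\<bar>e1 r\<bar> \<le> B * (K * (Cg * M * sqrt r))" unfolding e1_def by (rule ek[OF n1[OF r]])
      moreover have "\<bar>e2 r\<bar> \<le> B * (K * (K * (Cg * M * sqrt r)))" unfolding e2_def by (rule ek[OF n2[OF r]])
      moreover have "B * (K * (Cg * M * sqrt r)) + B * (K * (K * (Cg * M * sqrt r))) = L * sqrt r"
        by (simp add: L_def algebra_simps power2_eq_square)
      moreover have "0 \<le> B * (K * (K * (Cg * M * sqrt r)))" using B K Cg M r by simp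
      ultimately show "\<bar>e1 r\<bar> \<le> L * sqrt r" "\<bar>e2 r - e1 r\<bar> \<le> L * sqrt r" by linarith+
    qed
    define f where "f = (\<lambda>r. r * Q \<omega> + \<kappa> \<bullet> y r + p r)"
    define f' where "f' = (\<lambda>r. Q \<omega> + e1 r / r + p' r)"
    define f'' where "f'' = (\<lambda>r. (e2 r - e1 r) / r\<^sup>2 + p'' r)"
    define g where "g = (\<lambda>r. r powr (?\<mu> - 1) * exp (- q r))"
    define g' where "g' = (\<lambda>r. (?\<mu> - 1) * r powr (?\<mu> - 2) * exp (- q r) + r powr (?\<mu> - 1) * (- q' r * exp (- q r)))"
    have sq: "sqrt r / r = 1 / sqrt r" if "r > 0" for r
      using that by (simp add: field_simps)
    have "norm (integral {a..b} (\<lambda>r. g r *\<^sub>R cis (- f r))) \<le> (4 * C + (2 * C + 4 * C\<^sup>2) / (1 - ?\<mu>)) * a powr (?\<mu> - 1)"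
    proof (rule oscillatory_integral_bound[where f' = f' and f'' = f'' and g' = g'])
      show "0 < a" using a by linarith
      fix r assume r: "r \<in> {a..b}"
      note rr = r0[OF r]
      show "(f has_real_derivative f' r) (at r)"
        unfolding f_def f'_def by (auto intro!: derivative_eq_intros dk[OF rr(1)] p[OF r])
      have dq: "((\<lambda>r. e1 r / r) has_real_derivative (e2 r - e1 r) / r\<^sup>2) (at r)"
        using DERIV_divide[OF de1[OF rr(1)] DERIV_ident] rr(1) by (simp add: power2_eq_square)
      show "(f' has_real_derivative f'' r) (at r)"
        unfolding f'_def f''_def using DERIV_add[OF DERIV_add[OF DERIV_const dq] p'[OF r]] by simp
      show "(g has_real_derivative g' r) (at r)"
      proof -
        have 1: "((\<lambda>r. r powr (?\<mu> - 1)) has_real_derivative (?\<mu> - 1) * r powr (?\<mu> - 2)) (at r)"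
          using rr(1) by (auto intro!: derivative_eq_intros)
        have 2: "((\<lambda>r. exp (- q r)) has_real_derivative - q' r * exp (- q r)) (at r)"
          using q[OF r] by (auto intro!: derivative_eq_intros)
        show ?thesis unfolding g_def g'_def using DERIV_mult[OF 1 2] by (simp add: algebra_simps)
      qed
      have "4 * L \<le> sqrt r"
        using rr(3) by (intro real_le_rsqrt) (simp add: power_mult_distrib)
      then have "4 * L * sqrt r \<le> sqrt r * sqrt r" using rr(1) by (intro mult_right_mono) auto
      then have "L * sqrt r / r \<le> 1 / 4" using rr(1) by (simp add: field_simps)
      moreover have "\<bar>e1 r / r\<bar> \<le> L * sqrt r / r"
        using e1_le[OF rr(2)] rr(1) by (simp add: divide_right_mono)
      ultimately show "1 / 2 \<le> \<bar>f' r\<bar>"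
        using \<omega>(1) p'_le[OF r] unfolding f'_def by linarith
      show "\<bar>f'' r\<bar> \<le> C / r"
      proof -
        have "\<bar>(e2 r - e1 r) / r\<^sup>2\<bar> \<le> L * sqrt r / r\<^sup>2"
          using e12_le[OF rr(2)] by (simp add: divide_right_mono)
        also have "\<dots> = L / sqrt r / r"
          using rr(1) sq[OF rr(1)] by (simp add: power2_eq_square field_simps)
        also have "\<dots> \<le> L / r"
          using rr L by (intro divide_right_mono) (auto simp: field_simps mult_le_cancel_left1)
        finally have "\<bar>f'' r\<bar> \<le> L / r + 1 / r" using p''_le[OF r] unfolding f''_def by linarith
        also have "\<dots> \<le> C / r" unfolding add_divide_distrib[symmetric]
          using rr(1) Cq by (intro divide_right_mono) (auto simp: C_def)
        finally show ?thesis .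
      qed
      have e1: "exp (- q r) \<le> 1" using q0[OF r] by simp
      show "\<bar>g r\<bar> \<le> C * r powr (?\<mu> - 1)"
      proof -
        have "exp (- q r) \<le> C" using e1 L Cq unfolding C_def by linarith
        then show ?thesis by (simp add: g_def abs_mult mult_ac mult_right_mono)
      qed
      show "\<bar>g' r\<bar> \<le> C * r powr (?\<mu> - 2)"
      proof -
        have e: "r powr (?\<mu> - 1) / r = r powr (?\<mu> - 2)"
          using rr(1) powr_diff[of r "?\<mu> - 1" 1] by simp
        have "\<bar>g' r\<bar> \<le> \<bar>?\<mu> - 1\<bar> * r powr (?\<mu> - 2) * exp (- q r) + r powr (?\<mu> - 1) * (\<bar>q' r\<bar> * exp (- q r))"
          unfolding g'_def by (rule order_trans[OF abs_triangle_ineq]) (simp add: abs_mult)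
        also have "\<dots> \<le> \<bar>?\<mu> - 1\<bar> * r powr (?\<mu> - 2) * 1 + r powr (?\<mu> - 1) * (Cq / r)"
          using e1 by (intro add_mono mult_left_mono q'_le[OF r]) auto
        also have "\<dots> = (\<bar>?\<mu> - 1\<bar> + Cq) * r powr (?\<mu> - 2)"
          unfolding e[symmetric] by (simp add: algebra_simps add_divide_distrib)
        also have "\<dots> \<le> C * r powr (?\<mu> - 2)"
          using L by (intro mult_right_mono) (auto simp: C_def)
        finally show ?thesis .
      qed
    qed (use ab trace_lt_1 C in auto)
    then show "norm (integral {a..b} (\<lambda>r. (r powr (?\<mu> - 1) * exp (- q r)) *\<^sub>R
            cis (- (r * Q \<omega> + \<kappa> \<bullet> (tpow r E *v \<omega>) + p r)))) \<le> (4 * C + (2 * C + 4 * C\<^sup>2) / (1 - ?\<mu>)) * a powr (?\<mu> - 1)"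
      by (simp add: f_def g_def y_def)
  qed auto
qed

end

section \<open>Integration along orbits\<close>

lemma integrable_bounded_support:
  fixes f :: "'a::euclidean_space \<Rightarrow> complex"
  assumes "f \<in> borel_measurable borel" "bounded S" "S \<in> sets borel"
    and "\<And>x. x \<notin> S \<Longrightarrow> f x = 0" "\<And>x. norm (f x) \<le> B"
  shows "integrable lborel f"
  using assms emeasure_bounded_finite[OF assms(2)]
  by (intro integrableI_bounded_set[where A = S and B = B]) auto

context contracting_pos_hom
begin

definition annulus :: "(real^'d) set" where "annulus = {\<omega>. 1 \<le> P \<omega> \<and> P \<omega> \<le> exp 1}"

lemma annulus_sets [measurable]: "annulus \<in> sets borel"
  unfolding annulus_def by measurable

lemma compact_annulus: "compact annulus"
proof -
  have "annulus = {x. P x \<le> exp 1} \<inter> {x. 1 \<le> P x}" by (auto simp: annulus_def)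
  moreover have "closed {x. 1 \<le> P x}" using continuous_P by (intro closed_Collect_le) auto
  ultimately show ?thesis by (simp add: compact_Int_closed compact_sublevel)
qed

lemma orbit_measurable [measurable]:
  "(\<lambda>p. indicator ({0<..} \<times> UNIV) p *\<^sub>R (tpow (fst p) E *v snd p)) \<in> borel_measurable (borel \<Otimes>\<^sub>M borel)"
  unfolding borel_prod using borel_measurable_continuous_on_indicator[OF _ continuous_on_tpow, of E]
  by (simp add: case_prod_beta open_Times borel_open)

text \<open>A substitute for polar coordinates: integrating over the solid annulus \<open>{1 \<le> P \<le> e}\<close> instead of the
  surface \<open>{P = 1}\<close>. It holds because the orbit of every nonzero point spends logarithmic time exactly
  \<open>1\<close> in the annulus.\<close>

lemma annulus_polar:
  fixes g :: "real^'d \<Rightarrow> complex"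
  assumes g [measurable]: "g \<in> borel_measurable borel" and B: "\<And>x. norm (g x) \<le> B"
    and supp: "\<And>x. g x \<noteq> 0 \<Longrightarrow> a \<le> P x \<and> P x \<le> b" and a: "0 < a"
  shows "(\<integral>x. g x \<partial>lborel) = (\<integral>\<omega>. indicator annulus \<omega> *\<^sub>R
     (\<integral>r. (indicator {0<..} r * r powr (trace E - 1)) *\<^sub>R g (tpow r E *v \<omega>) \<partial>lborel) \<partial>lborel)"
proof -
  let ?\<mu> = "trace E"
  have B0: "B \<ge> 0" using B[of 0] norm_ge_zero order_trans by blast
  \<comment> \<open>F1 spreads g over time: for fixed x with P x > 0 the weight 1 / r on P x / e
    \<le> r \<le> P x has integral 1. F2 is F1 under x = r^E \<omega>, whose Jacobian r^\<mu> times
    1 / r gives r^(\<mu> - 1). Fubini on each side links the two descriptions.\<close>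
  define F1 where "F1 = (\<lambda>r x. (indicator {p. 0 < fst p \<and> fst p \<le> P (snd p) \<and> P (snd p) \<le> exp 1 * fst p} (r, x) / r) *\<^sub>R g x)"
  define F2 where "F2 = (\<lambda>r \<omega>. (indicator {0<..} r * r powr (?\<mu> - 1) * indicator annulus \<omega>) *\<^sub>R g (tpow r E *v \<omega>))"
  let ?X = "{a / exp 1..b} \<times> {x. P x \<le> b}" and ?Y = "{a / exp 1..b} \<times> annulus"
  have "compact ?X" "compact ?Y"
    by (intro compact_Times compact_Icc compact_sublevel compact_annulus)+
  then have X: "bounded ?X" "bounded ?Y" "?X \<in> sets borel" "?Y \<in> sets borel"
    by (auto intro: compact_imp_bounded borel_compact)
  have m1: "(\<lambda>p. F1 (fst p) (snd p)) \<in> borel_measurable (borel \<Otimes>\<^sub>M borel)"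
    unfolding F1_def by measurable
  have i1: "integrable (lborel \<Otimes>\<^sub>M lborel) (case_prod F1)"
    unfolding lborel_prod
  proof (rule integrable_bounded_support[where S = ?X and B = "exp 1 / a * B"])
    show "case_prod F1 \<in> borel_measurable borel" using m1 by (simp add: borel_prod case_prod_unfold)
    fix p :: "real \<times> (real^'d)"
    obtain r x where p: "p = (r, x)" by fastforce
    have *: "a \<le> exp 1 * r" "r \<le> b" "P x \<le> b" "0 < r" if "F1 r x \<noteq> 0"
      using that supp[of x] by (auto simp: F1_def indicator_def split: if_splits)
    show "case_prod F1 p = 0" if "p \<notin> ?X"
      using that * by (auto simp: p field_simps)
    show "norm (case_prod F1 p) \<le> exp 1 / a * B"
    proof (cases "F1 r x = 0")
      case False
      from *[OF this] have "1 / r \<le> exp 1 / a" using a by (simp add: field_simps)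
      moreover have "norm (F1 r x) \<le> 1 / r * norm (g x)"
        using *(4)[OF False] by (auto simp: F1_def indicator_def)
      ultimately have "norm (F1 r x) \<le> exp 1 / a * B"
        using B[of x] a by (elim order_trans) (intro mult_mono, auto)
      then show ?thesis by (simp add: p)
    qed (use B0 a in \<open>simp add: p\<close>)
  qed (use X in auto)
  \<comment> \<open>The dilation is jointly continuous only for r > 0. Cutting it off elsewhere
    makes it Borel on the whole product, and F2 vanishes there anyway.\<close>
  have F2_alt: "F2 r \<omega> = (indicator {0<..} r * r powr (?\<mu> - 1) * indicator annulus \<omega>) *\<^sub>R
      g (indicator ({0<..} \<times> UNIV) (r, \<omega>) *\<^sub>R (tpow (fst (r, \<omega>)) E *v snd (r, \<omega>)))" for r \<omega>
    by (auto simp: F2_def indicator_def)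
  have m2: "(\<lambda>p. F2 (fst p) (snd p)) \<in> borel_measurable (borel \<Otimes>\<^sub>M borel)"
    unfolding F2_alt prod.collapse by measurable
  have i2: "integrable (lborel \<Otimes>\<^sub>M lborel) (case_prod F2)"
    unfolding lborel_prod
  \<comment> \<open>The power r^(\<mu> - 1) is monotone, with a direction given by the sign of \<mu>
    - 1; the sum of its values at the two ends covers both signs.\<close>
  proof (rule integrable_bounded_support[where S = ?Y and B = "((a / exp 1) powr (?\<mu> - 1) + b powr (?\<mu> - 1)) * B"])
    show "case_prod F2 \<in> borel_measurable borel" using m2 by (simp add: borel_prod case_prod_unfold)
    fix p :: "real \<times> (real^'d)"
    obtain r x where p: "p = (r, x)" by fastforce
    have *: "a / exp 1 \<le> r" "r \<le> b" "x \<in> annulus" "0 < r" if "F2 r x \<noteq> 0"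
    proof -
      show 1: "0 < r" "x \<in> annulus" using that by (auto simp: F2_def indicator_def split: if_splits)
      have "g (tpow r E *v x) \<noteq> 0" using that by (auto simp: F2_def)
      from supp[OF this] have 2: "a \<le> r * P x" "r * P x \<le> b" using 1 by (auto simp: P_tpow)
      have "r * 1 \<le> r * P x" "r * P x \<le> r * exp 1"
        using 1 by (auto simp: annulus_def intro!: mult_left_mono)
      with 2 show "a / exp 1 \<le> r" "r \<le> b" by (simp_all add: field_simps)
    qed
    show "case_prod F2 p = 0" if "p \<notin> ?Y"
      using that * by (auto simp: p)
    show "norm (case_prod F2 p) \<le> ((a / exp 1) powr (?\<mu> - 1) + b powr (?\<mu> - 1)) * B"
    proof (cases "F2 r x = 0")
      case False
      note f = *[OF False]
      have "r powr (?\<mu> - 1) \<le> (a / exp 1) powr (?\<mu> - 1) + b powr (?\<mu> - 1)"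
      proof (cases "?\<mu> \<ge> 1")
        case True
        then have "r powr (?\<mu> - 1) \<le> b powr (?\<mu> - 1)" using f by (intro powr_mono2) auto
        then show ?thesis by (simp add: add_increasing)
      next
        case False
        then have "r powr (?\<mu> - 1) \<le> (a / exp 1) powr (?\<mu> - 1)" using f a by (intro powr_mono2') auto
        then show ?thesis by (simp add: add_increasing2)
      qed
      moreover have "norm (F2 r x) = r powr (?\<mu> - 1) * norm (g (tpow r E *v x))"
        using f by (simp add: F2_def)
      ultimately show ?thesis using B[of "tpow r E *v x"] by (auto simp: p intro!: mult_mono add_nonneg_nonneg)
    qed (use B0 in \<open>simp add: p\<close>)
  qed (use X in auto)
  have inner: "(\<integral>r. F1 r x \<partial>lborel) = g x" for x
  proof (cases "g x = 0")
    case False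
    then have P: "P x > 0" using supp[of x] a by auto
    have "(\<integral>r. indicator {P x / exp 1..P x} r *\<^sub>R (1 / r) \<partial>lborel) = ln (P x) - ln (P x / exp 1)"
    proof (rule integral_FTC_Icc)
      show "P x / exp 1 \<le> P x" using P by (simp add: field_simps)
      fix r assume r: "P x / exp 1 \<le> r" "r \<le> P x"
      then have "r > 0" using P by (smt (verit) divide_pos_pos exp_gt_zero)
      then show "(ln has_vector_derivative 1 / r) (at r within {P x / exp 1..P x})"
        using DERIV_ln_divide[of r] by (simp add: has_real_derivative_iff_has_vector_derivative has_vector_derivative_at_within)
    next
      show "continuous_on {P x / exp 1..P x} (\<lambda>r. 1 / r)"
        using P by (intro continuous_intros) (auto simp: field_simps)
    qed
    also have "\<dots> = 1" using P by (simp add: ln_div)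
    also have "(\<lambda>r. indicator {P x / exp 1..P x} r *\<^sub>R (1 / r))
        = (\<lambda>r. indicator {p. 0 < fst p \<and> fst p \<le> P (snd p) \<and> P (snd p) \<le> exp 1 * fst p} (r, x) / r)"
    proof
      fix r
      have "r > 0" if "P x / exp 1 \<le> r" using that P by (smt (verit) divide_pos_pos exp_gt_zero)
      then show "indicator {P x / exp 1..P x} r *\<^sub>R (1 / r)
        = indicator {p. 0 < fst p \<and> fst p \<le> P (snd p) \<and> P (snd p) \<le> exp 1 * fst p} (r, x) / r"
        by (auto simp: indicator_def field_simps)
    qed
    finally have 1: "(\<integral>r. indicator {p. 0 < fst p \<and> fst p \<le> P (snd p) \<and> P (snd p) \<le> exp 1 * fst p} (r, x) / r \<partial>lborel) = 1"
      (is "(\<integral>r. ?w r \<partial>lborel) = 1") .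
    then have "integrable lborel ?w"
      using not_integrable_integral_eq[of lborel ?w] by auto
    then show ?thesis unfolding F1_def using 1 by (subst integral_scaleR_left) simp_all
  qed (simp add: F1_def)
  have outer: "(\<integral>x. F1 r x \<partial>lborel) = (\<integral>\<omega>. F2 r \<omega> \<partial>lborel)" for r
  proof (cases "r > 0")
    case True
    have m: "F1 r \<in> borel_measurable borel" unfolding F1_def by measurable
    have "F1 r (tpow r E *v \<omega>) = (1 / r) *\<^sub>R (indicator annulus \<omega> *\<^sub>R g (tpow r E *v \<omega>))" for \<omega>
      using True by (auto simp: F1_def indicator_def annulus_def P_tpow)
    then have "(\<integral>x. F1 r x \<partial>lborel) = r powr ?\<mu> *\<^sub>R (\<integral>\<omega>. (1 / r) *\<^sub>R (indicator annulus \<omega> *\<^sub>R g (tpow r E *v \<omega>)) \<partial>lborel)"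
      using integral_tpow(1)[OF True m, of E] by (simp only:)
    also have "\<dots> = r powr ?\<mu> *\<^sub>R (1 / r) *\<^sub>R (\<integral>\<omega>. indicator annulus \<omega> *\<^sub>R g (tpow r E *v \<omega>) \<partial>lborel)"
      by (simp only: integral_scaleR_right)
    also have "r powr ?\<mu> *\<^sub>R (1 / r) *\<^sub>R z = r powr (?\<mu> - 1) *\<^sub>R z" for z :: complex
      using True powr_diff[of r ?\<mu> 1] by simp
    finally show ?thesis using True by (simp add: F2_def flip: scaleR_scaleR)
  qed (simp add: F1_def F2_def)
  have "(\<integral>x. g x \<partial>lborel) = (\<integral>x. (\<integral>r. F1 r x \<partial>lborel) \<partial>lborel)" by (simp add: inner)
  also have "\<dots> = (\<integral>r. (\<integral>x. F1 r x \<partial>lborel) \<partial>lborel)"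
    by (rule lborel_pair.Fubini_integral[OF i1])
  also have "\<dots> = (\<integral>r. (\<integral>\<omega>. F2 r \<omega> \<partial>lborel) \<partial>lborel)" by (simp add: outer)
  also have "\<dots> = (\<integral>\<omega>. (\<integral>r. F2 r \<omega> \<partial>lborel) \<partial>lborel)"
    by (rule lborel_pair.Fubini_integral[OF i2, symmetric])
  also have "(\<lambda>\<omega>. (\<integral>r. F2 r \<omega> \<partial>lborel)) = (\<lambda>\<omega>. indicator annulus \<omega> *\<^sub>R
     (\<integral>r. (indicator {0<..} r * r powr (?\<mu> - 1)) *\<^sub>R g (tpow r E *v \<omega>) \<partial>lborel))"
    by (auto simp: F2_def fun_eq_iff indicator_def)
  finally show ?thesis .
qed

text \<open>On the orbit of \<omega> the condition a \<le> P < b reads a / P \<omega> \<le> r < b /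
  P \<omega>. So \<open>annulus_polar\<close> converts a bound on the one-dimensional integrals,
  uniform in \<omega>, into one over the shell, at the price of the finite volume of the
  annulus.\<close>

lemma annulus_tail_bound:
  fixes G :: "real^'d \<Rightarrow> complex"
  assumes G [measurable]: "(\<lambda>x. indicator {x. a \<le> P x \<and> P x < b} x *\<^sub>R G x) \<in> borel_measurable borel"
    and B: "\<And>x. a \<le> P x \<Longrightarrow> P x < b \<Longrightarrow> norm (G x) \<le> B" "B \<ge> 0" and ab: "0 < a" and D: "D \<ge> 0"
    and inner: "\<And>\<omega>. \<omega> \<in> annulus \<Longrightarrow>
      norm (integral {a / P \<omega>..b / P \<omega>} (\<lambda>r. r powr (trace E - 1) *\<^sub>R G (tpow r E *v \<omega>))) \<le> D"
  shows "norm (LINT x:{x. a \<le> P x \<and> P x < b}|lborel. G x) \<le> D * measure lborel annulus"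
proof -
  let ?\<mu> = "trace E"
  let ?S = "{x. a \<le> P x \<and> P x < b}"
  let ?g = "\<lambda>x. indicator ?S x *\<^sub>R G x"
  let ?I = "\<lambda>\<omega>. \<integral>r. (indicator {0<..} r * r powr (?\<mu> - 1)) *\<^sub>R ?g (tpow r E *v \<omega>) \<partial>lborel"
  have eq: "(LINT x:?S|lborel. G x) = (\<integral>\<omega>. indicator annulus \<omega> *\<^sub>R ?I \<omega> \<partial>lborel)"
    unfolding set_lebesgue_integral_def
    by (rule annulus_polar[where B = B and a = a and b = b]) (use G B ab in \<open>auto simp: indicator_def\<close>)
  have I: "norm (?I \<omega>) \<le> D" if \<omega>: "\<omega> \<in> annulus" for \<omega>
  proof -
    have P: "P \<omega> > 0" using \<omega> by (auto simp: annulus_def)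
    let ?J = "{a / P \<omega>..<b / P \<omega>}" and ?h = "\<lambda>r. r powr (?\<mu> - 1) *\<^sub>R G (tpow r E *v \<omega>)"
    have e: "(indicator {0<..} r * r powr (?\<mu> - 1)) *\<^sub>R ?g (tpow r E *v \<omega>) = indicator ?J r *\<^sub>R ?h r" for r
    proof (cases "r > 0")
      case True
      then have "tpow r E *v \<omega> \<in> ?S \<longleftrightarrow> r \<in> ?J" using P by (auto simp: P_tpow field_simps)
      then show ?thesis using True by (simp add: indicator_def)
    next
      case False
      moreover have "a / P \<omega> > 0" using P ab by simp
      ultimately have "r \<notin> ?J" by auto
      then show ?thesis using False by simp
    qed
    show ?thesis
    proof (cases "a < b")
      case True
      have m: "(\<lambda>r. (indicator {0<..} r * r powr (?\<mu> - 1)) *\<^sub>R ?g (tpow r E *v \<omega>)) \<in> borel_measurable borel"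
      proof -
        define k where "k = (\<lambda>r. indicator ({0<..} \<times> UNIV) (r, \<omega>) *\<^sub>R (tpow (fst (r, \<omega>)) E *v snd (r, \<omega>)))"
        have "(\<lambda>r. (r, \<omega>)) \<in> borel \<rightarrow>\<^sub>M borel \<Otimes>\<^sub>M borel" by simp
        from measurable_compose[OF this orbit_measurable] have k: "k \<in> borel \<rightarrow>\<^sub>M borel" unfolding k_def .
        have 1: "(\<lambda>r. (indicator {0<..} r * r powr (?\<mu> - 1)) *\<^sub>R ?g (k r)) \<in> borel_measurable borel"
          by (rule borel_measurable_scaleR[OF _ measurable_compose[OF k G]]) measurable
        have 2: "(\<lambda>r. (indicator {0<..} r * r powr (?\<mu> - 1)) *\<^sub>R ?g (k r))
           = (\<lambda>r. (indicator {0<..} r * r powr (?\<mu> - 1)) *\<^sub>R ?g (tpow r E *v \<omega>))"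
        proof
          fix r show "(indicator {0<..} r * r powr (?\<mu> - 1)) *\<^sub>R ?g (k r)
             = (indicator {0<..} r * r powr (?\<mu> - 1)) *\<^sub>R ?g (tpow r E *v \<omega>)"
            by (cases "r > 0") (simp_all add: k_def)
        qed
        show ?thesis using 1 unfolding 2 .
      qed
      have si: "set_integrable lborel ?J ?h"
      proof (rule set_integrable_bounded[where B = "((a / P \<omega>) powr (?\<mu> - 1) + (b / P \<omega>) powr (?\<mu> - 1)) * B"])
        show "(\<lambda>r. indicator ?J r *\<^sub>R ?h r) \<in> borel_measurable borel" using m unfolding e .
        fix r assume r: "r \<in> ?J"
        have r0: "r > 0" using r P ab by (smt (verit) atLeastLessThan_iff divide_pos_pos)
        have "r powr (?\<mu> - 1) \<le> (a / P \<omega>) powr (?\<mu> - 1) + (b / P \<omega>) powr (?\<mu> - 1)"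
        proof (cases "?\<mu> \<ge> 1")
          case True
          then have "r powr (?\<mu> - 1) \<le> (b / P \<omega>) powr (?\<mu> - 1)" using r r0 by (intro powr_mono2) auto
          then show ?thesis by (simp add: add_increasing)
        next
          case False
          then have "r powr (?\<mu> - 1) \<le> (a / P \<omega>) powr (?\<mu> - 1)" using r P ab by (intro powr_mono2') auto
          then show ?thesis by (simp add: add_increasing2)
        qed
        moreover have "norm (G (tpow r E *v \<omega>)) \<le> B"
          using r r0 P by (intro B) (auto simp: P_tpow field_simps)
        ultimately show "norm (?h r) \<le> ((a / P \<omega>) powr (?\<mu> - 1) + (b / P \<omega>) powr (?\<mu> - 1)) * B"
          by (auto intro!: mult_mono add_nonneg_nonneg)
      qed auto
      have "?I \<omega> = (LINT r:?J|lborel. ?h r)" unfolding e set_lebesgue_integral_def ..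
      also have "\<dots> = integral ?J ?h" by (rule set_borel_integral_eq_integral(2)[OF si])
      \<comment> \<open>Half-open and closed intervals differ by a null set; the closed one suits
        the fundamental theorem of calculus.\<close>
      also have "\<dots> = integral {a / P \<omega>..b / P \<omega>} ?h"
        by (rule integral_subset_negligible) (auto intro: negligible_subset[of "{b / P \<omega>}"])
      finally show ?thesis using inner[OF \<omega>] by simp
    next
      case False
      then have "?J = {}" using P by (simp add: divide_right_mono)
      then show ?thesis unfolding e using D by simp
    qed
  qed
  have fin: "emeasure lborel annulus < \<infinity>"
    by (intro emeasure_bounded_finite compact_imp_bounded compact_annulus)
  have "norm (\<integral>\<omega>. indicator annulus \<omega> *\<^sub>R ?I \<omega> \<partial>lborel) \<le> (\<integral>\<omega>. D * indicator annulus \<omega> \<partial>lborel)"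
  \<comment> \<open>If the outer integrand is not integrable, its integral is 0 by convention and
    the bound is trivial, so measurability in \<omega> is never argued.\<close>
  proof (cases "integrable lborel (\<lambda>\<omega>. indicator annulus \<omega> *\<^sub>R ?I \<omega>)")
    case True
    then show ?thesis
    proof (rule Bochner_Integration.integral_norm_bound_integral)
      show "integrable lborel (\<lambda>\<omega>. D * indicat_real annulus \<omega>)"
        using fin by (intro integrable_mult_right integrable_real_indicator) auto
      show "norm (indicator annulus \<omega> *\<^sub>R ?I \<omega>) \<le> D * indicat_real annulus \<omega>" for \<omega>
        using I[of \<omega>] by (auto simp: indicator_def)
    qed
  next
    case False
    then show ?thesis using D by (simp add: not_integrable_integral_eq)
  qed
  then show ?thesis unfolding eq by (simp add: mult.commute)
qed

end

section \<open>Points of imaginary homogeneous type\<close>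

lemma strong_subhomD:
  assumes "strong_subhom E l f" "\<epsilon> > 0" "compact K"
  obtains \<tau> where "\<tau> > 0" "\<And>t \<xi> j. 0 < t \<Longrightarrow> t < \<tau> \<Longrightarrow> \<xi> \<in> K \<Longrightarrow> j \<le> l \<Longrightarrow>
    \<bar>t ^ j * (deriv ^^ j) (\<lambda>s. f (tpow s E *v \<xi>)) t\<bar> \<le> \<epsilon> * t"
proof -
  have "\<exists>\<tau>>0. \<forall>t. 0 < t \<and> t < \<tau> \<longrightarrow> (\<forall>\<xi>\<in>K. \<forall>j\<le>l.
            \<bar>t ^ j * (deriv ^^ j) (\<lambda>s. f (tpow s E *v \<xi>)) t\<bar> \<le> \<epsilon> * t)"
    using assms by (simp add: strong_subhom_def)
  then obtain \<tau> where "\<tau> > 0" "\<forall>t. 0 < t \<and> t < \<tau> \<longrightarrow> (\<forall>\<xi>\<in>K. \<forall>j\<le>l.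
            \<bar>t ^ j * (deriv ^^ j) (\<lambda>s. f (tpow s E *v \<xi>)) t\<bar> \<le> \<epsilon> * t)"
    by (elim exE conjE)
  then show ?thesis by (intro that[of \<tau>]) simp_all
qed

lemma strong_subhom_imp_subhom:
  assumes "strong_subhom E l f" shows "subhom E f"
  unfolding subhom_def
proof (intro conjI allI impI)
  show "contracting E" using assms by (simp add: strong_subhom_def)
  fix \<epsilon> :: real and K :: "(real^'a) set" assume \<epsilon>: "\<epsilon> > 0" and K: "compact K"
  obtain \<tau> where \<tau>: "\<tau> > 0" "\<And>t \<xi> j. 0 < t \<Longrightarrow> t < \<tau> \<Longrightarrow> \<xi> \<in> K \<Longrightarrow> j \<le> l \<Longrightarrow>
    \<bar>t ^ j * (deriv ^^ j) (\<lambda>s. f (tpow s E *v \<xi>)) t\<bar> \<le> \<epsilon> * t"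
    by (rule strong_subhomD[OF assms \<epsilon> K], rule that)
  show "\<exists>\<tau>>0. \<forall>t. 0 < t \<and> t < \<tau> \<longrightarrow> (\<forall>\<xi>\<in>K. \<bar>f (tpow t E *v \<xi>)\<bar> \<le> \<epsilon> * t)"
    using \<tau>(1) \<tau>(2)[of _ _ 0] by (intro exI[of _ \<tau>]) simp
qed

text \<open>The chain rule is expanded in partial derivatives because \<open>Ck\<close> passes from
  f to its partials; each partial can then be differentiated along the orbit by the same
  lemma.\<close>

lemma orbit_has_derivative:
  assumes f: "Ck (Suc k) U f" and t: "t > 0" and U: "tpow t E *v x \<in> U"
  shows "((\<lambda>t. f (tpow t E *v x)) has_real_derivative
    (\<Sum>i\<in>UNIV. ((1 / t) * (E *v (tpow t E *v x)) $ i) * frechet_derivative f (at (tpow t E *v x)) (axis i 1))) (at t)"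
proof -
  define y where "y = tpow t E *v x"
  define v where "v = (1 / t) *\<^sub>R (E *v y)"
  define F where "F = frechet_derivative f (at y)"
  have F: "(f has_derivative F) (at y)"
    using f U by (simp add: frechet_derivative_works F_def y_def)
  have lin: "linear F" using F by (rule has_derivative_linear)
  have "((\<lambda>t. tpow t E *v x) has_derivative (\<lambda>h. h *\<^sub>R v)) (at t)"
    using tpow_deriv[OF t, of E x] by (simp only: has_vector_derivative_def v_def y_def)
  from diff_chain_at[OF this F[unfolded y_def]]
  have D: "((\<lambda>t. f (tpow t E *v x)) has_derivative (\<lambda>h. F (h *\<^sub>R v))) (at t)" by (simp add: o_def)
  have "v = (\<Sum>i\<in>UNIV. (v $ i) *\<^sub>R axis i 1)"
    using basis_expansion[of v] by (simp add: scalar_mult_eq_scaleR)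
  then have "F v = F (\<Sum>i\<in>UNIV. (v $ i) *\<^sub>R axis i 1)" by (rule arg_cong[where f = F])
  also have "\<dots> = (\<Sum>i\<in>UNIV. v $ i * F (axis i 1))"
    unfolding linear_sum[OF lin] linear_scale[OF lin] by simp
  finally have Fv: "F v = (\<Sum>i\<in>UNIV. v $ i * F (axis i 1))" .
  have "(\<lambda>h. F (h *\<^sub>R v)) = (*) (F v)"
    using linear_scale[OF lin, of _ v] by (simp add: fun_eq_iff mult.commute)
  then have "((\<lambda>t. f (tpow t E *v x)) has_real_derivative F v) (at t)"
    using D unfolding has_field_derivative_def by metis
  then have "((\<lambda>t. f (tpow t E *v x)) has_real_derivative (\<Sum>i\<in>UNIV. v $ i * F (axis i 1))) (at t)"
    by (subst (asm) Fv)
  then show ?thesis unfolding v_def F_def y_def vector_scaleR_component real_scaleR_def .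
qed

text \<open>Strong subhomogeneity is phrased with \<open>deriv\<close>, which is informative only
  where a derivative exists; differentiability of f supplies this as long as the orbit is in
  U.\<close>

lemma orbit_deriv1:
  assumes "Ck (Suc k) U f" "t > 0" "tpow t E *v x \<in> U"
  shows "((\<lambda>t. f (tpow t E *v x)) has_real_derivative deriv (\<lambda>t. f (tpow t E *v x)) t) (at t)"
  unfolding DERIV_imp_deriv[OF orbit_has_derivative[OF assms]] by (rule orbit_has_derivative[OF assms])

text \<open>The formula for the first derivative holds on a whole interval of times, hence near t,
  and is a finite sum of products of three differentiable factors. Only existence of the second
  derivative is wanted, since its size is controlled by strong subhomogeneity, so its value stays an
  unspecified D.\<close>

lemma orbit_deriv2:
  assumes f: "Ck (Suc (Suc k)) U f" and U: "\<And>t. 0 < t \<Longrightarrow> t < \<sigma> \<Longrightarrow> tpow t E *v x \<in> U" and t: "0 < t" "t < \<sigma>"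
  shows "(deriv (\<lambda>t. f (tpow t E *v x)) has_real_derivative deriv (deriv (\<lambda>t. f (tpow t E *v x))) t) (at t)"
proof -
  let ?y = "\<lambda>t. tpow t E *v x"
  let ?D = "\<lambda>t. \<Sum>i\<in>UNIV. ((1 / t) * (E *v ?y t) $ i) * frechet_derivative f (at (?y t)) (axis i 1)"
  have eq: "deriv (\<lambda>t. f (?y t)) s = ?D s" if "s \<in> {0<..<\<sigma>}" for s
    using that U by (intro DERIV_imp_deriv orbit_has_derivative[OF f]) auto
  have "\<exists>D. ((\<lambda>t. ((1 / t) * (E *v ?y t) $ i) * frechet_derivative f (at (?y t)) (axis i 1)) has_real_derivative D) (at t)" for i
  proof -
    have c: "Ck (Suc k) U (\<lambda>z. frechet_derivative f (at z) (axis i 1))" using f by simp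
    note d1 = orbit_has_derivative[OF c t(1) U[OF t]]
    have bl: "bounded_linear (\<lambda>z. (E *v z) $ i)"
      by (rule bounded_linear_compose[OF bounded_linear_vec_nth matrix_vector_mul_bounded_linear])
    have d2: "((\<lambda>t. (E *v ?y t) $ i) has_real_derivative (E *v ((1 / t) *\<^sub>R (E *v ?y t))) $ i) (at t)"
      using bounded_linear.has_vector_derivative[OF bl tpow_deriv[OF t(1), of E x]]
      by (simp add: has_real_derivative_iff_has_vector_derivative)
    have d3: "((\<lambda>t. 1 / t) has_real_derivative - (1 / t\<^sup>2)) (at t)"
      using t(1) by (auto intro!: derivative_eq_intros simp: power2_eq_square)
    show ?thesis by (rule exI, rule DERIV_mult[OF DERIV_mult[OF d3 d2] d1])
  qed
  then have "\<exists>D. \<forall>i. ((\<lambda>t. ((1 / t) * (E *v ?y t) $ i) * frechet_derivative f (at (?y t)) (axis i 1)) has_real_derivative D i) (at t)"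
    by (intro choice allI)
  then obtain D where "\<forall>i. ((\<lambda>t. ((1 / t) * (E *v ?y t) $ i) * frechet_derivative f (at (?y t)) (axis i 1)) has_real_derivative D i) (at t)"
    by (elim exE)
  then have "(?D has_real_derivative (\<Sum>i\<in>UNIV. D i)) (at t)" by (intro DERIV_sum) (erule spec)
  then have d: "(deriv (\<lambda>t. f (?y t)) has_real_derivative (\<Sum>i\<in>UNIV. D i)) (at t)"
    by (rule has_field_derivative_transform_within_open[where S = "{0<..<\<sigma>}"]) (use t eq in auto)
  show ?thesis unfolding DERIV_imp_deriv[OF d] by (rule d)
qed

section \<open>Tails of oscillatory integrals and existence of the attractor\<close>

context contracting_im_hom
begin

text \<open>Feeds the radial estimate into the annulus bound. The perturbations p and q may vary
  with \<omega>, while \<kappa> and all constants are shared by the orbits.\<close>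

lemma tail_bound:
  assumes B: "B \<ge> 0" and Cq: "Cq \<ge> 0"
  obtains \<tau>0 C where "\<tau>0 \<ge> 1" "C \<ge> 0"
    "\<And>G \<kappa> a b. \<lbrakk>norm \<kappa> \<le> B; \<tau>0 \<le> a; a \<le> b;
      (\<lambda>x. indicator {x. a \<le> \<bar>Q x\<bar> \<and> \<bar>Q x\<bar> < b} x *\<^sub>R G x) \<in> borel_measurable borel;
      \<forall>x. a \<le> \<bar>Q x\<bar> \<and> \<bar>Q x\<bar> < b \<longrightarrow> norm (G x) \<le> 1;
      \<forall>\<omega>\<in>annulus. \<exists>p q. mild_perturbation Cq (a / \<bar>Q \<omega>\<bar>) (b / \<bar>Q \<omega>\<bar>) p q \<and>
        (\<forall>r\<in>{a / \<bar>Q \<omega>\<bar>..b / \<bar>Q \<omega>\<bar>}. G (tpow r E *v \<omega>) =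
           exp (- q r) *\<^sub>R cis (- (r * Q \<omega> + \<kappa> \<bullet> (tpow r E *v \<omega>) + p r)))\<rbrakk>
      \<Longrightarrow> norm (LINT x:{x. a \<le> \<bar>Q x\<bar> \<and> \<bar>Q x\<bar> < b}|lborel. G x) \<le> C * a powr (trace E - 1)"
proof -
  obtain a0 C where a0: "a0 \<ge> 1" and C: "C \<ge> 0" and
    osc: "\<And>\<omega> \<kappa> p q a b. \<lbrakk>1 \<le> \<bar>Q \<omega>\<bar>; \<bar>Q \<omega>\<bar> \<le> exp 1; norm \<kappa> \<le> B; a0 \<le> a; a \<le> b; mild_perturbation Cq a b p q\<rbrakk>
      \<Longrightarrow> norm (integral {a..b} (\<lambda>r. (r powr (trace E - 1) * exp (- q r)) *\<^sub>R
            cis (- (r * Q \<omega> + \<kappa> \<bullet> (tpow r E *v \<omega>) + p r)))) \<le> C * a powr (trace E - 1)"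
    by (rule radial_oscillation[OF B Cq], rule that)
  let ?\<mu> = "trace E"
  define C' where "C' = C * (1 / exp 1) powr (?\<mu> - 1) * measure lborel annulus"
  show ?thesis
  \<comment> \<open>The radial integral begins at a / |Q \<omega>| \<ge> a / e; the factor e in the
    threshold keeps this above a0, and the same loss enters C'.\<close>
  proof (rule that[of "exp 1 * a0" C'])
    show "exp 1 * a0 \<ge> 1"
      using a0 mult_mono[of 1 "exp 1" 1 a0] by simp
    show "C' \<ge> 0" using C by (simp add: C'_def)
    fix G :: "real^'d \<Rightarrow> complex" and \<kappa> :: "real^'d" and a b :: real
    assume \<kappa>: "norm \<kappa> \<le> B" and a: "exp 1 * a0 \<le> a" and ab: "a \<le> b"
      and G: "(\<lambda>x. indicator {x. a \<le> \<bar>Q x\<bar> \<and> \<bar>Q x\<bar> < b} x *\<^sub>R G x) \<in> borel_measurable borel"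
      and G1: "\<forall>x. a \<le> \<bar>Q x\<bar> \<and> \<bar>Q x\<bar> < b \<longrightarrow> norm (G x) \<le> 1"
      and H: "\<forall>\<omega>\<in>annulus. \<exists>p q. mild_perturbation Cq (a / \<bar>Q \<omega>\<bar>) (b / \<bar>Q \<omega>\<bar>) p q \<and>
        (\<forall>r\<in>{a / \<bar>Q \<omega>\<bar>..b / \<bar>Q \<omega>\<bar>}. G (tpow r E *v \<omega>) =
           exp (- q r) *\<^sub>R cis (- (r * Q \<omega> + \<kappa> \<bullet> (tpow r E *v \<omega>) + p r)))"
    have a_pos: "a > 0" using a a0 by (smt (verit) exp_gt_zero mult_pos_pos)
    have "norm (LINT x:{x. a \<le> \<bar>Q x\<bar> \<and> \<bar>Q x\<bar> < b}|lborel. G x) \<le> (C * (a / exp 1) powr (?\<mu> - 1)) * measure lborel annulus"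
    proof (rule annulus_tail_bound[OF G, where B = 1])
      show "C * (a / exp 1) powr (?\<mu> - 1) \<ge> 0" using C by simp
      fix \<omega> assume \<omega>: "\<omega> \<in> annulus"
      then have w: "1 \<le> \<bar>Q \<omega>\<bar>" "\<bar>Q \<omega>\<bar> \<le> exp 1" by (auto simp: annulus_def)
      obtain p q where mp: "mild_perturbation Cq (a / \<bar>Q \<omega>\<bar>) (b / \<bar>Q \<omega>\<bar>) p q"
        and Gr: "\<forall>r\<in>{a / \<bar>Q \<omega>\<bar>..b / \<bar>Q \<omega>\<bar>}. G (tpow r E *v \<omega>) =
           exp (- q r) *\<^sub>R cis (- (r * Q \<omega> + \<kappa> \<bullet> (tpow r E *v \<omega>) + p r))"
        using bspec[OF H \<omega>] by (elim exE conjE)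
      have ae: "a / exp 1 \<le> a / \<bar>Q \<omega>\<bar>" using w a_pos by (intro divide_left_mono mult_pos_pos) auto
      have "a0 \<le> a / exp 1" using a by (simp add: field_simps)
      then have a0a: "a0 \<le> a / \<bar>Q \<omega>\<bar>" using ae by linarith
      have "integral {a / \<bar>Q \<omega>\<bar>..b / \<bar>Q \<omega>\<bar>} (\<lambda>r. r powr (?\<mu> - 1) *\<^sub>R G (tpow r E *v \<omega>))
          = integral {a / \<bar>Q \<omega>\<bar>..b / \<bar>Q \<omega>\<bar>} (\<lambda>r. (r powr (?\<mu> - 1) * exp (- q r)) *\<^sub>R
              cis (- (r * Q \<omega> + \<kappa> \<bullet> (tpow r E *v \<omega>) + p r)))"
        by (rule Henstock_Kurzweil_Integration.integral_cong) (simp only: bspec[OF Gr] scaleR_scaleR)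
      also have "norm \<dots> \<le> C * (a / \<bar>Q \<omega>\<bar>) powr (?\<mu> - 1)"
        by (rule osc[OF w \<kappa> a0a _ mp]) (use ab in \<open>simp add: divide_right_mono\<close>)
      also have "\<dots> \<le> C * (a / exp 1) powr (?\<mu> - 1)"
        using C ae a_pos trace_lt_1 by (intro mult_left_mono powr_mono2') auto
      finally show "norm (integral {a / \<bar>Q \<omega>\<bar>..b / \<bar>Q \<omega>\<bar>} (\<lambda>r. r powr (?\<mu> - 1) *\<^sub>R G (tpow r E *v \<omega>)))
          \<le> C * (a / exp 1) powr (?\<mu> - 1)" .
    qed (use G1 a_pos in auto)
    also have "(a / exp 1) powr (?\<mu> - 1) = a powr (?\<mu> - 1) * (1 / exp 1) powr (?\<mu> - 1)"
      using a_pos powr_mult[of a "1 / exp 1" "?\<mu> - 1"] by simp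
    finally show "norm (LINT x:{x. a \<le> \<bar>Q x\<bar> \<and> \<bar>Q x\<bar> < b}|lborel. G x) \<le> C' * a powr (?\<mu> - 1)"
      by (simp add: C'_def mult_ac)
  qed
qed

lemma powr_trace_tendsto_0: "((\<lambda>\<tau>. C * \<tau> powr (trace E - 1)) \<longlongrightarrow> 0) at_top"
proof -
  have "trace E - 1 < 0" using trace_lt_1 by simp
  then have "((\<lambda>\<tau>. \<tau> powr (trace E - 1)) \<longlongrightarrow> 0) at_top" by real_asymp
  from tendsto_mult_right_zero[OF this] show ?thesis .
qed

text \<open>The truncated attractor integral rescaled to n = 1, with \<kappa> in place of the
  displacement and without the powers of 2 \<pi>.\<close>

definition osc :: "real^'d \<Rightarrow> real \<Rightarrow> complex" where
  "osc \<kappa> \<tau> = (LINT x:{x. \<bar>Q x\<bar> < \<tau>}|lborel. cis (- (Q x + \<kappa> \<bullet> x)))"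

lemma cis_measurable [measurable]: "(\<lambda>x. cis (- (Q x + \<kappa> \<bullet> x))) \<in> borel_measurable borel"
  by (intro borel_measurable_continuous_onI continuous_intros continuous_Q)

text \<open>Two truncations differ by a shell integral, to which the tail bound applies with p = q =
  0 and Cq = 0; as \<mu> < 1, this is a Cauchy condition. Integer cutoffs produce the limit, and
  sending the upper cutoff to infinity keeps the rate, uniformly for |\<kappa>| \<le> B.\<close>

lemma osc_limit:
  assumes B: "B \<ge> 0"
  obtains L C \<tau>0 where "\<tau>0 \<ge> 1" "\<And>\<kappa> \<tau>. norm \<kappa> \<le> B \<Longrightarrow> \<tau> \<ge> \<tau>0 \<Longrightarrow> norm (osc \<kappa> \<tau> - L \<kappa>) \<le> C * \<tau> powr (trace E - 1)"
    "\<And>\<kappa>. norm \<kappa> \<le> B \<Longrightarrow> (osc \<kappa> \<longlongrightarrow> L \<kappa>) at_top"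
proof -
  let ?\<mu> = "trace E"
  obtain \<tau>0 C where \<tau>0: "\<tau>0 \<ge> 1" and C: "C \<ge> 0" and
    tail: "\<And>G \<kappa> a b. \<lbrakk>norm \<kappa> \<le> B; \<tau>0 \<le> a; a \<le> b;
      (\<lambda>x. indicator {x. a \<le> \<bar>Q x\<bar> \<and> \<bar>Q x\<bar> < b} x *\<^sub>R G x) \<in> borel_measurable borel;
      \<forall>x. a \<le> \<bar>Q x\<bar> \<and> \<bar>Q x\<bar> < b \<longrightarrow> norm (G x) \<le> 1;
      \<forall>\<omega>\<in>annulus. \<exists>p q. mild_perturbation 0 (a / \<bar>Q \<omega>\<bar>) (b / \<bar>Q \<omega>\<bar>) p q \<and>
        (\<forall>r\<in>{a / \<bar>Q \<omega>\<bar>..b / \<bar>Q \<omega>\<bar>}. G (tpow r E *v \<omega>) =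
           exp (- q r) *\<^sub>R cis (- (r * Q \<omega> + \<kappa> \<bullet> (tpow r E *v \<omega>) + p r)))\<rbrakk>
      \<Longrightarrow> norm (LINT x:{x. a \<le> \<bar>Q x\<bar> \<and> \<bar>Q x\<bar> < b}|lborel. G x) \<le> C * a powr (trace E - 1)"
    by (rule tail_bound[OF B order_refl], rule that)
  have diff: "norm (osc \<kappa> b - osc \<kappa> a) \<le> C * a powr (?\<mu> - 1)" if \<kappa>: "norm \<kappa> \<le> B" and a: "\<tau>0 \<le> a" "a \<le> b" for \<kappa> a b
  proof -
    let ?G = "\<lambda>x. cis (- (Q x + \<kappa> \<bullet> x))"
    have m: "(\<lambda>x. indicator S x *\<^sub>R ?G x) \<in> borel_measurable borel" if "S \<in> sets borel" for S
      by (rule borel_measurable_scaleR[OF borel_measurable_indicator[OF that] cis_measurable])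
    have si: "set_integrable lborel S ?G" if S: "S \<in> sets borel" "bounded S" for S
      by (rule set_integrable_bounded[OF S m[OF S(1)], where B = 1]) simp
    have s2: "{x. a \<le> \<bar>Q x\<bar> \<and> \<bar>Q x\<bar> < b} \<in> sets borel" by measurable
    have "bounded {x. a \<le> \<bar>Q x\<bar> \<and> \<bar>Q x\<bar> < b}"
      by (rule bounded_subset[OF bounded_sublevel[of b]]) auto
    then have i1: "set_integrable lborel {x. \<bar>Q x\<bar> < a} ?G" "set_integrable lborel {x. a \<le> \<bar>Q x\<bar> \<and> \<bar>Q x\<bar> < b} ?G"
      by (intro si sublevel_meas bounded_sublevel s2)+
    have "{x. \<bar>Q x\<bar> < b} = {x. \<bar>Q x\<bar> < a} \<union> {x. a \<le> \<bar>Q x\<bar> \<and> \<bar>Q x\<bar> < b}" using a by auto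
    then have "osc \<kappa> b = osc \<kappa> a + (LINT x:{x. a \<le> \<bar>Q x\<bar> \<and> \<bar>Q x\<bar> < b}|lborel. ?G x)"
      unfolding osc_def by (simp only:) (rule set_integral_Un[OF _ i1], auto)
    moreover have "norm (LINT x:{x. a \<le> \<bar>Q x\<bar> \<and> \<bar>Q x\<bar> < b}|lborel. ?G x) \<le> C * a powr (?\<mu> - 1)"
    proof (rule tail[OF \<kappa> a m[OF s2]])
      have "mild_perturbation 0 c d (\<lambda>_. 0) (\<lambda>_. 0)" if "c > 0" for c d
        unfolding mild_perturbation_def by (intro exI[of _ "\<lambda>_. 0"]) (use that in auto)
      moreover have pos: "a / \<bar>Q \<omega>\<bar> > 0" if "\<omega> \<in> annulus" for \<omega>
        using that a \<tau>0 by (auto simp: annulus_def)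
      moreover have "Q (tpow r E *v \<omega>) = r * Q \<omega>" if "\<omega> \<in> annulus" "a / \<bar>Q \<omega>\<bar> \<le> r" for \<omega> r
        using less_le_trans[OF pos[OF that(1)] that(2)] by (rule Q_tpow)
      ultimately show "\<forall>\<omega>\<in>annulus. \<exists>p q. mild_perturbation 0 (a / \<bar>Q \<omega>\<bar>) (b / \<bar>Q \<omega>\<bar>) p q \<and>
        (\<forall>r\<in>{a / \<bar>Q \<omega>\<bar>..b / \<bar>Q \<omega>\<bar>}. ?G (tpow r E *v \<omega>) =
           exp (- q r) *\<^sub>R cis (- (r * Q \<omega> + \<kappa> \<bullet> (tpow r E *v \<omega>) + p r)))"
        by (intro ballI exI[of _ "\<lambda>_. 0"]) auto
    qed auto
    ultimately show ?thesis by simp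
  qed
  have conv: "convergent (\<lambda>n. osc \<kappa> (real n))" if \<kappa>: "norm \<kappa> \<le> B" for \<kappa>
  proof (rule Cauchy_convergent, rule metric_CauchyI)
    fix e :: real assume e: "e > 0"
    have "\<forall>\<^sub>F \<tau> in at_top. C * \<tau> powr (?\<mu> - 1) < e / 2"
      using powr_trace_tendsto_0 e by (intro order_tendstoD) auto
    then obtain T where T: "\<And>\<tau>. \<tau> \<ge> T \<Longrightarrow> C * \<tau> powr (?\<mu> - 1) < e / 2"
      by (auto simp: eventually_at_top_linorder)
    obtain N :: nat where N: "max T \<tau>0 \<le> real N" using real_arch_simple by blast
    have near: "dist (osc \<kappa> (real m)) (osc \<kappa> (real N)) < e / 2" if "m \<ge> N" for m
      using diff[OF \<kappa>, of "real N" "real m"] T[of "real N"] N that by (simp add: dist_norm)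
    show "\<exists>M. \<forall>m\<ge>M. \<forall>n\<ge>M. dist (osc \<kappa> (real m)) (osc \<kappa> (real n)) < e"
      using near dist_triangle_half_l by (intro exI[of _ N]) blast
  qed
  define L where "L = (\<lambda>\<kappa>. lim (\<lambda>n. osc \<kappa> (real n)))"
  have L: "norm (osc \<kappa> \<tau> - L \<kappa>) \<le> C * \<tau> powr (?\<mu> - 1)" if \<kappa>: "norm \<kappa> \<le> B" and \<tau>: "\<tau> \<ge> \<tau>0" for \<kappa> \<tau>
  proof (rule tendsto_upperbound)
    show "(\<lambda>n. norm (osc \<kappa> \<tau> - osc \<kappa> (real n))) \<longlonglongrightarrow> norm (osc \<kappa> \<tau> - L \<kappa>)"
      using conv[OF \<kappa>] unfolding L_def convergent_LIMSEQ_iff by (intro tendsto_intros)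
    have "\<forall>\<^sub>F n in sequentially. n \<ge> nat \<lceil>\<tau>\<rceil>" by (rule eventually_ge_at_top)
    then show "\<forall>\<^sub>F n in sequentially. norm (osc \<kappa> \<tau> - osc \<kappa> (real n)) \<le> C * \<tau> powr (?\<mu> - 1)"
    proof eventually_elim
      case (elim n)
      then have "\<tau> \<le> real n" by linarith
      from diff[OF \<kappa> \<tau> this] show ?case by (simp add: norm_minus_commute)
    qed
  qed simp
  show ?thesis
  proof (rule that[OF \<tau>0 L])
    fix \<kappa> :: "real^'d" assume \<kappa>: "norm \<kappa> \<le> B"
    have "((\<lambda>\<tau>. osc \<kappa> \<tau> - L \<kappa>) \<longlongrightarrow> 0) at_top"
    proof (rule Lim_null_comparison[OF _ powr_trace_tendsto_0[of C]])
      show "\<forall>\<^sub>F \<tau> in at_top. norm (osc \<kappa> \<tau> - L \<kappa>) \<le> C * \<tau> powr (?\<mu> - 1)"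
        using eventually_ge_at_top[of \<tau>0] by eventually_elim (rule L[OF \<kappa>])
    qed
    then show "(osc \<kappa> \<longlongrightarrow> L \<kappa>) at_top" by (simp add: LIM_zero_iff)
  qed
qed

lemma inner_tpow_transpose:
  assumes "t > 0"
  shows "(tpow t (transpose E') *v \<kappa>) \<bullet> (tpow (1 / t) E' *v x) = \<kappa> \<bullet> x"
  unfolding transpose_tpow transpose_matrix_vector dot_lmul_matrix using assms by (simp add: tpow_inverse)

text \<open>Substituting n^(-E) turns n Q into Q and the displacement into \<kappa>; the cutoff
  \<tau> becomes n \<tau>, which does not affect the limit. Convergence of \<open>osc\<close> is
  what gives \<open>Lim\<close> its value.\<close>

lemma H_im_rescale:
  fixes L :: complex
  assumes n: "n > 0" and L: "(osc \<kappa> \<longlongrightarrow> L) at_top"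
  shows "H_im (real n) Q (tpow (real n) (transpose E) *v \<kappa>)
    = (1 / (2 * pi)) ^ CARD('d) * (real n powr (- mu (\<lambda>x. \<bar>Q x\<bar>)) *\<^sub>R L)"
proof -
  let ?y = "tpow (real n) (transpose E) *v \<kappa>" and ?c = "real n powr (- mu (\<lambda>x. \<bar>Q x\<bar>))"
  have n0: "real n > 0" using n by simp
  have eq: "integral {\<xi>. \<bar>Q \<xi>\<bar> < \<tau>} (\<lambda>\<xi>. cis (- (real n * Q \<xi>) - ?y \<bullet> \<xi>)) = ?c *\<^sub>R osc \<kappa> (real n * \<tau>)" for \<tau>
  proof -
    let ?g = "\<lambda>\<xi>. cis (- (real n * Q \<xi>) - ?y \<bullet> \<xi>)"
    have m: "?g \<in> borel_measurable borel"
      by (intro borel_measurable_continuous_onI continuous_intros continuous_Q)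
    have m': "(\<lambda>x. indicator {x. \<bar>Q x\<bar> < \<tau>} x *\<^sub>R ?g x) \<in> borel_measurable borel"
      by (rule borel_measurable_scaleR[OF borel_measurable_indicator[OF sublevel_meas] m])
    have "set_integrable lborel {\<xi>. \<bar>Q \<xi>\<bar> < \<tau>} ?g"
      by (rule set_integrable_bounded[OF sublevel_meas bounded_sublevel m', where B = 1]) simp
    then have "integral {\<xi>. \<bar>Q \<xi>\<bar> < \<tau>} ?g = (LINT \<xi>:{\<xi>. \<bar>Q \<xi>\<bar> < \<tau>}|lborel. ?g \<xi>)"
      by (rule set_borel_integral_eq_integral(2)[symmetric])
    also have "\<dots> = ?c *\<^sub>R (LINT x:{x. \<bar>Q x\<bar> < real n * \<tau>}|lborel. ?g (tpow (1 / real n) E *v x))"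
      by (rule sublevel_integral_rescale[OF n0 m'])
    also have "\<dots> = ?c *\<^sub>R osc \<kappa> (real n * \<tau>)"
    proof -
      have "?g (tpow (1 / real n) E *v x) = cis (- (Q x + \<kappa> \<bullet> x))" for x
        using n0 by (simp add: Q_tpow inner_tpow_transpose)
      then show ?thesis by (simp only: osc_def)
    qed
    finally show ?thesis .
  qed
  have "filterlim (\<lambda>\<tau>. real n * \<tau>) at_top at_top"
    using n0 by (intro filterlim_tendsto_pos_mult_at_top[OF tendsto_const]) (auto simp: filterlim_ident)
  from filterlim_compose[OF L this]
  have "((\<lambda>\<tau>. ?c *\<^sub>R osc \<kappa> (real n * \<tau>)) \<longlongrightarrow> ?c *\<^sub>R L) at_top" by (intro tendsto_intros)
  then have "Lim at_top (\<lambda>\<tau>. ?c *\<^sub>R osc \<kappa> (real n * \<tau>)) = ?c *\<^sub>R L"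
    by (intro tendsto_Lim) auto
  then show ?thesis unfolding H_im_def eq by simp
qed

end

section \<open>The tail of the rescaled integrand\<close>

definition nexp :: "nat \<Rightarrow> ('a \<Rightarrow> real) \<Rightarrow> ('a \<Rightarrow> real) \<Rightarrow> 'a \<Rightarrow> complex" where
  "nexp n A B \<eta> = exp (- (real n * (of_real (A \<eta>) + \<i> * of_real (B \<eta>))))"

lemma norm_nexp: "norm (nexp n A B \<eta>) = exp (- (real n * A \<eta>))"
  by (simp add: nexp_def)

lemma nexp_mult_cis: "nexp n A B \<eta> * cis (- c) = exp (- (real n * A \<eta>)) *\<^sub>R cis (- (real n * B \<eta> + c))"
proof -
  have "nexp n A B \<eta> * cis (- c) = exp (- (real n * (of_real (A \<eta>) + \<i> * of_real (B \<eta>))) + \<i> * of_real (- c))"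
    by (simp only: nexp_def cis_conv_exp exp_add)
  also have "- (real n * (of_real (A \<eta>) + \<i> * of_real (B \<eta>))) + \<i> * of_real (- c)
      = of_real (- (real n * A \<eta>)) + \<i> * of_real (- (real n * B \<eta> + c))"
    by (simp add: algebra_simps)
  finally show ?thesis
    by (simp only: exp_add exp_of_real cis_conv_exp scaleR_conv_of_real)
qed

lemma nexp_measurable:
  assumes "V \<in> sets borel" "continuous_on V A" "continuous_on V B"
  shows "(\<lambda>\<eta>. indicator V \<eta> *\<^sub>R nexp n A B \<eta>) \<in> borel_measurable borel"
  unfolding nexp_def
  by (intro borel_measurable_continuous_on_indicator continuous_intros assms)

lemma mult_exp_neg_le:
  fixes c x :: real
  assumes "c > 0" shows "x * exp (- (c * x)) \<le> 1 / c"
proof -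
  have "c * x \<le> exp (c * x)" using exp_ge_add_one_self[of "c * x"] by linarith
  then show ?thesis using assms by (simp add: exp_minus field_simps)
qed

context contracting_im_hom
begin

lemma annulus_bounds:
  fixes R :: "real^'d \<Rightarrow> real"
  assumes "continuous_on UNIV R" "\<And>x. x \<noteq> 0 \<Longrightarrow> R x > 0"
  obtains c M where "c > 0" "\<And>\<omega>. \<omega> \<in> annulus \<Longrightarrow> c \<le> R \<omega>" "\<And>\<omega>. \<omega> \<in> annulus \<Longrightarrow> R \<omega> \<le> M"
proof (cases "annulus = {}")
  case False
  have c: "continuous_on annulus R" by (rule continuous_on_subset[OF assms(1)]) simp
  obtain y where y: "y \<in> annulus" "\<And>\<omega>. \<omega> \<in> annulus \<Longrightarrow> R y \<le> R \<omega>"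
    using continuous_attains_inf[OF compact_annulus False c] by blast
  obtain z where z: "z \<in> annulus" "\<And>\<omega>. \<omega> \<in> annulus \<Longrightarrow> R \<omega> \<le> R z"
    using continuous_attains_sup[OF compact_annulus False c] by blast
  have "y \<noteq> 0" using y(1) P_eq_0[of 0] by (auto simp: annulus_def)
  then show ?thesis using y z assms(2) by (intro that[of "R y" "R z"]) auto
qed (use that[of 1 0] in auto)

text \<open>With s = r / n the phase perturbation along an orbit is p r = n u(s) and the damping is
  q r = n (s^k R \<omega> + v(s^k)). Each derivative in r costs a factor 1 / n, so p' = u' and r p''
  = s u'' are bounded independently of n. Nonnegativity of R + Rt keeps the integrand in the unit
  disc and q \<ge> 0. Allowing every \<delta>' \<le> \<delta> leaves room to shrink the
  neighbourhood later.\<close>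

lemma perturbed_tail:
  assumes B: "B \<ge> 0" and U: "open U" "0 \<in> U" and CQ: "Ck (Suc (Suc 0)) U Qt" and CR: "Ck (Suc 0) U Rt"
    and ssQ: "strong_subhom E 2 Qt" and ssR: "strong_subhom ((1 / k) *\<^sub>R E) 1 Rt"
    and R: "pos_hom R" "hom_wrt ((1 / k) *\<^sub>R E) R" and k: "1 < k"
    and nn: "\<And>x. x \<in> U \<Longrightarrow> 0 \<le> R x + Rt x"
  obtains \<delta> \<tau>0 C where "\<delta> > 0" "\<tau>0 \<ge> 1" "\<And>x. \<bar>Q x\<bar> < \<delta> \<Longrightarrow> x \<in> U"
    "\<And>n \<kappa> a \<delta>'. \<lbrakk>n > 0; norm \<kappa> \<le> B; 0 < \<delta>'; \<delta>' \<le> \<delta>; \<tau>0 \<le> a; a \<le> real n * \<delta>'\<rbrakk> \<Longrightarrow>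
      norm (LINT x:{x. a \<le> \<bar>Q x\<bar> \<and> \<bar>Q x\<bar> < real n * \<delta>'}|lborel.
        nexp n (\<lambda>\<eta>. R \<eta> + Rt \<eta>) (\<lambda>\<eta>. Q \<eta> + Qt \<eta>) (tpow (1 / real n) E *v x) * cis (- (\<kappa> \<bullet> x))) \<le> C * a powr (trace E - 1)"
proof -
  have contR: "continuous_on UNIV R" and posR: "\<And>x. x \<noteq> 0 \<Longrightarrow> R x > 0"
    using R(1) unfolding pos_hom_def by (auto simp: less_le)
  obtain c M where c: "c > 0" "\<And>\<omega>. \<omega> \<in> annulus \<Longrightarrow> c \<le> R \<omega>" and M: "\<And>\<omega>. \<omega> \<in> annulus \<Longrightarrow> R \<omega> \<le> M"
    by (rule annulus_bounds[OF contR posR], assumption, rule that)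
  define M' where "M' = max M 0"
  have M': "M' \<ge> 0" "\<And>\<omega>. \<omega> \<in> annulus \<Longrightarrow> R \<omega> \<le> M'" using M by (auto simp: M'_def le_max_iff_disj)
  \<comment> \<open>With X = n s^k one has |q'| \<le> k (M' + c / 2) X / r and q \<ge> c X / 2; then
    X exp (- c X / 2) \<le> 2 / c gives this constant.\<close>
  define Cq where "Cq = k * (M' + c / 2) * (2 / c)"
  have Cq: "Cq \<ge> 0" using k c(1) M' by (simp add: Cq_def)
  obtain \<tau>0 C where \<tau>0: "\<tau>0 \<ge> 1" and C: "C \<ge> 0" and
    tail: "\<And>G \<kappa> a b. \<lbrakk>norm \<kappa> \<le> B; \<tau>0 \<le> a; a \<le> b;
      (\<lambda>x. indicator {x. a \<le> \<bar>Q x\<bar> \<and> \<bar>Q x\<bar> < b} x *\<^sub>R G x) \<in> borel_measurable borel;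
      \<forall>x. a \<le> \<bar>Q x\<bar> \<and> \<bar>Q x\<bar> < b \<longrightarrow> norm (G x) \<le> 1;
      \<forall>\<omega>\<in>annulus. \<exists>p q. mild_perturbation Cq (a / \<bar>Q \<omega>\<bar>) (b / \<bar>Q \<omega>\<bar>) p q \<and>
        (\<forall>r\<in>{a / \<bar>Q \<omega>\<bar>..b / \<bar>Q \<omega>\<bar>}. G (tpow r E *v \<omega>) =
           exp (- q r) *\<^sub>R cis (- (r * Q \<omega> + \<kappa> \<bullet> (tpow r E *v \<omega>) + p r)))\<rbrakk>
      \<Longrightarrow> norm (LINT x:{x. a \<le> \<bar>Q x\<bar> \<and> \<bar>Q x\<bar> < b}|lborel. G x) \<le> C * a powr (trace E - 1)"
    by (rule tail_bound[OF B Cq], rule that)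
  obtain \<tau>Q where \<tau>Q: "\<tau>Q > 0" "\<And>t \<xi> j. 0 < t \<Longrightarrow> t < \<tau>Q \<Longrightarrow> \<xi> \<in> annulus \<Longrightarrow> j \<le> 2 \<Longrightarrow>
    \<bar>t ^ j * (deriv ^^ j) (\<lambda>s. Qt (tpow s E *v \<xi>)) t\<bar> \<le> 1 / 4 * t"
    by (rule strong_subhomD[OF ssQ _ compact_annulus, of "1 / 4"], simp, rule that)
  \<comment> \<open>Half of the lower bound c of R on the annulus is given up to Rt, so R + Rt still
    dominates c s^k / 2 along orbits.\<close>
  obtain \<tau>R where \<tau>R: "\<tau>R > 0" "\<And>t \<xi> j. 0 < t \<Longrightarrow> t < \<tau>R \<Longrightarrow> \<xi> \<in> annulus \<Longrightarrow> j \<le> 1 \<Longrightarrow>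
    \<bar>t ^ j * (deriv ^^ j) (\<lambda>s. Rt (tpow s ((1 / k) *\<^sub>R E) *v \<xi>)) t\<bar> \<le> c / 2 * t"
    by (rule strong_subhomD[OF ssR _ compact_annulus, of "c / 2"], simp add: c(1), rule that)
  obtain \<sigma>0 where \<sigma>0: "\<sigma>0 > 0" "\<And>x. \<bar>Q x\<bar> < \<sigma>0 \<Longrightarrow> x \<in> U"
    by (rule sublevel_shrink[OF U], rule that)
  \<comment> \<open>Three constraints on the time s: the orbit of an annulus point stays in U (where
    |Q \<omega>| \<le> e costs the factor e), s is small enough for Qt, and s^k, the time belonging
    to E / k, is small enough for Rt.\<close>
  define \<sigma> where "\<sigma> = min (\<sigma>0 / exp 1) (min \<tau>Q (\<tau>R powr (1 / k)))"
  have \<sigma>: "\<sigma> > 0" using \<sigma>0 \<tau>Q \<tau>R by (simp add: \<sigma>_def)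
  have mem: "tpow s E *v \<omega> \<in> U" if "0 < s" "s < \<sigma>" "\<omega> \<in> annulus" for s \<omega>
  proof (rule \<sigma>0(2))
    have "s * \<bar>Q \<omega>\<bar> \<le> s * exp 1" using that by (intro mult_left_mono) (auto simp: annulus_def)
    also have "\<dots> < \<sigma>0" using that by (simp add: \<sigma>_def field_simps)
    finally show "\<bar>Q (tpow s E *v \<omega>)\<bar> < \<sigma>0" using P_tpow[OF that(1), of \<omega>] by simp
  qed
  have tk: "tpow (s powr k) ((1 / k) *\<^sub>R E) = tpow s E" if "s > 0" for s
    using that k by (simp add: tpow_divide powr_powr)
  have Rk: "R (tpow s E *v x) = s powr k * R x" if "s > 0" for s x
    using R(2) that unfolding hom_wrt_def by (metis tk powr_gt_zero less_irrefl)
  have sk: "s powr k < \<tau>R" if "0 < s" "s < \<sigma>" for s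
  proof -
    have "s powr k < (\<tau>R powr (1 / k)) powr k"
      using that k by (intro powr_less_mono2) (auto simp: \<sigma>_def)
    then show ?thesis using k \<tau>R(1) by (simp add: powr_powr)
  qed
  define u where "u = (\<lambda>\<omega> s. Qt (tpow s E *v \<omega>))"
  define v where "v = (\<lambda>\<omega> t. Rt (tpow t ((1 / k) *\<^sub>R E) *v \<omega>))"
  have u_app: "(\<lambda>s. Qt (tpow s E *v \<omega>)) = u \<omega>" and v_app: "(\<lambda>s. Rt (tpow s ((1 / k) *\<^sub>R E) *v \<omega>)) = v \<omega>" for \<omega>
    by (simp_all add: u_def v_def)
  have u1: "(u \<omega> has_real_derivative deriv (u \<omega>) s) (at s)"
    and u2: "(deriv (u \<omega>) has_real_derivative deriv (deriv (u \<omega>)) s) (at s)"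
    and u1_le: "\<bar>deriv (u \<omega>) s\<bar> \<le> 1 / 4" and u2_le: "\<bar>deriv (deriv (u \<omega>)) s\<bar> \<le> 1 / s"
    if s: "0 < s" "s < \<sigma>" and \<omega>: "\<omega> \<in> annulus" for s \<omega>
  proof -
    show "(u \<omega> has_real_derivative deriv (u \<omega>) s) (at s)"
      unfolding u_def by (rule orbit_deriv1[OF CQ s(1) mem[OF s \<omega>]])
    show "(deriv (u \<omega>) has_real_derivative deriv (deriv (u \<omega>)) s) (at s)"
      unfolding u_def by (rule orbit_deriv2[OF CQ mem[OF _ _ \<omega>] s])
    have "s < \<tau>Q" using s by (simp add: \<sigma>_def)
    note b = \<tau>Q(2)[OF s(1) this \<omega>, unfolded u_app]
    show "\<bar>deriv (u \<omega>) s\<bar> \<le> 1 / 4" using b[of 1] s(1) by (simp add: abs_mult)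
    have "s ^ 2 * \<bar>deriv (deriv (u \<omega>)) s\<bar> \<le> s"
      using b[of 2] s(1) by (simp add: abs_mult numeral_2_eq_2)
    then show "\<bar>deriv (deriv (u \<omega>)) s\<bar> \<le> 1 / s"
      using s(1) by (simp add: field_simps power2_eq_square)
  qed
  have v1: "(v \<omega> has_real_derivative deriv (v \<omega>) (s powr k)) (at (s powr k))"
    and v0_le: "\<bar>v \<omega> (s powr k)\<bar> \<le> c / 2 * s powr k" and v1_le: "\<bar>deriv (v \<omega>) (s powr k)\<bar> \<le> c / 2"
    and v_eq: "v \<omega> (s powr k) = Rt (tpow s E *v \<omega>)"
    if s: "0 < s" "s < \<sigma>" and \<omega>: "\<omega> \<in> annulus" for s \<omega>
  proof -
    have t: "s powr k > 0" using s by simp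
    show "(v \<omega> has_real_derivative deriv (v \<omega>) (s powr k)) (at (s powr k))"
      unfolding v_def by (rule orbit_deriv1[OF CR t]) (simp add: tk[OF s(1)] mem[OF s \<omega>])
    note b = \<tau>R(2)[OF t sk[OF s] \<omega>, unfolded v_app]
    show "\<bar>v \<omega> (s powr k)\<bar> \<le> c / 2 * s powr k" using b[of 0] by simp
    show "\<bar>deriv (v \<omega>) (s powr k)\<bar> \<le> c / 2" using b[of 1] t by (simp add: abs_mult)
    show "v \<omega> (s powr k) = Rt (tpow s E *v \<omega>)" by (simp add: v_def tk[OF s(1)])
  qed
  let ?A = "\<lambda>\<eta>. R \<eta> + Rt \<eta>" and ?B = "\<lambda>\<eta>. Q \<eta> + Qt \<eta>"
  show ?thesis
  \<comment> \<open>Half of \<sigma>, because the closed radial interval includes s = \<delta>' / |Q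
    \<omega>|, which may equal \<delta>', while the derivative bounds need s < \<sigma>
    strictly.\<close>
  proof (rule that[of "\<sigma> / 2" \<tau>0])
    show "x \<in> U" if "\<bar>Q x\<bar> < \<sigma> / 2" for x
    proof (rule \<sigma>0(2))
      have "\<sigma> \<le> \<sigma>0 / exp 1" by (simp add: \<sigma>_def)
      also have "\<dots> \<le> \<sigma>0" using \<sigma>0(1) by (simp add: field_simps)
      finally show "\<bar>Q x\<bar> < \<sigma>0" using that \<sigma> by linarith
    qed
    fix n :: nat and \<kappa> :: "real^'d" and a \<delta>' :: real
    assume n: "n > 0" and \<kappa>: "norm \<kappa> \<le> B" and \<delta>': "0 < \<delta>'" "\<delta>' \<le> \<sigma> / 2" and a: "\<tau>0 \<le> a" "a \<le> real n * \<delta>'"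
    let ?T = "\<lambda>x. tpow (1 / real n) E *v x"
    let ?S = "{x. a \<le> \<bar>Q x\<bar> \<and> \<bar>Q x\<bar> < real n * \<delta>'}"
    let ?G = "\<lambda>x. nexp n ?A ?B (?T x) * cis (- (\<kappa> \<bullet> x))"
    let ?V = "{x. \<bar>Q x\<bar> < \<delta>'}"
    have n0: "real n > 0" using n by simp
    have VU: "?V \<subseteq> U"
    proof safe
      fix x assume "\<bar>Q x\<bar> < \<delta>'"
      moreover have "\<sigma> \<le> \<sigma>0 / exp 1" by (simp add: \<sigma>_def)
      moreover have "\<sigma>0 / exp 1 \<le> \<sigma>0" using \<sigma>0(1) by (simp add: field_simps)
      ultimately show "x \<in> U" using \<delta>' \<sigma> by (intro \<sigma>0(2)) linarith
    qed
    have TV: "?T x \<in> ?V" if "x \<in> ?S" for x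
    proof -
      have "\<bar>Q (?T x)\<bar> = \<bar>Q x\<bar> / real n" using P_tpow[of "1 / real n" x] n0 by simp
      then show ?thesis using that n0 by (simp add: pos_divide_less_eq mult.commute)
    qed
    show "norm (LINT x:?S|lborel. ?G x) \<le> C * a powr (trace E - 1)"
    proof (rule tail[OF \<kappa> a])
      have "continuous_on U Qt" "continuous_on U Rt" using CQ CR by simp_all
      then have "continuous_on ?V ?A" "continuous_on ?V ?B"
        using VU by (auto intro!: continuous_intros continuous_Q continuous_on_subset[OF contR]
            elim: continuous_on_subset)
      then have m1: "(\<lambda>\<eta>. indicator ?V \<eta> *\<^sub>R nexp n ?A ?B \<eta>) \<in> borel_measurable borel"
        by (intro nexp_measurable sublevel_meas)
      have m2: "(\<lambda>x. indicator ?V (?T x) *\<^sub>R nexp n ?A ?B (?T x)) \<in> borel_measurable borel"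
        by (rule measurable_compose[OF borel_measurable_matrix_vector_mult m1])
      have m3: "(\<lambda>x. cis (- (\<kappa> \<bullet> x))) \<in> borel_measurable borel"
        by (intro borel_measurable_continuous_onI continuous_intros)
      have S: "?S \<in> sets borel" by measurable
      \<comment> \<open>Continuity of the perturbations is known only on U, so measurability goes
        through the indicator of the sublevel set \<open>?V\<close>, which equals 1 at the dilated
        points of the shell.\<close>
      have eq: "(\<lambda>x. indicator ?S x *\<^sub>R ?G x)
          = (\<lambda>x. indicator ?S x *\<^sub>R ((indicator ?V (?T x) *\<^sub>R nexp n ?A ?B (?T x)) * cis (- (\<kappa> \<bullet> x))))"
      proof
        fix x show "indicator ?S x *\<^sub>R ?G x
          = indicator ?S x *\<^sub>R ((indicator ?V (?T x) *\<^sub>R nexp n ?A ?B (?T x)) * cis (- (\<kappa> \<bullet> x)))"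
        proof (cases "x \<in> ?S")
          case True
          have "indicator ?V (?T x) = (1 :: real)" using TV[OF True] by (rule indicator_simps(1))
          then show ?thesis by (simp only: scaleR_one)
        next
          case False
          then have "indicator ?S x = (0 :: real)" by (rule indicator_simps(2))
          then show ?thesis by (simp only: scaleR_zero_left)
        qed
      qed
      show "(\<lambda>x. indicator ?S x *\<^sub>R ?G x) \<in> borel_measurable borel"
        unfolding eq by (intro borel_measurable_scaleR borel_measurable_times borel_measurable_indicator S m2 m3)
      show "\<forall>x. a \<le> \<bar>Q x\<bar> \<and> \<bar>Q x\<bar> < real n * \<delta>' \<longrightarrow> norm (?G x) \<le> 1"
      proof (intro allI impI)
        fix x assume "a \<le> \<bar>Q x\<bar> \<and> \<bar>Q x\<bar> < real n * \<delta>'"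
        then have "?T x \<in> U" using TV[of x] VU by blast
        then show "norm (?G x) \<le> 1" using nn[of "?T x"] by (simp add: norm_mult norm_nexp)
      qed
      show "\<forall>\<omega>\<in>annulus. \<exists>p q. mild_perturbation Cq (a / \<bar>Q \<omega>\<bar>) (real n * \<delta>' / \<bar>Q \<omega>\<bar>) p q \<and>
        (\<forall>r\<in>{a / \<bar>Q \<omega>\<bar>..real n * \<delta>' / \<bar>Q \<omega>\<bar>}. ?G (tpow r E *v \<omega>) =
           exp (- q r) *\<^sub>R cis (- (r * Q \<omega> + \<kappa> \<bullet> (tpow r E *v \<omega>) + p r)))"
      proof
        fix \<omega> assume \<omega>: "\<omega> \<in> annulus"
        then have w: "1 \<le> \<bar>Q \<omega>\<bar>" by (simp add: annulus_def)
        let ?I = "{a / \<bar>Q \<omega>\<bar>..real n * \<delta>' / \<bar>Q \<omega>\<bar>}"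
        define p where "p = (\<lambda>r. real n * u \<omega> (r / real n))"
        define q where "q = (\<lambda>r. real n * ((r / real n) powr k * R \<omega> + v \<omega> ((r / real n) powr k)))"
        define q' where "q' = (\<lambda>r. k * (r / real n) powr (k - 1) * (R \<omega> + deriv (v \<omega>) ((r / real n) powr k)))"
        have I: "r > 0" "r / real n > 0" "r / real n < \<sigma>" if r: "r \<in> ?I" for r
        proof -
          have "a / \<bar>Q \<omega>\<bar> > 0" using w a \<tau>0 by simp
          then show r0: "r > 0" using r by auto
          then show "r / real n > 0" using n0 by simp
          have "r \<le> real n * \<delta>' / \<bar>Q \<omega>\<bar>" using r by simp
          also have "\<dots> \<le> real n * \<delta>' / 1" using w n0 \<delta>' by (intro divide_left_mono) auto
          finally have "r / real n \<le> \<delta>'" using n0 by (simp add: field_simps)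
          then show "r / real n < \<sigma>" using \<delta>' \<sigma> by linarith
        qed
        have q_eq: "q r = real n * ?A (tpow (r / real n) E *v \<omega>)" if "r \<in> ?I" for r
          using I[OF that] v_eq[OF I(2,3)[OF that] \<omega>] by (simp add: q_def Rk)
        have dn: "((\<lambda>r. r / real n) has_real_derivative 1 / real n) (at r)" for r
          using n0 by (auto intro!: derivative_eq_intros)
        have "mild_perturbation Cq (a / \<bar>Q \<omega>\<bar>) (real n * \<delta>' / \<bar>Q \<omega>\<bar>) p q"
          unfolding mild_perturbation_def
        proof (rule exI[of _ "\<lambda>r. deriv (u \<omega>) (r / real n)"],
               rule exI[of _ "\<lambda>r. deriv (deriv (u \<omega>)) (r / real n) / real n"], rule exI[of _ q'], intro ballI conjI)
          fix r assume r: "r \<in> ?I"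
          note s = I(2,3)[OF r]
          define s' where "s' = r / real n"
          have s': "s' > 0" "s' < \<sigma>" using s by (simp_all add: s'_def)
          show "(p has_real_derivative deriv (u \<omega>) (r / real n)) (at r)"
            using DERIV_cmult[OF DERIV_chain2[OF u1[OF s \<omega>] dn], of "real n"] n0 by (simp add: p_def)
          show "((\<lambda>r. deriv (u \<omega>) (r / real n)) has_real_derivative deriv (deriv (u \<omega>)) (r / real n) / real n) (at r)"
            using DERIV_chain2[OF u2[OF s \<omega>] dn] by simp
          show "\<bar>deriv (u \<omega>) (r / real n)\<bar> \<le> 1 / 4" by (rule u1_le[OF s \<omega>])
          show "\<bar>deriv (deriv (u \<omega>)) (r / real n) / real n\<bar> \<le> 1 / r"
            using u2_le[OF s \<omega>] n0 I(1)[OF r] by (simp add: field_simps)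
          have dpk: "((\<lambda>r. (r / real n) powr k) has_real_derivative k * (r / real n) powr (k - 1) * (1 / real n)) (at r)"
            using DERIV_chain2[OF has_real_derivative_powr[OF s(1), of k] dn] by simp
          have "(q has_real_derivative real n * (k * (r / real n) powr (k - 1) * (1 / real n) * R \<omega>
              + deriv (v \<omega>) ((r / real n) powr k) * (k * (r / real n) powr (k - 1) * (1 / real n)))) (at r)"
            unfolding q_def
            by (intro DERIV_cmult DERIV_add DERIV_cmult_right DERIV_chain2[OF v1[OF s \<omega>] dpk] dpk)
          then show "(q has_real_derivative q' r) (at r)"
            using n0 by (simp add: q'_def algebra_simps)
          have "tpow (r / real n) E *v \<omega> \<in> U" by (rule mem[OF s \<omega>])
          then show "0 \<le> q r" using nn n0 by (simp add: q_eq[OF r])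
          define X where "X = real n * s' powr k"
          have X: "X \<ge> 0" by (simp add: X_def)
          have "\<bar>v \<omega> (s' powr k)\<bar> \<le> c / 2 * s' powr k" by (rule v0_le[OF s' \<omega>])
          moreover have "c * s' powr k \<le> R \<omega> * s' powr k" using c(2)[OF \<omega>] by (intro mult_right_mono) auto
          ultimately have "c / 2 * s' powr k \<le> s' powr k * R \<omega> + v \<omega> (s' powr k)"
            by (simp add: mult.commute)
          from mult_left_mono[OF this, of "real n"]
          have qX: "c / 2 * X \<le> q r" by (simp add: q_def X_def s'_def mult_ac)
          have pw: "s' powr (k - 1) = X / r"
            using s'(1) n0 I(1)[OF r] powr_diff[of s' k 1] by (simp add: X_def s'_def field_simps)
          have "\<bar>q' r\<bar> = k * s' powr (k - 1) * \<bar>R \<omega> + deriv (v \<omega>) (s' powr k)\<bar>"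
            using k by (simp add: q'_def s'_def abs_mult)
          also have "\<dots> \<le> k * s' powr (k - 1) * (M' + c / 2)"
          proof (intro mult_left_mono)
            have "0 \<le> R \<omega>" using c(1) c(2)[OF \<omega>] by linarith
            then show "\<bar>R \<omega> + deriv (v \<omega>) (s' powr k)\<bar> \<le> M' + c / 2"
              using M'(2)[OF \<omega>] v1_le[OF s' \<omega>] by linarith
          qed (use k in auto)
          finally have "\<bar>q' r\<bar> \<le> k * (M' + c / 2) * (X / r)" by (simp add: pw mult_ac)
          moreover have "exp (- q r) \<le> exp (- (c / 2 * X))" using qX by simp
          ultimately have "\<bar>q' r\<bar> * exp (- q r) \<le> (k * (M' + c / 2) * (X / r)) * exp (- (c / 2 * X))"
            using k M'(1) c(1) X I(1)[OF r] by (intro mult_mono) auto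
          also have "\<dots> = k * (M' + c / 2) / r * (X * exp (- (c / 2 * X)))" by simp
          also have "\<dots> \<le> k * (M' + c / 2) / r * (1 / (c / 2))"
            using k M'(1) c(1) I(1)[OF r] by (intro mult_left_mono mult_exp_neg_le) auto
          also have "\<dots> = Cq / r" by (simp add: Cq_def)
          finally show "\<bar>q' r\<bar> * exp (- q r) \<le> Cq / r" .
        qed
        moreover have "?G (tpow r E *v \<omega>) = exp (- q r) *\<^sub>R cis (- (r * Q \<omega> + \<kappa> \<bullet> (tpow r E *v \<omega>) + p r))"
          if r: "r \<in> ?I" for r
        proof -
          have T: "?T (tpow r E *v \<omega>) = tpow (r / real n) E *v \<omega>"
            using n0 I(1)[OF r] by (simp add: tpow_tpow)
          have "real n * ?B (tpow (r / real n) E *v \<omega>) + \<kappa> \<bullet> (tpow r E *v \<omega>) = r * Q \<omega> + \<kappa> \<bullet> (tpow r E *v \<omega>) + p r"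
            using n0 I(2)[OF r] by (simp add: p_def u_def Q_tpow distrib_left)
          then show ?thesis unfolding T nexp_mult_cis q_eq[OF r] by (simp only:)
        qed
        ultimately show "\<exists>p q. mild_perturbation Cq (a / \<bar>Q \<omega>\<bar>) (real n * \<delta>' / \<bar>Q \<omega>\<bar>) p q \<and>
          (\<forall>r\<in>?I. ?G (tpow r E *v \<omega>) = exp (- q r) *\<^sub>R cis (- (r * Q \<omega> + \<kappa> \<bullet> (tpow r E *v \<omega>) + p r)))"
          by (intro exI[of _ p] exI[of _ q] conjI ballI)
      qed
    qed
  qed (use \<sigma> \<tau>0 in auto)
qed

end

section \<open>The expansion for imaginary homogeneous type\<close>

context contracting_im_hom
begin

text \<open>The displacement is given as an adjoint dilation for the exponent E of the type
  condition, with only a bound on \<kappa>; compact sets and other exponents are reduced to this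
  afterwards.\<close>

lemma imaginary_expansion_contracting:
  fixes \<phi> :: "int^'d \<Rightarrow> complex"
  assumes \<phi>: "\<phi> \<in> S_d" and sup: "(SUP \<xi>. norm (fhat \<phi> \<xi>)) = 1" and Om: "Omega \<phi> = {\<xi>0}"
    and dec: "log_decomp \<phi> \<xi>0 U \<alpha> Q Qt R Rt"
    and ssQ: "strong_subhom E 2 Qt" and ssR: "strong_subhom ((1 / k) *\<^sub>R E) 1 Rt"
    and R: "pos_hom R" "hom_wrt ((1 / k) *\<^sub>R E) R" and k: "1 < k" and B: "B \<ge> 0" and \<epsilon>: "\<epsilon> > 0"
  shows "\<forall>\<^sub>F n in sequentially. \<forall>x \<kappa>. norm \<kappa> \<le> B \<and> lat x - real n *\<^sub>R \<alpha> = tpow (real n) (transpose E) *v \<kappa> \<longrightarrow>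
    norm (cpow \<phi> n x - fhat \<phi> \<xi>0 ^ n * cis (- (lat x \<bullet> \<xi>0)) * H_im (real n) Q (lat x - real n *\<^sub>R \<alpha>))
      \<le> \<epsilon> * real n powr (- mu (\<lambda>\<xi>. \<bar>Q \<xi>\<bar>))"
proof -
  let ?A = "\<lambda>\<eta>. R \<eta> + Rt \<eta>" and ?B = "\<lambda>\<eta>. Q \<eta> + Qt \<eta>" and ?\<mu> = "trace E"
  have U: "open U" "0 \<in> U" and sm: "smooth_on U Qt" "smooth_on U Rt" and pR: "poly_nolin R"
    using dec by (auto simp: log_decomp_def)
  have CQ: "Ck (Suc (Suc 0)) U Qt" and CR: "Ck (Suc 0) U Rt" using sm unfolding smooth_on_def by blast+
  have "\<xi>0 \<in> Omega \<phi>" using Om by simp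
  then have f1: "norm (fhat \<phi> \<xi>0) = 1" by (simp add: Omega_def)
  \<comment> \<open>Global maximality in logarithmic form: - (R + Rt) is the logarithm of a modulus
    at most 1.\<close>
  have nn: "0 \<le> R x + Rt x" if "x \<in> U" for x
  proof -
    let ?z = "fhat \<phi> (x + \<xi>0) / fhat \<phi> \<xi>0"
    let ?L = "\<i> * of_real (\<alpha> \<bullet> x) - \<i> * of_real (Q x + Qt x) - of_real (R x + Rt x)"
    have nz: "fhat \<phi> (x + \<xi>0) \<noteq> 0" and L: "Ln ?z = ?L"
      using dec that by (auto simp: log_decomp_def)
    have z0: "?z \<noteq> 0" using nz f1 by auto
    have "ln (norm ?z) = Re (Ln ?z)" by (rule Re_Ln[OF z0, symmetric])
    also have "\<dots> = - (R x + Rt x)" unfolding L by simp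
    finally have "ln (norm ?z) = - (R x + Rt x)" .
    moreover have "norm ?z \<le> 1" using fhat_le_1[OF \<phi> sup, of "x + \<xi>0"] f1 by (simp add: norm_divide)
    then have "ln (norm ?z) \<le> 0" using z0 by (subst ln_le_zero_iff) auto
    ultimately show ?thesis by linarith
  qed
  obtain \<delta>0 \<tau>1 C1 where \<delta>0: "\<delta>0 > 0" and \<tau>1: "\<tau>1 \<ge> 1" and \<delta>0U: "\<And>x. \<bar>Q x\<bar> < \<delta>0 \<Longrightarrow> x \<in> U" and
    tail: "\<And>n \<kappa> a \<delta>'. \<lbrakk>n > 0; norm \<kappa> \<le> B; 0 < \<delta>'; \<delta>' \<le> \<delta>0; \<tau>1 \<le> a; a \<le> real n * \<delta>'\<rbrakk> \<Longrightarrow>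
      norm (LINT x:{x. a \<le> \<bar>Q x\<bar> \<and> \<bar>Q x\<bar> < real n * \<delta>'}|lborel.
        nexp n ?A ?B (tpow (1 / real n) E *v x) * cis (- (\<kappa> \<bullet> x))) \<le> C1 * a powr (?\<mu> - 1)"
    by (rule perturbed_tail[OF B U CQ CR ssQ ssR R k nn], assumption, rule that)
  obtain \<delta>1 where \<delta>1: "\<delta>1 > 0" "\<And>x. \<bar>Q x\<bar> < \<delta>1 \<Longrightarrow> x \<in> box (\<chi> i. - pi) (\<chi> i. pi)"
    by (rule sublevel_shrink[OF zero_mem_cube_interior(1,2)], rule that)
  define \<delta> where "\<delta> = min \<delta>0 \<delta>1"
  define V where "V = {x. \<bar>Q x\<bar> < \<delta>}"
  have \<delta>: "\<delta> > 0" "\<delta> \<le> \<delta>0" using \<delta>0 \<delta>1(1) by (simp_all add: \<delta>_def)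
  have V: "open V" "0 \<in> V" "V \<subseteq> U" "V \<subseteq> cube"
    using open_sublevel[of \<delta>] zero_mem_sublevel[OF \<delta>(1)] \<delta>0U \<delta>1(2) zero_mem_cube_interior(3)
    by (auto simp: V_def \<delta>_def)
  obtain \<rho> where \<rho>: "0 \<le> \<rho>" "\<rho> < 1"
    "\<And>n x. norm (cpow \<phi> n x - fhat \<phi> \<xi>0 ^ n * cis (- (lat x \<bullet> \<xi>0)) * ((1 / (2 * pi)) ^ CARD('d) *
        (LINT \<eta>:V|lborel. exp (- (real n * (of_real (R \<eta> + Rt \<eta>) + \<i> * of_real (Q \<eta> + Qt \<eta>)))) *
           cis (- ((lat x - real n *\<^sub>R \<alpha>) \<bullet> \<eta>))))) \<le> \<rho> ^ n"
    by (rule cpow_localize[OF \<phi> sup Om dec V], rule that)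
  obtain L C2 \<tau>2 where \<tau>2: "\<tau>2 \<ge> 1"
    and L_le: "\<And>\<kappa> \<tau>. norm \<kappa> \<le> B \<Longrightarrow> \<tau> \<ge> \<tau>2 \<Longrightarrow> norm (osc \<kappa> \<tau> - L \<kappa>) \<le> C2 * \<tau> powr (?\<mu> - 1)"
    and L: "\<And>\<kappa>. norm \<kappa> \<le> B \<Longrightarrow> (osc \<kappa> \<longlongrightarrow> L \<kappa>) at_top"
    by (rule osc_limit[OF B], rule that)
  \<comment> \<open>The cutoff is fixed before n. It makes the tails of the rescaled integral and of
    the attractor at most \<epsilon> / 4 each, uniformly in n and \<kappa>; what remains lives on a
    fixed bounded set.\<close>
  have "\<forall>\<^sub>F \<tau> in at_top. C1 * \<tau> powr (?\<mu> - 1) < \<epsilon> / 4 \<and> C2 * \<tau> powr (?\<mu> - 1) < \<epsilon> / 4 \<and> \<tau> \<ge> max \<tau>1 \<tau>2"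
    using \<epsilon> by (intro eventually_conj order_tendstoD(2)[OF powr_trace_tendsto_0] eventually_ge_at_top) auto
  then obtain \<tau> where \<tau>: "C1 * \<tau> powr (?\<mu> - 1) < \<epsilon> / 4" "C2 * \<tau> powr (?\<mu> - 1) < \<epsilon> / 4" "\<tau>1 \<le> \<tau>" "\<tau>2 \<le> \<tau>"
    by (auto dest!: eventually_happens)
  define T where "T = (\<lambda>n. tpow (1 / real n) E)"
  define g where "g = (\<lambda>n \<eta>. indicator V \<eta> *\<^sub>R nexp n ?A ?B \<eta>)"
  \<comment> \<open>The character is dropped as in the positive case, so D does not involve
    \<kappa>.\<close>
  define D where "D = (\<lambda>n. \<integral>x. indicator {x. \<bar>Q x\<bar> < \<tau>} x * norm (g n (T n *v x) - cis (- Q x)) \<partial>lborel)"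
  have contV: "continuous_on V ?A" "continuous_on V ?B"
    using V(3) smooth_on_continuous[OF sm(1)] smooth_on_continuous[OF sm(2)]
    by (auto intro!: continuous_on_add continuous_poly_nolin[OF pR] continuous_Q elim: continuous_on_subset)
  have g_meas [measurable]: "g n \<in> borel_measurable borel" for n
    unfolding g_def using V(1) by (intro nexp_measurable contV) simp
  have g_norm: "norm (g n \<eta>) \<le> 1" for n \<eta>
    using nn[of \<eta>] V(3) by (auto simp: g_def indicator_def norm_nexp)
  have [measurable]: "(\<lambda>x. cis (- Q x)) \<in> borel_measurable borel"
    by (intro borel_measurable_continuous_onI continuous_intros continuous_Q)
  have ind_int: "integrable lborel (indicat_real {x. \<bar>Q x\<bar> < \<tau>})"
    using emeasure_sublevel_finite[of \<tau>] sublevel_meas by (intro integrable_real_indicator) auto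
  have D0: "D \<longlonglongrightarrow> 0"
    unfolding D_def
  proof (rule tendsto_integral_Suc)
    show "integrable lborel (\<lambda>x. indicat_real {x. \<bar>Q x\<bar> < \<tau>} x * 2)" using ind_int by simp
    show "(\<lambda>x. indicat_real {x. \<bar>Q x\<bar> < \<tau>} x * norm (g n (T n *v x) - cis (- Q x))) \<in> borel_measurable lborel" for n
      by measurable
    show "\<bar>indicat_real {x. \<bar>Q x\<bar> < \<tau>} x * norm (g n (T n *v x) - cis (- Q x))\<bar> \<le> indicat_real {x. \<bar>Q x\<bar> < \<tau>} x * 2" for n x
      using norm_triangle_ineq4[of "g n (T n *v x)" "cis (- Q x)"] g_norm[of n "T n *v x"]
      by (auto simp: abs_mult indicator_def)
    have "(\<lambda>n. norm (g n (T n *v x) - cis (- Q x))) \<longlonglongrightarrow> 0" for x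
    proof -
      \<comment> \<open>Here k > 1 enters: along the dilation R is of order n^(-k) and Rt at most
        so, hence both still vanish after multiplication by n, and the damping is absent from the
        limit.\<close>
      have pk: "(\<lambda>n. real n * (1 / real n) powr k) \<longlonglongrightarrow> 0" using k by real_asymp
      have Tk: "tpow ((1 / real n) powr k) ((1 / k) *\<^sub>R E) = T n" if "n > 0" for n
        using that k by (simp add: T_def tpow_divide powr_powr)
      have Tn: "Q (T n *v x) = Q x / real n" "R (T n *v x) = (1 / real n) powr k * R x" if "n > 0" for n
      proof -
        show "Q (T n *v x) = Q x / real n" using that Q_tpow[of "1 / real n" x] by (simp add: T_def)
        have "R (tpow ((1 / real n) powr k) ((1 / k) *\<^sub>R E) *v x) = (1 / real n) powr k * R x"
          using R(2) that unfolding hom_wrt_def by simp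
        then show "R (T n *v x) = (1 / real n) powr k * R x" by (simp only: Tk[OF that])
      qed
      have "(\<lambda>n. (real n * (1 / real n) powr k) * R x) \<longlonglongrightarrow> 0" by (rule tendsto_mult_left_zero[OF pk])
      moreover have "\<forall>\<^sub>F n in sequentially. (real n * (1 / real n) powr k) * R x = real n * R (T n *v x)"
        using eventually_gt_at_top[of 0] by eventually_elim (simp only: Tn mult.assoc)
      ultimately have l1: "(\<lambda>n. real n * R (T n *v x)) \<longlonglongrightarrow> 0" by (rule Lim_transform_eventually)
      obtain \<sigma> where \<sigma>: "\<sigma> > 0" "\<And>t y. 0 < t \<Longrightarrow> t < \<sigma> \<Longrightarrow> y \<in> {x} \<Longrightarrow> \<bar>Rt (tpow t ((1 / k) *\<^sub>R E) *v y)\<bar> \<le> 1 * t"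
        by (rule subhomD[OF strong_subhom_imp_subhom[OF ssR] zero_less_one compact_sing], rule that)
      have "(\<lambda>n. (1 / real n) powr k) \<longlonglongrightarrow> 0" using k by real_asymp
      then have "\<forall>\<^sub>F n in sequentially. (1 / real n) powr k < \<sigma>" using \<sigma>(1) by (rule order_tendstoD)
      then have "\<forall>\<^sub>F n in sequentially. norm (real n * Rt (T n *v x)) \<le> real n * (1 / real n) powr k"
        using eventually_gt_at_top[of 0]
      proof eventually_elim
        case (elim n)
        have "\<bar>Rt (T n *v x)\<bar> \<le> (1 / real n) powr k"
          using \<sigma>(2)[of "(1 / real n) powr k" x] elim by (simp add: Tk)
        then show ?case by (simp add: abs_mult mult_left_mono)
      qed
      from Lim_null_comparison[OF this pk] have l2: "(\<lambda>n. real n * Rt (T n *v x)) \<longlonglongrightarrow> 0" .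
      have l3: "(\<lambda>n. real n * Qt (T n *v x)) \<longlonglongrightarrow> 0"
        unfolding T_def by (rule subhom_pointwise_limit[OF strong_subhom_imp_subhom[OF ssQ]])
      let ?w = "\<lambda>n. exp (- (of_real (real n * R (T n *v x) + real n * Rt (T n *v x)) + \<i> * of_real (Q x + real n * Qt (T n *v x))))"
      have "?w \<longlonglongrightarrow> exp (- (of_real (0 + 0) + \<i> * of_real (Q x + 0)))"
        by (intro tendsto_intros l1 l2 l3)
      then have w: "?w \<longlonglongrightarrow> cis (- Q x)" by (simp add: cis_conv_exp)
      have "(\<lambda>n. \<bar>Q x\<bar> / real n) \<longlonglongrightarrow> 0" by real_asymp
      then have "\<forall>\<^sub>F n in sequentially. \<bar>Q x\<bar> / real n < \<delta>" using \<delta>(1) by (rule order_tendstoD)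
      then have "\<forall>\<^sub>F n in sequentially. ?w n = g n (T n *v x)"
        using eventually_gt_at_top[of 0]
      proof eventually_elim
        case (elim n)
        then have "T n *v x \<in> V" by (simp add: V_def Tn)
        then have gn: "g n (T n *v x) = nexp n ?A ?B (T n *v x)" by (simp add: g_def)
        have e1: "real n * R (T n *v x) + real n * Rt (T n *v x) = real n * ?A (T n *v x)"
          by (simp add: distrib_left)
        have e2: "Q x + real n * Qt (T n *v x) = real n * ?B (T n *v x)"
          using elim by (simp add: Tn distrib_left)
        show ?case unfolding gn nexp_def e1 e2 of_real_mult by (simp add: algebra_simps)
      qed
      with w have "(\<lambda>n. g n (T n *v x)) \<longlonglongrightarrow> cis (- Q x)" by (rule Lim_transform_eventually)
      from tendsto_norm[OF tendsto_diff[OF this tendsto_const[of "cis (- Q x)"]]] show ?thesis by simp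
    qed
    then show "AE x in lborel. (\<lambda>n. indicat_real {x. \<bar>Q x\<bar> < \<tau>} x * norm (g n (T n *v x) - cis (- Q x))) \<longlonglongrightarrow> 0"
      by (intro AE_I2 tendsto_mult_right_zero)
  qed
  have key: "norm (cpow \<phi> n x - fhat \<phi> \<xi>0 ^ n * cis (- (lat x \<bullet> \<xi>0)) * H_im (real n) Q (lat x - real n *\<^sub>R \<alpha>))
      \<le> \<rho> ^ n + real n powr (- mu (\<lambda>\<xi>. \<bar>Q \<xi>\<bar>)) * (\<epsilon> / 4 + D n + \<epsilon> / 4)"
    if n: "n > 0" and n\<tau>: "\<tau> \<le> real n * \<delta>" and \<kappa>: "norm \<kappa> \<le> B"
      and y: "lat x - real n *\<^sub>R \<alpha> = tpow (real n) (transpose E) *v \<kappa>" for n x \<kappa>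
  proof -
    let ?C = "(1 / (2 * pi)) ^ CARD('d)" and ?m = "real n powr (- mu (\<lambda>\<xi>. \<bar>Q \<xi>\<bar>))"
    let ?y = "lat x - real n *\<^sub>R \<alpha>"
    let ?G = "\<lambda>x. nexp n ?A ?B (T n *v x) * cis (- (\<kappa> \<bullet> x))"
    have n0: "real n > 0" using n by simp
    have yT: "?y \<bullet> (T n *v z) = \<kappa> \<bullet> z" for z
      unfolding y T_def by (rule inner_tpow_transpose[OF n0])
    have cm: "(\<lambda>\<eta>. cis (- (w \<bullet> \<eta>))) \<in> borel_measurable borel" for w :: "real^'d"
      by (intro borel_measurable_continuous_onI continuous_intros)
    have "(\<lambda>\<eta>. g n \<eta> * cis (- (?y \<bullet> \<eta>))) \<in> borel_measurable borel"
      by (intro borel_measurable_times g_meas cm)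
    then have mV: "(\<lambda>\<eta>. indicator {x. \<bar>Q x\<bar> < \<delta>} \<eta> *\<^sub>R (nexp n ?A ?B \<eta> * cis (- (?y \<bullet> \<eta>)))) \<in> borel_measurable borel"
      by (simp only: g_def V_def mult_scaleR_left)
    have I: "(LINT \<eta>:V|lborel. exp (- (real n * (of_real (R \<eta> + Rt \<eta>) + \<i> * of_real (Q \<eta> + Qt \<eta>)))) * cis (- (?y \<bullet> \<eta>)))
        = ?m *\<^sub>R (LINT z:{x. \<bar>Q x\<bar> < real n * \<delta>}|lborel. ?G z)"
    proof -
      have Tn: "tpow (1 / real n) E = T n" by (simp add: T_def)
      show ?thesis using sublevel_integral_rescale[OF n0 mV] unfolding Tn yT by (simp only: nexp_def V_def)
    qed
    have QT: "\<bar>Q (T n *v z)\<bar> = \<bar>Q z\<bar> / real n" for z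
      using P_tpow[of "1 / real n" z] n0 by (simp add: T_def)
    have gG: "g n (T n *v z) * cis (- (\<kappa> \<bullet> z)) = ?G z" if "\<bar>Q z\<bar> < real n * \<delta>" for z
      using that n0 by (simp add: g_def V_def QT pos_divide_less_eq mult.commute)
    let ?g' = "\<lambda>z. g n (T n *v z) * cis (- (\<kappa> \<bullet> z))"
    have g'm: "?g' \<in> borel_measurable borel"
      by (intro borel_measurable_times cm measurable_compose[OF borel_measurable_matrix_vector_mult g_meas])
    have si: "set_integrable lborel S ?g'" if S: "S \<in> sets borel" "bounded S" for S
      by (rule set_integrable_bounded[OF S borel_measurable_scaleR[OF borel_measurable_indicator[OF S(1)] g'm], where B = 1])
         (simp add: norm_mult g_norm)
    let ?S1 = "{x. \<bar>Q x\<bar> < \<tau>}" and ?S2 = "{x. \<tau> \<le> \<bar>Q x\<bar> \<and> \<bar>Q x\<bar> < real n * \<delta>}" and ?S = "{x. \<bar>Q x\<bar> < real n * \<delta>}"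
    have S2: "?S2 \<in> sets borel" by measurable
    have "bounded ?S2" by (rule bounded_subset[OF bounded_sublevel[of "real n * \<delta>"]]) auto
    then have i: "set_integrable lborel ?S1 ?g'" "set_integrable lborel ?S2 ?g'"
      by (intro si sublevel_meas bounded_sublevel S2)+
    have "(LINT z:?S|lborel. ?G z) = (LINT z:?S|lborel. ?g' z)"
      by (rule set_lebesgue_integral_cong) (use gG sublevel_meas in auto)
    also have "\<dots> = (LINT z:?S1 \<union> ?S2|lborel. ?g' z)"
      by (rule arg_cong[where f = "\<lambda>S. LINT z:S|lborel. ?g' z"]) (use n\<tau> in auto)
    also have "\<dots> = (LINT z:?S1|lborel. ?g' z) + (LINT z:?S2|lborel. ?g' z)"
      by (rule set_integral_Un[OF _ i]) auto
    also have "(LINT z:?S2|lborel. ?g' z) = (LINT z:?S2|lborel. ?G z)"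
      by (rule set_lebesgue_integral_cong) (use gG S2 in auto)
    finally have split: "(LINT z:?S|lborel. ?G z) = (LINT z:?S1|lborel. ?g' z) + (LINT z:?S2|lborel. ?G z)" .
    have t1: "norm (LINT z:?S2|lborel. ?G z) \<le> \<epsilon> / 4"
      using tail[OF n \<kappa> \<delta> \<tau>(3) n\<tau>] \<tau>(1) unfolding T_def by linarith
    have t2: "norm (osc \<kappa> \<tau> - L \<kappa>) \<le> \<epsilon> / 4" using L_le[OF \<kappa> \<tau>(4)] \<tau>(2) by linarith
    have t3: "norm ((LINT z:?S1|lborel. ?g' z) - osc \<kappa> \<tau>) \<le> D n"
    proof -
      let ?c = "\<lambda>z. cis (- (Q z + \<kappa> \<bullet> z))"
      have ic: "set_integrable lborel ?S1 ?c"
        by (rule set_integrable_bounded[OF sublevel_meas bounded_sublevel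
              borel_measurable_scaleR[OF borel_measurable_indicator[OF sublevel_meas] cis_measurable], where B = 1]) simp
      have "(LINT z:?S1|lborel. ?g' z) - osc \<kappa> \<tau> = (LINT z:?S1|lborel. ?g' z - ?c z)"
        unfolding osc_def by (rule set_integral_diff(2)[OF i(1) ic, symmetric])
      also have "norm \<dots> \<le> (LINT z:?S1|lborel. norm (?g' z - ?c z))"
        by (rule set_integral_norm_bound[OF set_integral_diff(1)[OF i(1) ic]])
      also have "\<dots> = D n"
      proof -
        have "?g' z - ?c z = (g n (T n *v z) - cis (- Q z)) * cis (- (\<kappa> \<bullet> z))" for z
          by (simp add: left_diff_distrib cis_mult algebra_simps)
        then have "norm (?g' z - ?c z) = norm (g n (T n *v z) - cis (- Q z))" for z
          by (simp only: norm_mult norm_cis mult_1_right)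
        then show ?thesis by (simp only: D_def set_lebesgue_integral_def real_scaleR_def)
      qed
      finally show ?thesis .
    qed
    have "norm ((LINT z:?S|lborel. ?G z) - L \<kappa>) \<le> \<epsilon> / 4 + D n + \<epsilon> / 4"
    proof -
      \<comment> \<open>The three summands are the shell of the perturbed integral, the difference
        on the fixed sublevel set, and the tail of the attractor. D n and the geometric localization
        error take the two remaining quarters of \<epsilon> at the end.\<close>
      have "(LINT z:?S|lborel. ?G z) - L \<kappa> = (LINT z:?S2|lborel. ?G z) + ((LINT z:?S1|lborel. ?g' z) - osc \<kappa> \<tau>) + (osc \<kappa> \<tau> - L \<kappa>)"
        by (simp add: split)
      also have "norm \<dots> \<le> \<epsilon> / 4 + D n + \<epsilon> / 4"
        by (intro norm_triangle_mono t1 t2 t3)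
      finally show ?thesis .
    qed
    note bnd = this
    let ?M = "fhat \<phi> \<xi>0 ^ n * cis (- (lat x \<bullet> \<xi>0))"
    have M1: "norm ?M = 1" using f1 by (simp add: norm_mult norm_power)
    have C1: "norm (?C :: complex) \<le> 1"
      using pi_ge_two by (simp add: norm_power norm_divide power_le_one)
    let ?X = "LINT \<eta>:V|lborel. exp (- (real n * (of_real (R \<eta> + Rt \<eta>) + \<i> * of_real (Q \<eta> + Qt \<eta>)))) * cis (- (?y \<bullet> \<eta>))"
    have H: "H_im (real n) Q ?y = ?C * (?m *\<^sub>R L \<kappa>)"
      unfolding y by (rule H_im_rescale[OF n L[OF \<kappa>]])
    have "norm (?M * (?C * ?X) - ?M * H_im (real n) Q ?y) = norm (?C :: complex) * (?m * norm ((LINT z:?S|lborel. ?G z) - L \<kappa>))"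
      unfolding H I right_diff_distrib[symmetric] norm_mult[of ?M] M1 scaleR_right_diff_distrib[symmetric]
      by (simp add: norm_mult)
    also have "\<dots> \<le> 1 * (?m * (\<epsilon> / 4 + D n + \<epsilon> / 4))"
      by (intro mult_mono mult_left_mono C1 bnd) auto
    finally have "norm (?M * (?C * ?X) - ?M * H_im (real n) Q ?y) \<le> ?m * (\<epsilon> / 4 + D n + \<epsilon> / 4)" by simp
    then show ?thesis by (rule norm_diff_triangle_le[OF \<rho>(3)[of n x]])
  qed
  have "\<forall>\<^sub>F n in sequentially. \<rho> ^ n \<le> (\<epsilon> / 4) * real n powr (- mu (\<lambda>\<xi>. \<bar>Q \<xi>\<bar>))"
    using \<rho> \<epsilon> by (intro geometric_small) auto
  moreover have "\<forall>\<^sub>F n in sequentially. D n < \<epsilon> / 4"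
    using D0 \<epsilon> by (intro order_tendstoD) auto
  moreover have "filterlim (\<lambda>n. real n * \<delta>) at_top sequentially"
    using \<delta>(1) by (intro filterlim_at_top_mult_tendsto_pos[OF tendsto_const] filterlim_real_sequentially)
  then have "\<forall>\<^sub>F n in sequentially. \<tau> \<le> real n * \<delta>" by (simp add: filterlim_at_top)
  moreover have "\<forall>\<^sub>F n in sequentially. n > (0::nat)" by (rule eventually_gt_at_top)
  ultimately show ?thesis
  proof eventually_elim
    case (elim n)
    let ?m = "real n powr (- mu (\<lambda>\<xi>. \<bar>Q \<xi>\<bar>))"
    have "?m * (\<epsilon> / 4 + D n + \<epsilon> / 4) \<le> ?m * (3 * \<epsilon> / 4)"
      using elim(2) by (intro mult_left_mono) auto
    then have "\<rho> ^ n + ?m * (\<epsilon> / 4 + D n + \<epsilon> / 4) \<le> \<epsilon> * ?m"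
      using elim(1) by (simp add: algebra_simps)
    then show ?case using key[OF elim(4,3)] order_trans by blast
  qed
qed

text \<open>For two exponents \<open>E'\<close> and \<open>E\<close> of \<open>Q\<close>, the maps \<open>t^E' t^(-E)\<close> are symmetries of \<open>Q\<close>; they preserve the
  bounded set \<open>{|Q| \<le> 1}\<close> and are therefore uniformly bounded.\<close>

lemma exponent_change_bounded:
  assumes E': "E' \<in> Exp Q"
  obtains c where "c \<ge> 0" "\<And>t \<kappa>. t > 0 \<Longrightarrow>
    norm (tpow (1 / t) (transpose E) *v (tpow t (transpose E') *v \<kappa>)) \<le> c * norm \<kappa>"
proof -
  obtain M where M: "M > 0" "\<And>x. \<bar>Q x\<bar> \<le> 1 \<Longrightarrow> norm x \<le> M"
    using bounded_unit_sublevel by (auto simp: bounded_pos)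
  \<comment> \<open>A ball inside {|Q| < 1} keeps points of level 1 at distance at least m from 0;
    together with the outer radius M this bounds the symmetry by M / m.\<close>
  obtain m where m: "m > 0" "ball 0 m \<subseteq> {x. \<bar>Q x\<bar> < 1}"
    using open_contains_ball[of "{x. \<bar>Q x\<bar> < 1}"] open_sublevel[of 1] zero_mem_sublevel[of 1] by auto
  have S: "norm (tpow t E' *v (tpow (1 / t) E *v v)) \<le> M / m * norm v" if t: "t > 0" for t v
  proof (cases "v = 0")
    case False
    let ?S = "\<lambda>v. tpow t E' *v (tpow (1 / t) E *v v)"
    obtain s where s: "s > 0" "\<bar>Q (s *\<^sub>R v)\<bar> = 1"
      by (rule ray_meets_level[OF False], rule that)
    have "Q (?S (s *\<^sub>R v)) = Q (s *\<^sub>R v)"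
      using E' t Q_tpow[of "1 / t" "s *\<^sub>R v"] by (simp add: Exp_def hom_wrt_def)
    then have "norm (?S (s *\<^sub>R v)) \<le> M" using s by (intro M(2)) simp
    then have 1: "s * norm (?S v) \<le> M" using s(1) by (simp add: matrix_vector_mult_scaleR)
    have "s *\<^sub>R v \<notin> ball 0 m" using subsetD[OF m(2), of "s *\<^sub>R v"] s(2) by force
    then have 2: "m \<le> s * norm v" using s(1) by simp
    have "norm (?S v) \<le> M / s" using 1 s(1) by (simp add: field_simps)
    also have "\<dots> \<le> M / m * norm v" using 2 s(1) m(1) M(1) by (simp add: field_simps)
    finally show ?thesis .
  qed simp
  show ?thesis
  proof (rule that[of "M / m"])
    fix t :: real and \<kappa> :: "real^'d" assume t: "t > 0"
    define w where "w = tpow (1 / t) (transpose E) *v (tpow t (transpose E') *v \<kappa>)"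
    \<comment> \<open>The bound for the symmetry passes to its adjoint by pairing the image w with
      itself and moving both dilations across.\<close>
    have "w \<bullet> w = \<kappa> \<bullet> (tpow t E' *v (tpow (1 / t) E *v w))"
      unfolding w_def transpose_tpow transpose_matrix_vector dot_lmul_matrix ..
    also have "\<dots> \<le> norm \<kappa> * norm (tpow t E' *v (tpow (1 / t) E *v w))" by (rule norm_cauchy_schwarz)
    also have "\<dots> \<le> norm \<kappa> * (M / m * norm w)" by (intro mult_left_mono S[OF t]) simp
    finally have *: "norm w * norm w \<le> (M / m * norm \<kappa>) * norm w"
      by (simp add: dot_square_norm power2_eq_square mult_ac)
    show "norm w \<le> M / m * norm \<kappa>"
    proof (cases "w = 0")
      case False
      then show ?thesis by (intro mult_right_le_imp_le[OF *]) simp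
    qed (use M(1) m(1) in simp)
  qed (use M m in auto)
qed

end

text \<open>The exponent E' in the claim need not be the E of the type condition. An adjoint
  E'-dilation of a point of K is the adjoint E-dilation of a vector that may vary with n but has
  norm at most c M; this is why the previous expansion asks only for a bound on \<kappa>.\<close>

lemma imaginary_type_expansion:
  fixes \<phi> :: "int^'d::finite \<Rightarrow> complex"
  assumes \<phi>: "\<phi> \<in> S_d" and sup: "(SUP \<xi>. norm (fhat \<phi> \<xi>)) = 1" and Om: "Omega \<phi> = {\<xi>0}"
    and type: "im_type \<phi> \<xi>0 \<alpha> Q R" and mu: "mu (\<lambda>\<xi>. \<bar>Q \<xi>\<bar>) < 1"
    and K: "compact K" and E': "E' \<in> Exp Q" and \<epsilon>: "\<epsilon> > 0"
  shows "\<forall>\<^sub>F n in sequentially. \<forall>x.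
     lat x \<in> (\<lambda>k. real n *\<^sub>R \<alpha> + tpow (real n) (transpose E') *v k) ` K \<longrightarrow>
     norm (cpow \<phi> n x - fhat \<phi> \<xi>0 ^ n * cis (- (lat x \<bullet> \<xi>0)) * H_im (real n) Q (lat x - real n *\<^sub>R \<alpha>))
     \<le> \<epsilon> * real n powr (- mu (\<lambda>\<xi>. \<bar>Q \<xi>\<bar>))"
proof -
  obtain U Qt Rt E k where dec: "log_decomp \<phi> \<xi>0 U \<alpha> Q Qt R Rt" and Q: "pos_hom (\<lambda>\<xi>. \<bar>Q \<xi>\<bar>)" "E \<in> Exp (\<lambda>\<xi>. \<bar>Q \<xi>\<bar>)"
    and R: "pos_hom R" "hom_wrt ((1 / k) *\<^sub>R E) R" and k: "1 < k"
    and ssQ: "strong_subhom E 2 Qt" and ssR: "strong_subhom ((1 / k) *\<^sub>R E) 1 Rt"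
    using type unfolding im_type_def by (elim exE conjE)
  have "contracting E" using ssQ by (simp add: strong_subhom_def)
  moreover have "poly_nolin Q" using dec by (simp add: log_decomp_def)
  ultimately interpret contracting_im_hom Q E using Q mu by unfold_locales
  obtain c where c: "c \<ge> 0" "\<And>t \<kappa>. t > 0 \<Longrightarrow>
    norm (tpow (1 / t) (transpose E) *v (tpow t (transpose E') *v \<kappa>)) \<le> c * norm \<kappa>"
    by (rule exponent_change_bounded[OF E'], rule that)
  obtain M where M: "M > 0" "\<And>\<kappa>. \<kappa> \<in> K \<Longrightarrow> norm \<kappa> \<le> M"
    using compact_imp_bounded[OF K] by (auto simp: bounded_pos)
  have "c * M \<ge> 0" using c(1) M(1) by simp
  from imaginary_expansion_contracting[OF \<phi> sup Om dec ssQ ssR R k this \<epsilon>] eventually_gt_at_top[of 0]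
  show ?thesis
  proof eventually_elim
    case (elim n)
    show ?case
    proof (intro allI impI)
      fix x assume "lat x \<in> (\<lambda>k. real n *\<^sub>R \<alpha> + tpow (real n) (transpose E') *v k) ` K"
      then obtain \<kappa> where \<kappa>: "\<kappa> \<in> K" "lat x = real n *\<^sub>R \<alpha> + tpow (real n) (transpose E') *v \<kappa>" by blast
      have n0: "real n > 0" using elim(2) by simp
      let ?w = "tpow (1 / real n) (transpose E) *v (tpow (real n) (transpose E') *v \<kappa>)"
      have "norm ?w \<le> c * norm \<kappa>" by (rule c(2)[OF n0])
      also have "\<dots> \<le> c * M" using M(2)[OF \<kappa>(1)] c(1) by (rule mult_left_mono)
      finally have "norm ?w \<le> c * M" .
      moreover have "lat x - real n *\<^sub>R \<alpha> = tpow (real n) (transpose E) *v ?w"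
        unfolding tpow_inverse(1)[OF n0] using \<kappa>(2) by simp
      ultimately show "norm (cpow \<phi> n x - fhat \<phi> \<xi>0 ^ n * cis (- (lat x \<bullet> \<xi>0)) * H_im (real n) Q (lat x - real n *\<^sub>R \<alpha>))
          \<le> \<epsilon> * real n powr (- mu (\<lambda>\<xi>. \<bar>Q \<xi>\<bar>))"
        using elim(1) by blast
    qed
  qed
qed

theorem theorem1:
  fixes \<phi> :: "int^'d::finite \<Rightarrow> complex" and \<xi>0 :: "real^'d"
  assumes "\<phi> \<in> S_d"
    and "(SUP \<xi>. norm (fhat \<phi> \<xi>)) = 1"
    and "Omega \<phi> = {\<xi>0}"
  shows "(\<forall>\<alpha> Q R. pos_type \<phi> \<xi>0 \<alpha> Q R \<longrightarrow>
            (\<forall>\<epsilon>>0. \<forall>\<^sub>F n in sequentially. \<forall>x.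
               norm (cpow \<phi> n x - fhat \<phi> \<xi>0 ^ n * cis (- (lat x \<bullet> \<xi>0)) *
                     H_pos (real n) (\<lambda>\<xi>. of_real (R \<xi>) + \<i> * of_real (Q \<xi>)) (lat x - real n *\<^sub>R \<alpha>))
               \<le> \<epsilon> * real n powr (- mu R)))
       \<and> (\<forall>\<alpha> Q R. im_type \<phi> \<xi>0 \<alpha> Q R \<and> mu (\<lambda>\<xi>. \<bar>Q \<xi>\<bar>) < 1 \<longrightarrow>
            (\<forall>K E. compact K \<and> E \<in> Exp Q \<longrightarrow>
              (\<forall>\<epsilon>>0. \<forall>\<^sub>F n in sequentially. \<forall>x.
                 lat x \<in> (\<lambda>k. real n *\<^sub>R \<alpha> + tpow (real n) (transpose E) *v k) ` K \<longrightarrow>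
                 norm (cpow \<phi> n x - fhat \<phi> \<xi>0 ^ n * cis (- (lat x \<bullet> \<xi>0)) *
                       H_im (real n) Q (lat x - real n *\<^sub>R \<alpha>))
                 \<le> \<epsilon> * real n powr (- mu (\<lambda>\<xi>. \<bar>Q \<xi>\<bar>)))))"
  using positive_type_expansion[OF assms] imaginary_type_expansion[OF assms] by blast

end
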